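(* Let $(M,g)$, $\Gamma$, $f$, $\psi$ satisfy all the standing assumptions (A1)-(A4) listed in the context. For every $K\ge 0$ there is a constant $C>0$, depending only on $K$ and on the known data $(M,g),\Gamma,f,\nu_0,\psi,\gamma,C_\psi$, with the following property. Let $u\in C^3(M)$ be an admissible solution of $$f(\lambda(\nabla^2 u))=\psi(x,u,\nabla u)\quad\text{on } M$$ with $|u|_{C^0}=\sup_M|u|\le K$. Then for every $x_0\in M$ and every $0<r<1$ such that the geodesic ball $B_r(x_0)$ is contained in $\mathring M$, $$|\nabla u(x_0)|\le \frac{C}{r}.$$
   Context: Standing assumptions. (A1) $(M,g)$ is a smooth compact Riemannian manifold of dimension $n\ge 2$ with nonempty boundary $\partial M$; $\mathring M=M\setminus\partial M$ is its interior; $\nabla$ is the Levi-Civita connection. For a function $u$, $\nabla u$ is its gradient, $\nabla^2u$ its Hessian, and $\lambda(\nabla^2u)\in\mathbb{R}^n$ denotes the eigenvalues of $\nabla^2 u$ with respect to $g$. (A2) $\Gamma\subset\mathbb{R}^n$ is an open convex cone with vertex at the origin, symmetric (invariant under permutations of coordinates), with $\Gamma_n:=\{\lambda\in\mathbb{R}^n:\text{each }\lambda_i>0\}\subseteq\Gamma\ne\mathbb{R}^n$. (A3) $f$ is a smooth function on $\Gamma$, symmetric in $\lambda_1,\dots,\lambda_n$, such that: (i) $f_i:=\partial f/\partial\lambda_i>0$ in $\Gamma$ for all $i$; (ii) $f$ is concave; (iii) $f>0$ in $\Gamma$ and $f=0$ on $\partial\Gamma$ (i.e. $f$ extends continuously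 to $\overline\Gamma$ by $0$ on $\partial \Gamma$); (iv) $f$ is homogeneous of degree one; (v) there is a constant $\nu_0>0$ such that $f_j(\lambda)\ge\nu_0\big(1+\sum_{i=1}^n f_i(\lambda)\big)$ for every $\lambda\in\Gamma$ and every index $j$ with $\lambda_j<0$. (A4) $\psi=\psi(x,z,p)$ is a positive $C^3$ function of $x\in M$, $z\in\mathbb{R}$, $p\in T_xM\cong\mathbb{R}^n$, and there are constants $0<\gamma<1$ and $C_\psi>0$ such that for all $(x,z,p)$ and all indices $i,l$, $$|\psi_{x_i}(x,z,p)|+|\psi_z(x,z,p)|\,|p|+|\psi_{p_l}(x,z,p)|\,|p|^2\le C_\psi|p|^{2+\gamma}.$$ Here components are taken in a local $g$-orthonormal frame, $\psi_{p_l}$ is the derivative in the fibre variable, and $\psi_{x_i}$ is the derivative in $x$ with $z$ fixed and $p$ parallel transported, so that $\nabla_i[\psi(x,u,\nabla u)]=\psi_{x_i}+\psi_z\nabla_iu+\sum_l\psi_{p_l}\nabla_{il}u$. A function $u$ is called an admissible solution of the equation if it solves it and $\lambda(\nabla^2u)(x)\in\Gamma$ for all $x\in M$. *)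

theory Defs
  imports "HOL-Analysis.Analysis"
begin

section \<open>Functions of class \<open>C\<^sup>k\<close> on sets with nonempty interior\<close>

text \<open>All derivatives are taken within \<open>S\<close>.  In this theory \<open>S\<close> is always relatively open in a
  Euclidean space, a half space, a half space times a Euclidean space, or a nondegenerate interval,
  so derivatives within \<open>S\<close> are unique, and at boundary points of the half space they are the
  usual derivatives up to the boundary.\<close>

primrec Ck_on ::
    "nat \<Rightarrow> 'a::real_normed_vector set \<Rightarrow> ('a \<Rightarrow> 'b::real_normed_vector) \<Rightarrow> bool" where
  "Ck_on 0 S f \<longleftrightarrow> continuous_on S f"
| "Ck_on (Suc k) S f \<longleftrightarrow>
     (\<exists>f'. (\<forall>x\<in>S. (f has_derivative f' x) (at x within S)) \<and> (\<forall>v. Ck_on k S (\<lambda>x. f' x v)))"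

definition smooth_on ::
    "'a::real_normed_vector set \<Rightarrow> ('a \<Rightarrow> 'b::real_normed_vector) \<Rightarrow> bool" where
  "smooth_on S f \<longleftrightarrow> (\<forall>k. Ck_on k S f)"

definition partial_deriv ::
    "(real^'n) set \<Rightarrow> 'n::finite \<Rightarrow> (real^'n \<Rightarrow> real) \<Rightarrow> real^'n \<Rightarrow> real" where
  "partial_deriv S i f y = frechet_derivative f (at y within S) (axis i 1)"


section \<open>Smooth manifolds with boundary\<close>

type_synonym ('m, 'n) chart = "'m set \<times> ('m \<Rightarrow> real^'n)"

abbreviation chart_dom :: "('m, 'n::finite) chart \<Rightarrow> 'm set" where
  "chart_dom \<equiv> fst"

abbreviation chart_map :: "('m, 'n::finite) chart \<Rightarrow> 'm \<Rightarrow> real^'n" where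
  "chart_map \<equiv> snd"

definition chart_img :: "('m, 'n::finite) chart \<Rightarrow> (real^'n) set" where
  "chart_img c = chart_map c ` chart_dom c"

definition chart_inv :: "('m, 'n::finite) chart \<Rightarrow> real^'n \<Rightarrow> 'm" where
  "chart_inv c = inv_into (chart_dom c) (chart_map c)"

text \<open>The index \<open>k\<close> of the coordinate defining the half space may depend on the chart.\<close>

definition is_chart :: "'m topology \<Rightarrow> ('m, 'n::finite) chart \<Rightarrow> bool" where
  "is_chart X c \<longleftrightarrow>
     openin X (chart_dom c) \<and>
     (\<exists>k. openin (top_of_set {y. 0 \<le> y $ k}) (chart_img c)) \<and>
     homeomorphic_map (subtopology X (chart_dom c)) (top_of_set (chart_img c)) (chart_map c)"

definition smooth_atlas :: "'m topology \<Rightarrow> ('m, 'n::finite) chart set \<Rightarrow> bool" where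
  "smooth_atlas X A \<longleftrightarrow>
     (\<forall>c\<in>A. is_chart X c) \<and>
     (\<Union>c\<in>A. chart_dom c) = topspace X \<and>
     (\<forall>c\<in>A. \<forall>d\<in>A. smooth_on (chart_map c ` (chart_dom c \<inter> chart_dom d)) (chart_map d \<circ> chart_inv c))"

text \<open>The image of a chart is relatively open in a half space, so a point of it lies on the
  bounding hyperplane iff it is not in the interior (in Euclidean space) of the image.\<close>

definition manifold_boundary :: "'m topology \<Rightarrow> ('m, 'n::finite) chart set \<Rightarrow> 'm set" where
  "manifold_boundary X A =
     {x \<in> topspace X. \<exists>c\<in>A. x \<in> chart_dom c \<and> chart_map c x \<notin> interior (chart_img c)}"

definition manifold_interior :: "'m topology \<Rightarrow> ('m, 'n::finite) chart set \<Rightarrow> 'm set" where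
  "manifold_interior X A = topspace X - manifold_boundary X A"

definition C3_fun :: "('m, 'n::finite) chart set \<Rightarrow> ('m \<Rightarrow> real) \<Rightarrow> bool" where
  "C3_fun A u \<longleftrightarrow> (\<forall>c\<in>A. Ck_on 3 (chart_img c) (u \<circ> chart_inv c))"


section \<open>Tangent vectors\<close>

text \<open>A tangent vector at \<open>x\<close> is a family of coordinate vectors, one for each chart around \<open>x\<close>,
  related by the derivatives of the coordinate changes.  Components in charts not
  containing \<open>x\<close> are set to \<open>0\<close>, so that equality of tangent vectors is equality of functions.\<close>

type_synonym ('m, 'n) tvec = "('m, 'n) chart \<Rightarrow> real^'n"

definition coord_change ::
    "('m, 'n::finite) chart \<Rightarrow> ('m, 'n) chart \<Rightarrow> 'm \<Rightarrow> real^'n \<Rightarrow> real^'n" where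
  "coord_change c d x =
     frechet_derivative (chart_map d \<circ> chart_inv c)
       (at (chart_map c x) within chart_map c ` (chart_dom c \<inter> chart_dom d))"

definition tangent_space :: "('m, 'n::finite) chart set \<Rightarrow> 'm \<Rightarrow> ('m, 'n) tvec set" where
  "tangent_space A x =
     {p. (\<forall>c\<in>A. \<forall>d\<in>A. x \<in> chart_dom c \<inter> chart_dom d \<longrightarrow> p d = coord_change c d x (p c)) \<and>
         (\<forall>c. \<not> (c \<in> A \<and> x \<in> chart_dom c) \<longrightarrow> p c = 0)}"

text \<open>\<open>tvec A c x v\<close> is the tangent vector at \<open>x\<close> whose components in the chart \<open>c\<close> are \<open>v\<close>.\<close>

definition tvec ::
    "('m, 'n::finite) chart set \<Rightarrow> ('m, 'n) chart \<Rightarrow> 'm \<Rightarrow> real^'n \<Rightarrow> ('m, 'n) tvec" where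
  "tvec A c x v = (\<lambda>d. if d \<in> A \<and> x \<in> chart_dom d then coord_change c d x v else 0)"


section \<open>Riemannian metrics\<close>

type_synonym ('m, 'n) metric = "'m \<Rightarrow> ('m, 'n) tvec \<Rightarrow> ('m, 'n) tvec \<Rightarrow> real"

definition metric_matrix ::
    "('m, 'n::finite) chart set \<Rightarrow> ('m, 'n) metric \<Rightarrow> ('m, 'n) chart \<Rightarrow> 'm \<Rightarrow> real^'n^'n" where
  "metric_matrix A g c x = (\<chi> i j. g x (tvec A c x (axis i 1)) (tvec A c x (axis j 1)))"

definition riemannian_metric ::
    "('m, 'n::finite) chart set \<Rightarrow> ('m, 'n) metric \<Rightarrow> bool" where
  "riemannian_metric A g \<longleftrightarrow>
     (\<forall>c\<in>A. \<forall>x\<in>chart_dom c.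
        bilinear (\<lambda>v w. g x (tvec A c x v) (tvec A c x w)) \<and>
        (\<forall>v w. g x (tvec A c x v) (tvec A c x w) = g x (tvec A c x w) (tvec A c x v)) \<and>
        (\<forall>v. v \<noteq> 0 \<longrightarrow> 0 < g x (tvec A c x v) (tvec A c x v))) \<and>
     (\<forall>c\<in>A. \<forall>i j. smooth_on (chart_img c) (\<lambda>y. metric_matrix A g c (chart_inv c y) $ i $ j))"

definition compact_riemannian_manifold_with_boundary ::
    "'m topology \<Rightarrow> ('m, 'n::finite) chart set \<Rightarrow> ('m, 'n) metric \<Rightarrow> bool" where
  "compact_riemannian_manifold_with_boundary X A g \<longleftrightarrow>
     Hausdorff_space X \<and> compact_space X \<and> smooth_atlas X A \<and> riemannian_metric A g \<and>
     manifold_boundary X A \<noteq> {}"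

definition gnorm :: "('m, 'n::finite) metric \<Rightarrow> 'm \<Rightarrow> ('m, 'n) tvec \<Rightarrow> real" where
  "gnorm g x p = sqrt (g x p p)"


section \<open>Levi-Civita connection, gradient, Hessian\<close>

text \<open>\<open>metric_deriv A g c x l i j\<close> is the partial derivative of the component
  \<open>g\<^sub>i\<^sub>j\<close> in the direction of the \<open>l\<close>-th coordinate of the chart \<open>c\<close>.\<close>

definition metric_deriv ::
    "('m, 'n::finite) chart set \<Rightarrow> ('m, 'n) metric \<Rightarrow> ('m, 'n) chart \<Rightarrow> 'm \<Rightarrow> 'n \<Rightarrow> 'n \<Rightarrow> 'n \<Rightarrow> real" where
  "metric_deriv A g c x l i j =
     partial_deriv (chart_img c) l (\<lambda>y. metric_matrix A g c (chart_inv c y) $ i $ j) (chart_map c x)"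

text \<open>\<open>christoffel A g c x k i j\<close> is the \<open>k\<close>-th component of the covariant derivative of the
  \<open>j\<close>-th coordinate field in the direction of the \<open>i\<close>-th one.\<close>

definition christoffel ::
    "('m, 'n::finite) chart set \<Rightarrow> ('m, 'n) metric \<Rightarrow> ('m, 'n) chart \<Rightarrow> 'm \<Rightarrow> 'n \<Rightarrow> 'n \<Rightarrow> 'n \<Rightarrow> real" where
  "christoffel A g c x k i j =
     1/2 * (\<Sum>l\<in>UNIV. matrix_inv (metric_matrix A g c x) $ k $ l *
       (metric_deriv A g c x i j l + metric_deriv A g c x j i l - metric_deriv A g c x l i j))"

definition christoffel_map ::
    "('m, 'n::finite) chart set \<Rightarrow> ('m, 'n) metric \<Rightarrow> ('m, 'n) chart \<Rightarrow> 'm \<Rightarrow>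
     real^'n \<Rightarrow> real^'n \<Rightarrow> real^'n" where
  "christoffel_map A g c x v w =
     (\<chi> k. \<Sum>i\<in>UNIV. \<Sum>j\<in>UNIV. christoffel A g c x k i j * v $ i * w $ j)"

definition grad ::
    "('m, 'n::finite) chart set \<Rightarrow> ('m, 'n) metric \<Rightarrow> ('m \<Rightarrow> real) \<Rightarrow> 'm \<Rightarrow> ('m, 'n) tvec" where
  "grad A g u x =
     (\<lambda>c. if c \<in> A \<and> x \<in> chart_dom c
          then matrix_inv (metric_matrix A g c x) *v
            (\<chi> j. partial_deriv (chart_img c) j (u \<circ> chart_inv c) (chart_map c x))
          else 0)"

text \<open>Components of the covariant Hessian, as a bilinear form, in the chart \<open>c\<close>.\<close>

definition hessian ::
    "('m, 'n::finite) chart set \<Rightarrow> ('m, 'n) metric \<Rightarrow> ('m \<Rightarrow> real) \<Rightarrow> ('m, 'n) chart \<Rightarrow> 'm \<Rightarrow> real^'n^'n" where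
  "hessian A g u c x =
     (\<chi> i j. partial_deriv (chart_img c) i
               (partial_deriv (chart_img c) j (u \<circ> chart_inv c)) (chart_map c x)
            - (\<Sum>k\<in>UNIV. christoffel A g c x k i j *
                 partial_deriv (chart_img c) k (u \<circ> chart_inv c) (chart_map c x)))"

text \<open>The entries of \<open>lam\<close> are the eigenvalues, listed with multiplicity in some order, of the
  bilinear form \<open>H\<close> with respect to the inner product \<open>G\<close>.\<close>

definition eigenvalues_wrt :: "real^'n^'n \<Rightarrow> real^'n^'n \<Rightarrow> real^'n::finite \<Rightarrow> bool" where
  "eigenvalues_wrt G H lam \<longleftrightarrow>
     (\<forall>t. card {i. lam $ i = t} = dim {v. H *v v = t *\<^sub>R (G *v v)})"


section \<open>Riemannian distance and geodesic balls\<close>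

definition piecewise_C1_curve ::
    "'m topology \<Rightarrow> ('m, 'n::finite) chart set \<Rightarrow> (real \<Rightarrow> 'm) \<Rightarrow> bool" where
  "piecewise_C1_curve X A \<sigma> \<longleftrightarrow>
     continuous_map (top_of_set {0..1}) X \<sigma> \<and>
     (\<exists>B. finite B \<and>
        (\<forall>a b. 0 \<le> a \<and> a < b \<and> b \<le> 1 \<and> {a<..<b} \<inter> B = {} \<longrightarrow>
           (\<forall>c\<in>A. Ck_on 1 {t\<in>{a..b}. \<sigma> t \<in> chart_dom c} (chart_map c \<circ> \<sigma>))))"

definition velocity ::
    "('m, 'n::finite) chart set \<Rightarrow> (real \<Rightarrow> 'm) \<Rightarrow> real \<Rightarrow> ('m, 'n) tvec" where
  "velocity A \<sigma> t =
     (\<lambda>c. if c \<in> A \<and> \<sigma> t \<in> chart_dom c then vector_derivative (chart_map c \<circ> \<sigma>) (at t) else 0)"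

definition curve_length ::
    "('m, 'n::finite) chart set \<Rightarrow> ('m, 'n) metric \<Rightarrow> (real \<Rightarrow> 'm) \<Rightarrow> real" where
  "curve_length A g \<sigma> = integral {0..1} (\<lambda>t. gnorm g (\<sigma> t) (velocity A \<sigma> t))"

text \<open>The manifold need not be connected; points in different components have distance \<open>\<infinity>\<close>.\<close>

definition riemannian_dist ::
    "'m topology \<Rightarrow> ('m, 'n::finite) chart set \<Rightarrow> ('m, 'n) metric \<Rightarrow> 'm \<Rightarrow> 'm \<Rightarrow> ereal" where
  "riemannian_dist X A g x y =
     (INF \<sigma> \<in> {\<sigma>. piecewise_C1_curve X A \<sigma> \<and> \<sigma> 0 = x \<and> \<sigma> 1 = y}. ereal (curve_length A g \<sigma>))"

definition geodesic_ball ::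
    "'m topology \<Rightarrow> ('m, 'n::finite) chart set \<Rightarrow> ('m, 'n) metric \<Rightarrow> 'm \<Rightarrow> real \<Rightarrow> 'm set" where
  "geodesic_ball X A g x r = {y \<in> topspace X. riemannian_dist X A g x y < ereal r}"


section \<open>The cone and the operator\<close>

definition admissible_cone :: "(real^'n::finite) set \<Rightarrow> bool" where
  "admissible_cone \<Gamma> \<longleftrightarrow>
     open \<Gamma> \<and> convex \<Gamma> \<and>
     (\<forall>lam\<in>\<Gamma>. \<forall>t>0. t *\<^sub>R lam \<in> \<Gamma>) \<and>
     (\<forall>\<pi>. \<pi> permutes UNIV \<longrightarrow> (\<forall>lam\<in>\<Gamma>. (\<chi> i. lam $ \<pi> i) \<in> \<Gamma>)) \<and>
     {lam. \<forall>i. 0 < lam $ i} \<subseteq> \<Gamma> \<and> \<Gamma> \<noteq> UNIV"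

text \<open>Only the values of \<open>f\<close> on \<open>\<Gamma>\<close> are constrained; its vanishing on the boundary of \<open>\<Gamma>\<close> is
  expressed by limits from within \<open>\<Gamma>\<close>.\<close>

definition admissible_operator :: "(real^'n::finite) set \<Rightarrow> (real^'n \<Rightarrow> real) \<Rightarrow> real \<Rightarrow> bool" where
  "admissible_operator \<Gamma> f \<nu>0 \<longleftrightarrow>
     smooth_on \<Gamma> f \<and>
     (\<forall>\<pi>. \<pi> permutes UNIV \<longrightarrow> (\<forall>lam\<in>\<Gamma>. f (\<chi> i. lam $ \<pi> i) = f lam)) \<and>
     (\<forall>lam\<in>\<Gamma>. \<forall>i. 0 < partial_deriv \<Gamma> i f lam) \<and>
     concave_on \<Gamma> f \<and>
     (\<forall>lam\<in>\<Gamma>. 0 < f lam) \<and>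
     (\<forall>lam0\<in>frontier \<Gamma>. (f \<longlongrightarrow> 0) (at lam0 within \<Gamma>)) \<and>
     (\<forall>lam\<in>\<Gamma>. \<forall>t>0. f (t *\<^sub>R lam) = t * f lam) \<and>
     0 < \<nu>0 \<and>
     (\<forall>lam\<in>\<Gamma>. \<forall>j. lam $ j < 0 \<longrightarrow>
        \<nu>0 * (1 + (\<Sum>i\<in>UNIV. partial_deriv \<Gamma> i f lam)) \<le> partial_deriv \<Gamma> j f lam)"


section \<open>The right-hand side\<close>

type_synonym ('m, 'n) rhs = "'m \<Rightarrow> real \<Rightarrow> ('m, 'n) tvec \<Rightarrow> real"

definition rhs_local ::
    "('m, 'n::finite) chart set \<Rightarrow> ('m, 'n) rhs \<Rightarrow> ('m, 'n) chart \<Rightarrow> (real^'n) \<times> real \<times> (real^'n) \<Rightarrow> real" where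
  "rhs_local A \<psi> c = (\<lambda>(y, z, w). \<psi> (chart_inv c y) z (tvec A c (chart_inv c y) w))"

definition rhs_deriv ::
    "('m, 'n::finite) chart set \<Rightarrow> ('m, 'n) rhs \<Rightarrow> ('m, 'n) chart \<Rightarrow> 'm \<Rightarrow> real \<Rightarrow> real^'n \<Rightarrow>
     (real^'n) \<times> real \<times> (real^'n) \<Rightarrow> real" where
  "rhs_deriv A \<psi> c x z w =
     frechet_derivative (rhs_local A \<psi> c)
       (at (chart_map c x, z, w) within (chart_img c \<times> UNIV \<times> UNIV))"

text \<open>Derivatives of \<open>\<psi>\<close> at \<open>(x, z, p)\<close>, where \<open>p\<close> has components \<open>w\<close> in the chart \<open>c\<close>:
  in \<open>x\<close> along a tangent vector with components \<open>e\<close>, with \<open>z\<close> fixed and \<open>p\<close> parallel transported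
  (components of parallel fields satisfy \<open>w' = - christoffel_map e w\<close>,
  see \<open>rhs_deriv_x_parallel\<close> below); in \<open>z\<close>; and in the fibre direction \<open>e\<close>.\<close>

definition rhs_deriv_x ::
    "('m, 'n::finite) chart set \<Rightarrow> ('m, 'n) metric \<Rightarrow> ('m, 'n) rhs \<Rightarrow> ('m, 'n) chart \<Rightarrow> 'm \<Rightarrow> real \<Rightarrow>
     real^'n \<Rightarrow> real^'n \<Rightarrow> real" where
  "rhs_deriv_x A g \<psi> c x z w e = rhs_deriv A \<psi> c x z w (e, 0, - christoffel_map A g c x e w)"

definition rhs_deriv_z ::
    "('m, 'n::finite) chart set \<Rightarrow> ('m, 'n) rhs \<Rightarrow> ('m, 'n) chart \<Rightarrow> 'm \<Rightarrow> real \<Rightarrow> real^'n \<Rightarrow> real" where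
  "rhs_deriv_z A \<psi> c x z w = rhs_deriv A \<psi> c x z w (0, 1, 0)"

definition rhs_deriv_p ::
    "('m, 'n::finite) chart set \<Rightarrow> ('m, 'n) rhs \<Rightarrow> ('m, 'n) chart \<Rightarrow> 'm \<Rightarrow> real \<Rightarrow>
     real^'n \<Rightarrow> real^'n \<Rightarrow> real" where
  "rhs_deriv_p A \<psi> c x z w e = rhs_deriv A \<psi> c x z w (0, 0, e)"

definition orthonormal_frame ::
    "('m, 'n::finite) chart set \<Rightarrow> ('m, 'n) metric \<Rightarrow> ('m, 'n) chart \<Rightarrow> 'm \<Rightarrow> ('n \<Rightarrow> real^'n) \<Rightarrow> bool" where
  "orthonormal_frame A g c x E \<longleftrightarrow>
     (\<forall>i j. g x (tvec A c x (E i)) (tvec A c x (E j)) = (if i = j then 1 else 0))"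

definition admissible_rhs ::
    "'m topology \<Rightarrow> ('m, 'n::finite) chart set \<Rightarrow> ('m, 'n) metric \<Rightarrow> ('m, 'n) rhs \<Rightarrow> real \<Rightarrow> real \<Rightarrow> bool" where
  "admissible_rhs X A g \<psi> \<gamma> C\<psi> \<longleftrightarrow>
     (\<forall>x\<in>topspace X. \<forall>z. \<forall>p\<in>tangent_space A x. 0 < \<psi> x z p) \<and>
     (\<forall>c\<in>A. Ck_on 3 (chart_img c \<times> UNIV \<times> UNIV) (rhs_local A \<psi> c)) \<and>
     0 < \<gamma> \<and> \<gamma> < 1 \<and> 0 < C\<psi> \<and>
     (\<forall>c\<in>A. \<forall>x\<in>chart_dom c. \<forall>z w E. orthonormal_frame A g c x E \<longrightarrow>
        (\<forall>i l.
           \<bar>rhs_deriv_x A g \<psi> c x z w (E i)\<bar>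
           + \<bar>rhs_deriv_z A \<psi> c x z w\<bar> * gnorm g x (tvec A c x w)
           + \<bar>rhs_deriv_p A \<psi> c x z w (E l)\<bar> * gnorm g x (tvec A c x w) ^ 2
           \<le> C\<psi> * gnorm g x (tvec A c x w) powr (2 + \<gamma>)))"


section \<open>Admissible solutions\<close>

text \<open>The eigenvalues are determined up to order, and \<open>\<Gamma>\<close> and \<open>f\<close> are symmetric, so the choice of
  \<open>lam\<close> is immaterial.\<close>

definition admissible_solution ::
    "('m, 'n::finite) chart set \<Rightarrow> ('m, 'n) metric \<Rightarrow> (real^'n) set \<Rightarrow> (real^'n \<Rightarrow> real) \<Rightarrow>
     ('m, 'n) rhs \<Rightarrow> ('m \<Rightarrow> real) \<Rightarrow> bool" where
  "admissible_solution A g \<Gamma> f \<psi> u \<longleftrightarrow>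
     (\<forall>c\<in>A. \<forall>x\<in>chart_dom c.
        \<exists>lam. eigenvalues_wrt (metric_matrix A g c x) (hessian A g u c x) lam \<and>
              lam \<in> \<Gamma> \<and> f lam = \<psi> x (u x) (grad A g u x))"


section \<open>Consistency of the coordinate expressions\<close>

lemma metric_matrix_symmetric:
  assumes "riemannian_metric A g" "c \<in> A" "x \<in> chart_dom c"
  shows "metric_matrix A g c x $ i $ j = metric_matrix A g c x $ j $ i"
  using assms by (auto simp: riemannian_metric_def metric_matrix_def)

lemma metric_matrix_invertible:
  assumes g: "riemannian_metric A g" and c: "c \<in> A" "x \<in> chart_dom c"
  shows "invertible (metric_matrix A g c x)"
proof -
  define h where "h = (\<lambda>v w. g x (tvec A c x v) (tvec A c x w))"
  have bl: "bilinear h" and pos: "\<And>v. v \<noteq> 0 \<Longrightarrow> 0 < h v v"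
    using g c by (auto simp: riemannian_metric_def h_def)
  have h_eq: "w \<bullet> (metric_matrix A g c x *v v) = h w v" for v w
  proof -
    have lw: "linear (h a)" "linear (\<lambda>b. h b a)" for a
      using bl by (auto simp: bilinear_def)
    have "h w v = h (\<Sum>i\<in>UNIV. w $ i *\<^sub>R axis i 1) (\<Sum>j\<in>UNIV. v $ j *\<^sub>R axis j 1)"
      using basis_expansion[of w] basis_expansion[of v] by (simp add: scalar_mult_eq_scaleR)
    also have "\<dots> = (\<Sum>i\<in>UNIV. \<Sum>j\<in>UNIV. w $ i * (v $ j * h (axis i 1) (axis j 1)))"
      by (simp add: linear_sum[OF lw(1)] linear_sum[OF lw(2)] linear_cmul[OF lw(1)]
          linear_cmul[OF lw(2)] sum_distrib_left)
         (subst sum.swap, simp add: algebra_simps)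
    finally show ?thesis
      by (simp add: inner_vec_def matrix_vector_mult_def metric_matrix_def h_def sum_distrib_left
          algebra_simps)
  qed
  have "v = 0" if "metric_matrix A g c x *v v = 0" for v
    using h_eq[of v v] pos[of v] that by auto
  then show ?thesis
    unfolding invertible_left_inverse matrix_left_invertible_ker by blast
qed

lemma metric_deriv_symmetric:
  assumes "riemannian_metric A g" "c \<in> A" "x \<in> chart_dom c"
  shows "metric_deriv A g c x l i j = metric_deriv A g c x l j i"
proof -
  have "metric_matrix A g c (chart_inv c y) $ i $ j = metric_matrix A g c (chart_inv c y) $ j $ i"
    if "y \<in> chart_img c" for y
    using that assms
    by (intro metric_matrix_symmetric) (auto simp: chart_img_def chart_inv_def inv_into_into)
  then have "((\<lambda>y. metric_matrix A g c (chart_inv c y) $ i $ j) has_derivative D)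
      (at (chart_map c x) within chart_img c) \<longleftrightarrow>
    ((\<lambda>y. metric_matrix A g c (chart_inv c y) $ j $ i) has_derivative D)
      (at (chart_map c x) within chart_img c)" for D
    using assms(3) by (intro iffI; elim has_derivative_transform[rotated 2]) (auto simp: chart_img_def)
  then show ?thesis
    by (simp add: metric_deriv_def partial_deriv_def frechet_derivative_def)
qed

text \<open>The connection with these Christoffel symbols is torsion free and compatible with the metric,
  that is, it is the Levi-Civita connection.\<close>

lemma christoffel_torsion_free:
  assumes "riemannian_metric A g" "c \<in> A" "x \<in> chart_dom c"
  shows "christoffel A g c x k i j = christoffel A g c x k j i"
  unfolding christoffel_def metric_deriv_symmetric[OF assms, of _ i j]
  by (simp add: algebra_simps)

lemma christoffel_metric_compatible:
  assumes "riemannian_metric A g" "c \<in> A" "x \<in> chart_dom c"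
  shows "metric_deriv A g c x l i j =
    (\<Sum>m\<in>UNIV. christoffel A g c x m l i * metric_matrix A g c x $ m $ j) +
    (\<Sum>m\<in>UNIV. christoffel A g c x m l j * metric_matrix A g c x $ i $ m)"
proof -
  define G where "G = metric_matrix A g c x"
  define d where "d = metric_deriv A g c x"
  have inv: "G ** matrix_inv G = mat 1"
    using someI_ex[OF metric_matrix_invertible[OF assms, unfolded invertible_def]]
    by (simp add: G_def matrix_inv_def)
  have lower: "(\<Sum>m\<in>UNIV. G $ q $ m * christoffel A g c x m a b) = 1/2 * (d a b q + d b a q - d q a b)"
    for a b q
  proof -
    have "(\<Sum>m\<in>UNIV. G $ q $ m * christoffel A g c x m a b) =
      1/2 * (\<Sum>p\<in>UNIV. (\<Sum>m\<in>UNIV. G $ q $ m * matrix_inv G $ m $ p) * (d a b p + d b a p - d p a b))"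
      unfolding christoffel_def G_def[symmetric] d_def[symmetric] sum_distrib_left sum_distrib_right
      by (subst sum.swap) (simp add: mult_ac)
    also have "\<And>p. (\<Sum>m\<in>UNIV. G $ q $ m * matrix_inv G $ m $ p) = (if q = p then 1 else 0)"
      using inv by (simp add: vec_eq_iff matrix_matrix_mult_def mat_def)
    then have "1/2 * (\<Sum>p\<in>UNIV. (\<Sum>m\<in>UNIV. G $ q $ m * matrix_inv G $ m $ p) * (d a b p + d b a p - d p a b))
      = 1/2 * (d a b q + d b a q - d q a b)"
      by (simp add: if_distrib[of "\<lambda>t. t * _"] cong: if_cong)
    finally show ?thesis .
  qed
  have sym: "G $ a $ b = G $ b $ a" "d e a b = d e b a" for a b e
    using metric_matrix_symmetric[OF assms] metric_deriv_symmetric[OF assms]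
    by (auto simp: G_def d_def)
  have "(\<Sum>m\<in>UNIV. christoffel A g c x m l i * G $ m $ j) = 1/2 * (d l i j + d i l j - d j l i)"
    using lower[of j l i] by (simp add: sym(1)[of _ j] mult.commute)
  moreover have "(\<Sum>m\<in>UNIV. christoffel A g c x m l j * G $ i $ m) = 1/2 * (d l j i + d j l i - d i l j)"
    using lower[of i l j] by (simp add: mult.commute)
  ultimately show ?thesis
    using sym(2)[of l i j] by (simp add: G_def d_def field_simps)
qed

text \<open>\<open>rhs_deriv_x\<close> is the derivative of \<open>\<psi>\<close> along any curve \<open>y\<close> starting at \<open>x\<close> with velocity \<open>e\<close>,
  with \<open>z\<close> fixed and the fibre variable \<open>w\<close> parallel (to first order) along \<open>y\<close>.\<close>

lemma rhs_deriv_x_parallel: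
  fixes A :: "('m, 'n::finite) chart set"
  assumes "Ck_on 3 (chart_img c \<times> UNIV \<times> UNIV) (rhs_local A \<psi> c)"
    and "0 \<in> T" and "\<And>t. t \<in> T \<Longrightarrow> y t \<in> chart_img c" and "y 0 = chart_map c x" and "w 0 = w0"
    and y: "(y has_vector_derivative e) (at 0 within T)"
    and w: "(w has_vector_derivative - christoffel_map A g c x e w0) (at 0 within T)"
  shows "((\<lambda>t. rhs_local A \<psi> c (y t, z, w t)) has_vector_derivative rhs_deriv_x A g \<psi> c x z w0 e)
    (at 0 within T)"
proof -
  let ?S = "chart_img c \<times> (UNIV :: real set) \<times> (UNIV :: (real^'n) set)"
  let ?q = "\<lambda>t. (y t, z, w t)"
  have "rhs_local A \<psi> c differentiable (at (chart_map c x, z, w0) within ?S)"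
    using assms(1,2,4) assms(3)[of 0]
    by (auto simp: numeral_3_eq_3 differentiable_def)
  then have D: "(rhs_local A \<psi> c has_derivative rhs_deriv A \<psi> c x z w0) (at (?q 0) within ?S)"
    using assms(4,5) by (simp add: rhs_deriv_def frechet_derivative_works)
  have q: "(?q has_vector_derivative (e, 0, - christoffel_map A g c x e w0)) (at 0 within T)"
    using y w by (intro has_vector_derivative_Pair has_vector_derivative_const)
  have "(rhs_local A \<psi> c has_derivative rhs_deriv A \<psi> c x z w0) (at (?q 0) within ?q ` T)"
    by (rule has_derivative_subset[OF D]) (use assms(3) in auto)
  from vector_derivative_diff_chain_within[OF q this] show ?thesis
    by (simp add: rhs_deriv_x_def o_def)
qed

end

theory Submission
  imports Defs
begin

text \<open>
  In a chart, let \<open>p\<close> be the coordinate gradient of \<open>u\<close>, \<open>|p|\<close> its Euclidean length, and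
  \<open>\<zeta> = R\<^sup>2 - |x - y|\<^sup>2\<close>.  At an interior maximum of \<open>ln |p|\<^sup>2 - ln (K + 1 - u) / 2 + 2 ln \<zeta>\<close> the
  first-order condition forces \<open>\<lambda>\<^sub>i < 0\<close> for some eigendirection \<open>E\<^sub>i\<close> with \<open>(p \<bullet> E\<^sub>i)\<^sup>2 \<ge> c |p|\<^sup>2\<close>, unless
  \<open>|p| \<le> C (1 + R / \<zeta>)\<close>.  Then \<open>f\<^sub>i \<ge> \<nu>\<^sub>0 (1 + \<Sum> f\<^sub>j)\<close>, and the term \<open>\<Sum> f\<^sub>i (p \<bullet> E\<^sub>i)\<^sup>2\<close> produced by the concavity of
  \<open>ln (K + 1 - u)\<close> dominates all errors in the second-order condition, which are at most of order
  \<open>(1 + |p| + R / \<zeta> + R\<^sup>2 / \<zeta>\<^sup>2) \<Sum> f\<^sub>j + |p|\<^sup>1\<^sup>+\<^sup>\<gamma>\<close>.  Since lower-order terms in \<open>p\<close> are harmless, the Euclidean length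
  and plain coordinate derivatives suffice and no curvature identities are needed.

  Only \<open>f \<mu> \<le> \<Sum> f\<^sub>i(\<lambda>) \<mu>\<^sub>\<sigma>\<^sub>(\<^sub>i\<^sub>)\<close>, a consequence of concavity, homogeneity and symmetry, is used to differentiate the
  equation, so eigenvalues need not be differentiable.
\<close>


section \<open>Linear algebra\<close>

text \<open>The weight 1/2 of ln (K + 1 - u) is chosen below 1. For a weight a, the second
  derivative of - a ln (K + 1 - u) in u is 1/a times the square of the first, while the first-order
  condition turns the squared derivative of ln |p|^2 into that same square plus cutoff terms; a < 1
  leaves a positive multiple of (p . E_i)^2. The summand 1 in \<open>\<nu>0 * (1 + ...)\<close> pays
  for the differentiated right-hand side, the only error without a factor \<open>f\<^sub>j\<close>;
  \<gamma> < 1 is decisive there.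

  Between charts and manifold the obstacle is uniformity: the geodesic ball avoids the boundary, but
  its centre may lie arbitrarily close to it. It remains to find, around the centre of a geodesic
  ball of radius r, a coordinate ball of radius \<delta> r of interior points, with \<delta>
  independent of the centre and of r; compactness then leaves finitely many charts.\<close>

lemma bilinear_expand:
  fixes h :: "'a::euclidean_space \<Rightarrow> 'b::euclidean_space \<Rightarrow> real"
  assumes "bilinear h"
  shows "h (x + y) z = h x z + h y z" "h x (w + z) = h x w + h x z"
    "h (x - y) z = h x z - h y z" "h x (w - z) = h x w - h x z"
    "h (c *\<^sub>R x) z = c * h x z" "h x (c *\<^sub>R z) = c * h x z"
    "h (sum a I) z = (\<Sum>i\<in>I. h (a i) z)" "h x (sum b I) = (\<Sum>i\<in>I. h x (b i))"
    "h 0 z = 0" "h x 0 = 0" "h (- x) z = - h x z" "h x (- z) = - h x z"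
proof -
  have l: "linear (\<lambda>u. h u z)" "linear (h x)" for x z using assms by (auto simp: bilinear_def)
  show "h (sum a I) z = (\<Sum>i\<in>I. h (a i) z)" "h x (sum b I) = (\<Sum>i\<in>I. h x (b i))"
    using linear_sum[OF l(1)] linear_sum[OF l(2)] by auto
qed (use assms in \<open>auto simp: bilinear_ladd bilinear_radd bilinear_lsub bilinear_rsub
    bilinear_lmul bilinear_rmul bilinear_lzero bilinear_rzero
    bilinear_lneg bilinear_rneg\<close>)

section \<open>Frames orthonormal for a positive definite form\<close>

definition spd_form :: "('a::euclidean_space \<Rightarrow> 'a \<Rightarrow> real) \<Rightarrow> bool" where
  "spd_form G \<longleftrightarrow> bilinear G \<and> (\<forall>v w. G v w = G w v) \<and> (\<forall>v. v \<noteq> 0 \<longrightarrow> 0 < G v v)"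

definition orthonormal_wrt :: "('a \<Rightarrow> 'a \<Rightarrow> real) \<Rightarrow> ('i \<Rightarrow> 'a) \<Rightarrow> bool" where
  "orthonormal_wrt G E \<longleftrightarrow> (\<forall>i j. G (E i) (E j) = (if i = j then 1 else 0))"

lemma spd_formD:
  assumes "spd_form G"
  shows "bilinear G" "G v w = G w v" "v \<noteq> 0 \<Longrightarrow> 0 < G v v" "linear (G v)"
  using assms by (auto simp: spd_form_def bilinear_def)

text \<open>Gram-Schmidt for \<open>G\<close>, one unit vector per step: as long as
  \<open>k < dim V\<close>, some vector of \<open>V\<close> lies outside the span of the vectors
  found so far.\<close>

lemma orthonormal_subset_of_subspace:
  fixes G :: "'a::euclidean_space \<Rightarrow> 'a \<Rightarrow> real"
  assumes G: "spd_form G" and V: "subspace V" and "k \<le> dim V"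
  shows "\<exists>B\<subseteq>V. finite B \<and> card B = k \<and> (\<forall>a\<in>B. \<forall>b\<in>B. G a b = (if a = b then 1 else 0))"
  using \<open>k \<le> dim V\<close>
proof (induction k)
  case 0
  show ?case by (intro exI[of _ "{}"]) auto
next
  case (Suc k)
  then obtain B where B: "B \<subseteq> V" "finite B" "card B = k"
      "\<And>a b. a \<in> B \<Longrightarrow> b \<in> B \<Longrightarrow> G a b = (if a = b then 1 else 0)"
    by auto
  have "\<not> V \<subseteq> span B"
  proof
    assume "V \<subseteq> span B"
    then have "dim V \<le> card B" using B(2) by (rule dim_le_card)
    then show False using Suc.prems B(3) by simp
  qed
  then obtain v where v: "v \<in> V" "v \<notin> span B" by auto
  define w where "w = v - (\<Sum>b\<in>B. G b v *\<^sub>R b)"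
  have "(\<Sum>b\<in>B. G b v *\<^sub>R b) \<in> span B" by (intro span_sum span_scale span_base)
  then have "w \<noteq> 0" using v(2) by (auto simp: w_def)
  then have pos: "0 < G w w" using G by (simp add: spd_formD)
  have "(\<Sum>b\<in>B. G b v *\<^sub>R b) \<in> V"
    using B(1) V by (intro subspace_sum subspace_mul) auto
  then have wV: "w \<in> V" using v V by (simp add: w_def subspace_diff)
  have orth: "G a w = 0" if "a \<in> B" for a
  proof -
    have "G a w = G a v - (\<Sum>b\<in>B. G b v * G a b)"
      by (simp add: w_def bilinear_expand[OF spd_formD(1)[OF G]])
    also have "(\<Sum>b\<in>B. G b v * G a b) = (\<Sum>b\<in>B. if a = b then G b v else 0)"
      using B(4) that by (intro sum.cong) auto
    finally show ?thesis using B(2) that by simp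
  qed
  define e where "e = (1 / sqrt (G w w)) *\<^sub>R w"
  have ee: "G e e = 1"
    using pos by (simp add: e_def bilinear_expand[OF spd_formD(1)[OF G]])
  have ae: "G a e = 0" if "a \<in> B" for a
    using orth[OF that] by (simp add: e_def bilinear_expand[OF spd_formD(1)[OF G]])
  then have "e \<notin> B" using ee by fastforce
  have ea: "G e a = 0" if "a \<in> B" for a
    using ae[OF that] spd_formD(2)[OF G, of e a] by simp
  show ?case
    using B wV V ee ae ea \<open>e \<notin> B\<close>
    by (intro exI[of _ "insert e B"]) (auto simp: e_def subspace_mul)
qed

lemma spd_form_matrix:
  fixes Gm :: "real^'n^'n"
  assumes "transpose Gm = Gm" "\<And>v. v \<noteq> 0 \<Longrightarrow> 0 < v \<bullet> (Gm *v v)"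
  shows "spd_form (\<lambda>v w. v \<bullet> (Gm *v w))"
proof -
  have "v \<bullet> (Gm *v w) = w \<bullet> (Gm *v v)" for v w
    using dot_lmul_matrix[of v Gm w] assms(1)
    by (metis inner_commute transpose_matrix_vector)
  then show ?thesis
    using assms(2)
    by (auto simp: spd_form_def bilinear_def linear_iff inner_add matrix_vector_right_distrib
        matrix_vector_mult_scaleR)
qed

text \<open>The hypothesis \<^term>\<open>eigenvalues_wrt\<close> already says that the eigenspaces fill the whole space,
  so orthonormal bases of the eigenspaces assemble to a frame and no spectral theorem is needed.\<close>

lemma eigenframe_exists:
  fixes Gm Hm :: "real^'n^'n"
  assumes Gs: "transpose Gm = Gm" and Gp: "\<And>v. v \<noteq> 0 \<Longrightarrow> 0 < v \<bullet> (Gm *v v)"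
    and Hs: "transpose Hm = Hm" and ev: "eigenvalues_wrt Gm Hm lam"
  obtains E where "orthonormal_wrt (\<lambda>v w. v \<bullet> (Gm *v w)) E"
    "\<And>i. Hm *v E i = lam $ i *\<^sub>R (Gm *v E i)"
proof -
  define G where "G = (\<lambda>v w. v \<bullet> (Gm *v w))"
  have G: "spd_form G" unfolding G_def by (rule spd_form_matrix[OF Gs Gp])
  define V where "V t = {v. Hm *v v = t *\<^sub>R (Gm *v v)}" for t
  have V: "subspace (V t)" for t
    unfolding V_def by (rule subspaceI) (auto simp: matrix_vector_right_distrib scaleR_add_right
        matrix_vector_mult_scaleR)
  have "\<exists>B\<subseteq>V t. finite B \<and> card B = dim (V t) \<and> (\<forall>a\<in>B. \<forall>b\<in>B. G a b = (if a = b then 1 else 0))" for t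
    by (rule orthonormal_subset_of_subspace[OF G V order_refl])
  then obtain B where B: "\<And>t. B t \<subseteq> V t" "\<And>t. finite (B t)" "\<And>t. card (B t) = dim (V t)"
      "\<And>t a b. a \<in> B t \<Longrightarrow> b \<in> B t \<Longrightarrow> G a b = (if a = b then 1 else 0)"
    by metis
  \<comment> \<open>Both sets have as many elements as the multiplicity of \<open>t\<close>; gluing
    the bijections over all \<open>t\<close> indexes the eigenvectors by the positions of
    \<open>lam\<close>.\<close>
  have "\<exists>h. bij_betw h {i. lam $ i = t} (B t)" for t
    using ev B(2,3)[of t] by (intro finite_same_card_bij) (auto simp: eigenvalues_wrt_def V_def)
  then obtain h where h: "\<And>t. bij_betw (h t) {i. lam $ i = t} (B t)" by metis
  define E where "E i = h (lam $ i) i" for i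
  have EB: "E i \<in> B (lam $ i)" for i
    using h[of "lam $ i"] by (auto simp: E_def bij_betw_def)
  then have eig: "Hm *v E i = lam $ i *\<^sub>R (Gm *v E i)" for i
    using B(1) by (auto simp: V_def)
  have "G (E i) (E j) = (if i = j then 1 else 0)" for i j
  proof (cases "lam $ i = lam $ j")
    case True
    then have "E i = E j \<longleftrightarrow> i = j"
      using h[of "lam $ j"] by (auto simp: E_def bij_betw_def inj_on_def)
    then show ?thesis using B(4) EB[of i] EB[of j] True by simp
  next
    case False
    have "lam $ j * G (E i) (E j) = E i \<bullet> (Hm *v E j)" by (simp add: eig G_def)
    also have "\<dots> = E j \<bullet> (Hm *v E i)"
      using dot_lmul_matrix[of "E i" Hm "E j"] Hs by (metis inner_commute transpose_matrix_vector)
    also have "\<dots> = lam $ i * G (E j) (E i)" by (simp add: eig G_def)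
    finally have "lam $ j * G (E i) (E j) = lam $ i * G (E i) (E j)"
      using spd_formD(2)[OF G] by metis
    then show ?thesis using False by auto
  qed
  then show thesis using that[of E] eig by (simp add: orthonormal_wrt_def G_def)
qed

text \<open>Taking coefficients and forming linear combinations are linear maps of the same
  finite-dimensional space. Orthonormality makes one composition the identity, hence also the other,
  which is the expansion.\<close>

lemma orthonormal_expansion:
  fixes E :: "'n::finite \<Rightarrow> real^'n"
  assumes G: "spd_form G" and E: "orthonormal_wrt G E"
  shows "v = (\<Sum>j\<in>UNIV. G (E j) v *\<^sub>R E j)"
proof -
  define F where "F x = (\<chi> j. G (E j) x)" for x
  define F' where "F' y = (\<Sum>j\<in>UNIV. y $ j *\<^sub>R E j)" for y :: "real^'n"
  have lF: "linear F"
    using spd_formD(4)[OF G] by (auto simp: linear_iff F_def vec_eq_iff)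
  have lF': "linear F'"
    by (auto simp: linear_iff F'_def scaleR_add_left sum.distrib scaleR_right.sum)
  have "F (F' y) = y" for y
  proof -
    have "F (F' y) $ i = y $ i" for i
      using E by (simp add: F_def F'_def bilinear_expand[OF spd_formD(1)[OF G]] orthonormal_wrt_def
          if_distrib[of "\<lambda>x. _ * x"] cong: if_cong)
    then show ?thesis by (simp add: vec_eq_iff)
  qed
  then have "F' \<circ> F = id"
    using linear_inverse_left[OF lF' lF] by (auto simp: o_def fun_eq_iff)
  then have "F' (F v) = v" by (metis comp_apply id_apply)
  then show ?thesis by (simp add: F_def F'_def)
qed

lemma orthonormal_parseval:
  fixes E :: "'n::finite \<Rightarrow> real^'n"
  assumes G: "spd_form G" and E: "orthonormal_wrt G E"
  shows "G v w = (\<Sum>j\<in>UNIV. G (E j) v * G (E j) w)"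
proof -
  have "G v w = G (\<Sum>j\<in>UNIV. G (E j) v *\<^sub>R E j) w"
    using orthonormal_expansion[OF assms, of v] by simp
  then show ?thesis
    by (simp only: bilinear_expand[OF spd_formD(1)[OF G]])
qed

lemma eigenframe_expansion:
  fixes E :: "'n::finite \<Rightarrow> real^'n"
  assumes G: "spd_form G" and E: "orthonormal_wrt G E" and H: "bilinear H"
    and ev: "\<And>j v. H (E j) v = mu j * G (E j) v"
  shows "H v v = (\<Sum>j\<in>UNIV. mu j * (G (E j) v)\<^sup>2)"
proof -
  have "H v v = H (\<Sum>j\<in>UNIV. G (E j) v *\<^sub>R E j) v"
    using orthonormal_expansion[OF G E, of v] by simp
  then show ?thesis
    by (simp only: bilinear_expand[OF H] ev) (simp add: power2_eq_square mult_ac)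
qed

section \<open>The assignment problem with product costs\<close>

lemma finite_minimizer:
  fixes h :: "'a \<Rightarrow> real"
  assumes "finite S" "S \<noteq> {}"
  obtains x where "x \<in> S" "\<And>y. y \<in> S \<Longrightarrow> h x \<le> h y"
proof -
  have "Min (h ` S) \<in> h ` S" using assms by (intro Min_in) auto
  then obtain x where "x \<in> S" "h x = Min (h ` S)" by auto
  then show thesis using that[of x] assms by simp
qed

text \<open>The function \<open>a\<close> plays the role of a concave function of \<open>p\<close> with supergradient \<open>q\<close>.\<close>

lemma opposite_order_potential:
  fixes P Q :: real and p q :: "'i \<Rightarrow> real"
  assumes "finite I"
    and "\<And>i j. i \<in> I \<Longrightarrow> j \<in> I \<Longrightarrow> (p i - p j) * (q i - q j) \<le> 0"
    and "\<And>i. i \<in> I \<Longrightarrow> \<bar>p i\<bar> \<le> P" "\<And>i. i \<in> I \<Longrightarrow> \<bar>q i\<bar> \<le> Q"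
  shows "\<exists>a. (\<forall>i\<in>I. \<forall>j\<in>I. a j \<le> a i + (p j - p i) * q i) \<and> (\<forall>i\<in>I. \<bar>a i\<bar> \<le> 2 * P * Q * card I)"
  using assms
proof (induction "card I" arbitrary: I)
  case 0
  then show ?case by auto
next
  case (Suc k)
  then have fin: "finite I" and ne: "I \<noteq> {}" by auto
  define pm where "pm = Max (p ` I)"
  define N where "N = {i\<in>I. p i = pm}"
  have "pm \<in> p ` I" unfolding pm_def using fin ne by (intro Max_in) auto
  then have "N \<noteq> {}" by (auto simp: N_def)
  moreover have "finite N" using fin by (simp add: N_def)
  \<comment> \<open>The index removed in the induction has maximal \<open>p\<close> and, among
    those, minimal \<open>q\<close>; by opposite ordering its \<open>q\<close> is then minimal
    overall.\<close>
  ultimately obtain n where n: "n \<in> N" "\<And>i. i \<in> N \<Longrightarrow> q n \<le> q i"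
    by (meson finite_minimizer)
  have nI: "n \<in> I" using n by (simp add: N_def)
  have pn: "p i \<le> p n" if "i \<in> I" for i
    using that n fin by (auto simp: N_def pm_def)
  have qn: "q n \<le> q i" if "i \<in> I" for i
  proof (cases "p i = p n")
    case True
    then show ?thesis using n that by (auto simp: N_def)
  next
    case False
    then have "p i < p n" using pn that by force
    then show ?thesis using Suc.prems(2)[OF that nI] by (simp add: mult_le_0_iff)
  qed
  let ?J = "I - {n}"
  have cJ: "k = card ?J" using Suc.hyps(2) nI fin by simp
  have "\<exists>a. (\<forall>i\<in>?J. \<forall>j\<in>?J. a j \<le> a i + (p j - p i) * q i) \<and> (\<forall>i\<in>?J. \<bar>a i\<bar> \<le> 2 * P * Q * card ?J)"
    by (rule Suc.hyps(1)[OF cJ]) (use Suc.prems fin in auto)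
  then obtain a where "\<forall>i\<in>?J. \<forall>j\<in>?J. a j \<le> a i + (p j - p i) * q i"
      "\<forall>i\<in>?J. \<bar>a i\<bar> \<le> 2 * P * Q * card ?J"
    by blast
  then have a: "\<And>i j. i \<in> ?J \<Longrightarrow> j \<in> ?J \<Longrightarrow> a j \<le> a i + (p j - p i) * q i"
      "\<And>i. i \<in> ?J \<Longrightarrow> \<bar>a i\<bar> \<le> 2 * P * Q * k"
    unfolding cJ by blast+
  have PQ: "0 \<le> P" "0 \<le> Q" using Suc.prems(3,4)[OF nI] by linarith+
  show ?case
  proof (cases "?J = {}")
    case True
    then have "I = {n}" using nI by auto
    then show ?thesis using PQ by (intro exI[of _ "\<lambda>_. 0"]) auto
  next
    case False
    \<comment> \<open>\<open>b i\<close> is the value at \<open>p n\<close> of the affine majorant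
      belonging to \<open>i\<close>. The new value of \<open>a\<close> at \<open>n\<close> is the
      least of these, the largest one that the constraints allow. It differs from an old value by at
      most \<open>2 * P * Q\<close>, which is the origin of the factor \<open>card I\<close> in the
      bound.\<close>
    define b where "b i = a i + (p n - p i) * q i" for i
    have "finite ?J" using fin by simp
    with False obtain m where m: "m \<in> ?J" "\<And>i. i \<in> ?J \<Longrightarrow> b m \<le> b i"
      by (meson finite_minimizer)
    define a' where "a' = a(n := b m)"
    have 1: "a' j \<le> a' i + (p j - p i) * q i" if i: "i \<in> I" and j: "j \<in> I" for i j
    proof (cases "i = n")
      case True
      show ?thesis
      proof (cases "j = n")
        case True
        then show ?thesis using \<open>i = n\<close> by simp
      next
        case False
        then have jJ: "j \<in> ?J" using j by simp
        have "0 \<le> (p n - p j) * (q m - q n)" using pn[OF j] qn m(1) by simp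
        moreover have "a j \<le> a m + (p j - p m) * q m" using a(1)[OF m(1) jJ] .
        ultimately show ?thesis
          using \<open>i = n\<close> False by (simp add: a'_def b_def algebra_simps)
      qed
    next
      case False
      then have iJ: "i \<in> ?J" using i by simp
      show ?thesis
      proof (cases "j = n")
        case True
        then show ?thesis using m(2)[OF iJ] False by (simp add: a'_def b_def)
      next
        case False
        then show ?thesis using a(1)[of i j] iJ j \<open>i \<noteq> n\<close> by (simp add: a'_def)
      qed
    qed
    have "\<bar>(p n - p m) * q m\<bar> \<le> 2 * P * Q"
    proof -
      have "\<bar>p n - p m\<bar> \<le> 2 * P" using Suc.prems(3)[OF nI] Suc.prems(3)[of m] m(1) by simp
      then show ?thesis
        using Suc.prems(4)[of m] m(1) PQ by (simp add: abs_mult mult_mono)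
    qed
    then have bm: "\<bar>b m\<bar> \<le> 2 * P * Q * card I"
      using a(2)[OF m(1)] Suc.hyps(2)[symmetric] by (simp add: b_def algebra_simps)
    have "2 * P * Q * k \<le> 2 * P * Q * card I"
      using PQ Suc.hyps(2)[symmetric] by (intro mult_left_mono) auto
    then have "\<bar>a' i\<bar> \<le> 2 * P * Q * card I" if "i \<in> I" for i
      using that a(2)[of i] bm by (auto simp: a'_def)
    then show ?thesis using 1 by blast
  qed
qed

text \<open>Linear programming duality for assignments. By an exchange argument a minimizing
  permutation pairs \<open>p\<close> and \<open>q\<close> in opposite order, and the potential of
  that pairing is an optimal dual solution. The bounds on \<open>a\<close> and \<open>b\<close>
  depend on \<open>P\<close>, \<open>Q\<close> and the dimension only; they make the later estimate
  stable when row and column sums are merely close to 1.\<close>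

lemma assignment_dual:
  fixes P Q :: real and p q :: "'n::finite \<Rightarrow> real"
  assumes p: "\<And>i. \<bar>p i\<bar> \<le> P" and q: "\<And>i. \<bar>q i\<bar> \<le> Q"
  obtains \<sigma> a b where "\<sigma> permutes UNIV" "\<And>i j. a i + b j \<le> p i * q j"
    "(\<Sum>i\<in>UNIV. p i * q (\<sigma> i)) = (\<Sum>i\<in>UNIV. a i) + (\<Sum>j\<in>UNIV. b j)"
    "\<And>i. \<bar>a i\<bar> \<le> 2 * P * Q * CARD('n)" "\<And>j. \<bar>b j\<bar> \<le> P * Q + 2 * P * Q * CARD('n)"
proof -
  have "finite {\<sigma>. \<sigma> permutes (UNIV :: 'n set)}" by (rule finite_permutations) simp
  moreover have "{\<sigma>. \<sigma> permutes (UNIV :: 'n set)} \<noteq> {}" using permutes_id by blast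
  ultimately obtain \<sigma> where \<sigma>: "\<sigma> permutes (UNIV :: 'n set)"
      "\<And>\<tau>. \<tau> permutes (UNIV :: 'n set) \<Longrightarrow> (\<Sum>i\<in>UNIV. p i * q (\<sigma> i)) \<le> (\<Sum>i\<in>UNIV. p i * q (\<tau> i))"
    by (rule finite_minimizer[where h = "\<lambda>\<sigma>. \<Sum>i\<in>UNIV. p i * q (\<sigma> i)"]) (rule that, auto)
  define r where "r i = q (\<sigma> i)" for i
  have opp: "(p i - p j) * (r i - r j) \<le> 0" for i j
  proof (cases "i = j")
    case False
    let ?\<tau> = "\<sigma> \<circ> Transposition.transpose i j"
    have "?\<tau> permutes UNIV"
      using \<sigma>(1) permutes_swap_id[of i UNIV j] by (intro permutes_compose) auto
    then have le: "(\<Sum>k\<in>UNIV. p k * r k) \<le> (\<Sum>k\<in>UNIV. p k * r (Transposition.transpose i j k))"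
      using \<sigma>(2)[of ?\<tau>] by (simp add: r_def)
    have "(\<Sum>k\<in>UNIV. p k * s k) = p i * s i + p j * s j + (\<Sum>k\<in>UNIV - {i, j}. p k * s k)" for s
      using False by (subst sum.subset_diff[of "{i, j}"]) auto
    from this[of r] this[of "\<lambda>k. r (Transposition.transpose i j k)"]
    have "p i * r i + p j * r j \<le> p i * r j + p j * r i"
      using le by (simp add: transpose_apply_other)
    then show ?thesis by (simp add: algebra_simps)
  qed simp
  obtain a where a: "\<And>i j. a j \<le> a i + (p j - p i) * r i" "\<And>i. \<bar>a i\<bar> \<le> 2 * P * Q * CARD('n)"
    using opposite_order_potential[of UNIV p r P Q] opp p q by (auto simp: r_def)
  define \<tau> where "\<tau> = inv \<sigma>"
  have inv: "\<sigma> (\<tau> j) = j" "\<tau> (\<sigma> i) = i" for i j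
    using \<sigma>(1) by (simp_all add: \<tau>_def permutes_inverses)
  \<comment> \<open>Complementary slackness: \<open>b\<close> is determined by equality at the pairs
    \<open>(\<tau> j, j)\<close> of the minimizer.\<close>
  define b where "b j = p (\<tau> j) * q j - a (\<tau> j)" for j
  have dual: "a i + b j \<le> p i * q j" for i j
    using a(1)[of i "\<tau> j"] by (simp add: b_def r_def inv algebra_simps)
  have tight: "(\<Sum>i\<in>UNIV. p i * q (\<sigma> i)) = (\<Sum>i\<in>UNIV. a i) + (\<Sum>j\<in>UNIV. b j)"
  proof -
    have "(\<Sum>j\<in>UNIV. b j) = (\<Sum>i\<in>UNIV. b (\<sigma> i))"
      using sum.permute[OF \<sigma>(1), of b] by (simp add: o_def)
    then show ?thesis by (simp add: b_def inv sum_subtractf)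
  qed
  have bound: "\<bar>b j\<bar> \<le> P * Q + 2 * P * Q * CARD('n)" for j
  proof -
    have "\<bar>p (\<tau> j) * q j\<bar> \<le> P * Q"
      using p[of "\<tau> j"] q[of j] abs_ge_zero[of "p (\<tau> j)"] by (simp add: abs_mult mult_mono)
    then show ?thesis using a(2)[of "\<tau> j"] by (simp add: b_def)
  qed
  show thesis by (rule that[OF \<sigma>(1) dual tight a(2) bound])
qed

text \<open>Both sides are the trace of (A - 1)^2, once for A = M M^T and once for A = M^T M, and
  the traces of A and of A^2 are the same for the two.\<close>

lemma frobenius_gram_eq:
  fixes M :: "'n::finite \<Rightarrow> 'n \<Rightarrow> real"
  shows "(\<Sum>j\<in>UNIV. \<Sum>k\<in>UNIV. ((\<Sum>i\<in>UNIV. M j i * M k i) - (if j = k then 1 else 0))\<^sup>2)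
       = (\<Sum>i\<in>UNIV. \<Sum>l\<in>UNIV. ((\<Sum>j\<in>UNIV. M j i * M j l) - (if i = l then 1 else 0))\<^sup>2)"
proof -
  have expand: "(\<Sum>j\<in>UNIV. \<Sum>k\<in>UNIV. (S j k - (if j = k then 1 else 0))\<^sup>2)
      = (\<Sum>j\<in>UNIV. \<Sum>k\<in>UNIV. (S j k)\<^sup>2) - 2 * (\<Sum>j\<in>UNIV. S j j) + CARD('n)"
    for S :: "'n \<Rightarrow> 'n \<Rightarrow> real"
  proof -
    have "(S j k - (if j = k then 1 else 0))\<^sup>2
        = (S j k)\<^sup>2 - (if j = k then 2 * S j k else 0) + (if j = k then 1 else 0)" for j k
      by (simp add: power2_diff)
    then show ?thesis
      by (simp add: sum.distrib sum_subtractf sum_distrib_left)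
  qed
  have "(\<Sum>j\<in>UNIV. \<Sum>k\<in>UNIV. (\<Sum>i\<in>UNIV. M j i * M k i)\<^sup>2)
      = (\<Sum>j\<in>UNIV. \<Sum>k\<in>UNIV. \<Sum>i\<in>UNIV. \<Sum>l\<in>UNIV. M j i * M k i * (M j l * M k l))"
    by (simp add: power2_eq_square sum_product)
  also have "\<dots> = (\<Sum>i\<in>UNIV. \<Sum>l\<in>UNIV. \<Sum>j\<in>UNIV. \<Sum>k\<in>UNIV. M j i * M k i * (M j l * M k l))"
    by (simp add: sum.cartesian_product)
      (rule sum.reindex_bij_witness[of _ "\<lambda>(i, l, j, k). (j, k, i, l)" "\<lambda>(j, k, i, l). (i, l, j, k)"], auto)
  also have "\<dots> = (\<Sum>i\<in>UNIV. \<Sum>l\<in>UNIV. (\<Sum>j\<in>UNIV. M j i * M j l)\<^sup>2)"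
    by (simp add: power2_eq_square sum_product mult_ac)
  finally have 1: "(\<Sum>j\<in>UNIV. \<Sum>k\<in>UNIV. (\<Sum>i\<in>UNIV. M j i * M k i)\<^sup>2)
      = (\<Sum>i\<in>UNIV. \<Sum>l\<in>UNIV. (\<Sum>j\<in>UNIV. M j i * M j l)\<^sup>2)" .
  have 2: "(\<Sum>j\<in>UNIV. \<Sum>i\<in>UNIV. M j i * M j i) = (\<Sum>i\<in>UNIV. \<Sum>j\<in>UNIV. M j i * M j i)"
    by (rule sum.swap)
  show ?thesis unfolding expand using 1 2 by simp
qed

text \<open>\<open>e\<close> measures the deviation of the columns from orthonormality. The sums
  over a column are diagonal entries of their Gram matrix. The sums over a row belong to the Gram
  matrix of the rows, whose Frobenius distance from 1 is the same and hence at most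
  \<open>e\<close>. So the squared entries are nearly doubly stochastic.\<close>

lemma column_sums_near_one:
  fixes M :: "'n::finite \<Rightarrow> 'n \<Rightarrow> real"
  defines "e \<equiv> (\<Sum>i\<in>UNIV. \<Sum>l\<in>UNIV. \<bar>(\<Sum>j\<in>UNIV. M j i * M j l) - (if i = l then 1 else 0)\<bar>)"
  shows "\<bar>(\<Sum>i\<in>UNIV. (M j i)\<^sup>2) - 1\<bar> \<le> e" "\<bar>(\<Sum>j\<in>UNIV. (M j i)\<^sup>2) - 1\<bar> \<le> e"
proof -
  define S where "S i l = (\<Sum>j\<in>UNIV. M j i * M j l) - (if i = l then 1 else 0)" for i l
  define T where "T j k = (\<Sum>i\<in>UNIV. M j i * M k i) - (if j = k then 1 else 0)" for j k
  have e: "e = (\<Sum>x\<in>UNIV. \<bar>S (fst x) (snd x)\<bar>)"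
    by (simp add: e_def S_def sum.cartesian_product case_prod_unfold)
  have e0: "0 \<le> e" by (simp add: e sum_nonneg)
  have "\<bar>S i i\<bar> \<le> (\<Sum>x\<in>UNIV. \<bar>S (fst x) (snd x)\<bar>)" for i
    using member_le_sum[of "(i, i)" UNIV "\<lambda>x. \<bar>S (fst x) (snd x)\<bar>"] by simp
  then show "\<bar>(\<Sum>j\<in>UNIV. (M j i)\<^sup>2) - 1\<bar> \<le> e" by (simp add: e S_def power2_eq_square)
  have "(T j j)\<^sup>2 \<le> (\<Sum>x\<in>UNIV. (T (fst x) (snd x))\<^sup>2)" for j
    using member_le_sum[of "(j, j)" UNIV "\<lambda>x. (T (fst x) (snd x))\<^sup>2"] by simp
  also have "(\<Sum>x\<in>UNIV. (T (fst x) (snd x))\<^sup>2) = (\<Sum>x\<in>UNIV. (S (fst x) (snd x))\<^sup>2)"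
    using frobenius_gram_eq[of M]
    by (simp add: S_def T_def sum.cartesian_product case_prod_unfold)
  also have "\<dots> \<le> e\<^sup>2"
  proof -
    have "(\<Sum>x\<in>UNIV. (S (fst x) (snd x))\<^sup>2) = (L2_set (\<lambda>x. S (fst x) (snd x)) UNIV)\<^sup>2"
      by (simp add: L2_set_def sum_nonneg)
    also have "\<dots> \<le> e\<^sup>2"
      unfolding e by (intro power_mono L2_set_le_sum_abs L2_set_nonneg)
    finally show ?thesis .
  qed
  finally have "(T j j)\<^sup>2 \<le> e\<^sup>2" for j .
  then have "\<bar>T j j\<bar> \<le> e" for j using e0 abs_le_square_iff[of "T j j" e] by simp
  then show "\<bar>(\<Sum>i\<in>UNIV. (M j i)\<^sup>2) - 1\<bar> \<le> e" by (simp add: T_def power2_eq_square)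
qed

text \<open>A linear function on doubly stochastic matrices is minimal at a permutation. The squares
  of \<open>M\<close> are only nearly doubly stochastic; summing the dual potentials against them is
  stable, and the defect costs a multiple of \<open>e\<close> proportional to the size of the
  potentials.\<close>

lemma assignment_le_frame_sum:
  fixes P Q :: real and p q :: "'n::finite \<Rightarrow> real" and M :: "'n \<Rightarrow> 'n \<Rightarrow> real" and e :: real
  assumes p: "\<And>i. \<bar>p i\<bar> \<le> P" and q: "\<And>i. \<bar>q i\<bar> \<le> Q"
  defines "e \<equiv> (\<Sum>i\<in>UNIV. \<Sum>l\<in>UNIV. \<bar>(\<Sum>j\<in>UNIV. M j i * M j l) - (if i = l then 1 else 0)\<bar>)"
  obtains \<sigma> where "\<sigma> permutes UNIV"
    "(\<Sum>i\<in>UNIV. p i * q (\<sigma> i)) \<le> (\<Sum>i\<in>UNIV. \<Sum>j\<in>UNIV. p i * q j * (M j i)\<^sup>2)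
      + CARD('n) * (P * Q + 4 * P * Q * CARD('n)) * e"
proof -
  obtain \<sigma> a b where \<sigma>: "\<sigma> permutes UNIV" and ab: "\<And>i j. a i + b j \<le> p i * q j"
    and s: "(\<Sum>i\<in>UNIV. p i * q (\<sigma> i)) = (\<Sum>i\<in>UNIV. a i) + (\<Sum>j\<in>UNIV. b j)"
    and a: "\<And>i. \<bar>a i\<bar> \<le> 2 * P * Q * CARD('n)" and b: "\<And>j. \<bar>b j\<bar> \<le> P * Q + 2 * P * Q * CARD('n)"
    by (rule assignment_dual[of p P q Q, OF p q]) (rule that)
  let ?r = "\<lambda>i. (\<Sum>j\<in>UNIV. (M j i)\<^sup>2)" and ?c = "\<lambda>j. (\<Sum>i\<in>UNIV. (M j i)\<^sup>2)"
  have e0: "0 \<le> e" by (simp add: e_def sum_nonneg)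
  have weight: "x \<le> x * y + C * e" if "\<bar>x\<bar> \<le> C" "\<bar>y - 1\<bar> \<le> e" for x y C :: real
  proof -
    have "x - x * y = x * (1 - y)" by (simp add: algebra_simps)
    also have "\<dots> \<le> \<bar>x\<bar> * \<bar>y - 1\<bar>" by (metis abs_ge_self abs_minus_commute abs_mult)
    also have "\<dots> \<le> C * e" using that by (intro mult_mono) auto
    finally show ?thesis by simp
  qed
  have 1: "(\<Sum>i\<in>UNIV. a i) \<le> (\<Sum>i\<in>UNIV. a i * ?r i + 2 * P * Q * CARD('n) * e)"
    by (intro sum_mono weight a) (use column_sums_near_one(2)[of M] in \<open>simp add: e_def\<close>)
  have 2: "(\<Sum>j\<in>UNIV. b j) \<le> (\<Sum>j\<in>UNIV. b j * ?c j + (P * Q + 2 * P * Q * CARD('n)) * e)"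
    by (intro sum_mono weight b) (use column_sums_near_one(1)[of M] in \<open>simp add: e_def\<close>)
  have "(\<Sum>i\<in>UNIV. a i * ?r i) = (\<Sum>i\<in>UNIV. \<Sum>j\<in>UNIV. a i * (M j i)\<^sup>2)"
    unfolding sum_distrib_left ..
  moreover have "(\<Sum>j\<in>UNIV. b j * ?c j) = (\<Sum>i\<in>UNIV. \<Sum>j\<in>UNIV. b j * (M j i)\<^sup>2)"
    unfolding sum_distrib_left by (rule sum.swap)
  ultimately have 3: "(\<Sum>i\<in>UNIV. a i * ?r i) + (\<Sum>j\<in>UNIV. b j * ?c j)
      = (\<Sum>i\<in>UNIV. \<Sum>j\<in>UNIV. (a i + b j) * (M j i)\<^sup>2)"
    unfolding distrib_right sum.distrib by (simp only:)
  have 4: "(\<Sum>i\<in>UNIV. \<Sum>j\<in>UNIV. (a i + b j) * (M j i)\<^sup>2)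
      \<le> (\<Sum>i\<in>UNIV. \<Sum>j\<in>UNIV. p i * q j * (M j i)\<^sup>2)"
    by (intro sum_mono mult_right_mono ab) simp
  have "CARD('n) * (2 * P * Q * CARD('n) * e) + CARD('n) * ((P * Q + 2 * P * Q * CARD('n)) * e)
      = CARD('n) * (P * Q + 4 * P * Q * CARD('n)) * e"
    by (simp add: algebra_simps)
  then show thesis
    using 1 2 3 4 unfolding sum.distrib by (intro that[OF \<sigma>], unfold s) simp
qed


section \<open>The differentiated equation\<close>

lemma open_smooth_has_derivative:
  assumes "smooth_on S f" "open S" "x \<in> S"
  shows "(f has_derivative frechet_derivative f (at x within S)) (at x)"
proof -
  have "Ck_on (Suc 0) S f" using assms(1) unfolding smooth_on_def by blast
  then obtain f' where "(f has_derivative f' x) (at x within S)" using assms(3) by auto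
  then have "f differentiable (at x within S)" unfolding differentiable_def by blast
  then have "(f has_derivative frechet_derivative f (at x within S)) (at x within S)"
    by (simp only: frechet_derivative_works)
  then show ?thesis
    using assms(2,3) by (simp only: at_within_open)
qed

text \<open>A concave function lies below its tangent at \<open>lam\<close>. In degree one Euler's
  identity removes the constant term of the tangent, leaving the linear map alone, and symmetry of
  \<open>f\<close> allows the entries of \<open>mu\<close> to be listed in any order.\<close>

lemma concave_operator_le:
  fixes f :: "real^'n::finite \<Rightarrow> real"
  assumes \<Gamma>: "admissible_cone \<Gamma>" and f: "admissible_operator \<Gamma> f \<nu>0" and lam: "lam \<in> \<Gamma>"
  shows "f lam = (\<Sum>i\<in>UNIV. partial_deriv \<Gamma> i f lam * lam $ i)"
    and "mu \<in> \<Gamma> \<Longrightarrow> \<sigma> permutes UNIV \<Longrightarrow> f mu \<le> (\<Sum>i\<in>UNIV. partial_deriv \<Gamma> i f lam * mu $ \<sigma> i)"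
proof -
  define f' where "f' = frechet_derivative f (at lam within \<Gamma>)"
  have D: "(f has_derivative f') (at lam)"
    unfolding f'_def using assms open_smooth_has_derivative
    by (auto simp: admissible_cone_def admissible_operator_def)
  have f'_eq: "f' v = (\<Sum>i\<in>UNIV. partial_deriv \<Gamma> i f lam * v $ i)" for v
  proof -
    have "f' v = f' (\<Sum>i\<in>UNIV. v $ i *\<^sub>R axis i 1)"
      using basis_expansion[of v] by (simp add: scalar_mult_eq_scaleR)
    also have "\<dots> = (\<Sum>i\<in>UNIV. v $ i *\<^sub>R f' (axis i 1))"
      using has_derivative_linear[OF D] by (simp only: linear_sum linear_cmul)
    finally show ?thesis by (simp add: partial_deriv_def f'_def mult.commute)
  qed
  have line: "((\<lambda>t. f (lam + t *\<^sub>R w)) has_real_derivative f' w) (at 0)" for w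
  proof -
    have "((\<lambda>t. lam + t *\<^sub>R w) has_derivative (\<lambda>t. t *\<^sub>R w)) (at 0)"
      by (auto intro!: derivative_eq_intros)
    then have "((\<lambda>t. f (lam + t *\<^sub>R w)) has_derivative (\<lambda>t. f' (t *\<^sub>R w))) (at 0)"
      using has_derivative_compose[of "\<lambda>t. lam + t *\<^sub>R w" _ 0 UNIV f f'] D by simp
    then show ?thesis
      using has_derivative_linear[OF D]
      by (simp add: has_field_derivative_def linear_cmul mult_commute_abs)
  qed
  have euler: "f' lam = f lam"
  proof (rule DERIV_unique[OF line])
    have D1: "((\<lambda>t. (1 + t) * f lam) has_real_derivative f lam) (at 0)"
      by (auto intro!: derivative_eq_intros)
    have eq: "(1 + t) * f lam = f (lam + t *\<^sub>R lam)" if "t \<in> {-1<..<1}" for t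
    proof -
      have "f ((1 + t) *\<^sub>R lam) = (1 + t) * f lam"
        using f lam that by (simp add: admissible_operator_def)
      then show ?thesis by (simp add: scaleR_add_left)
    qed
    show "((\<lambda>t. f (lam + t *\<^sub>R lam)) has_real_derivative f lam) (at 0)"
      by (rule has_field_derivative_transform_within_open[OF D1, where S = "{-1<..<1}"]) (use eq in auto)
  qed
  then show "f lam = (\<Sum>i\<in>UNIV. partial_deriv \<Gamma> i f lam * lam $ i)" by (simp add: f'_eq)
  assume mu: "mu \<in> \<Gamma>" and \<sigma>: "\<sigma> permutes UNIV"
  define m where "m = (\<chi> i. mu $ \<sigma> i)"
  have m: "m \<in> \<Gamma>" "f m = f mu"
    using \<Gamma> f mu \<sigma> by (auto simp: admissible_cone_def admissible_operator_def m_def)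
  have "f m - f lam \<le> f' (m - lam)"
  proof (rule tendsto_lowerbound)
    have "((\<lambda>t. (f (lam + t *\<^sub>R (m - lam)) - f lam) / t) \<longlongrightarrow> f' (m - lam)) (at 0)"
      using line[of "m - lam"] by (simp add: has_field_derivative_iff)
    then show "((\<lambda>t. (f (lam + t *\<^sub>R (m - lam)) - f lam) / t) \<longlongrightarrow> f' (m - lam)) (at_right 0)"
      by (rule tendsto_within_subset) auto
    have "f m - f lam \<le> (f (lam + t *\<^sub>R (m - lam)) - f lam) / t" if t: "0 < t" "t < 1" for t
    proof -
      have "(1 - t) * f lam + t * f m \<le> f ((1 - t) *\<^sub>R lam + t *\<^sub>R m)"
        using f lam m t by (intro concave_onD) (auto simp: admissible_operator_def)
      also have "(1 - t) *\<^sub>R lam + t *\<^sub>R m = lam + t *\<^sub>R (m - lam)" by (simp add: algebra_simps)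
      finally show ?thesis using t by (simp add: field_simps)
    qed
    then show "\<forall>\<^sub>F t in at_right 0. f m - f lam \<le> (f (lam + t *\<^sub>R (m - lam)) - f lam) / t"
      unfolding eventually_at_right_field by (intro exI[of _ 1]) auto
  qed simp
  moreover have "f' (m - lam) = f' m - f' lam"
    using has_derivative_linear[OF D] by (rule linear_diff)
  ultimately have "f mu \<le> f' m" using euler m(2) by simp
  then show "f mu \<le> (\<Sum>i\<in>UNIV. partial_deriv \<Gamma> i f lam * mu $ \<sigma> i)" by (simp add: f'_eq m_def)
qed

section \<open>Differentiating a pencil of bilinear forms\<close>

lemma has_real_derivative_abs_zero:
  assumes "(s has_real_derivative 0) (at x)" "s x = 0"
  shows "((\<lambda>t. \<bar>s t\<bar>) has_real_derivative 0) (at x)"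
proof -
  have "((\<lambda>t. s t / (t - x)) \<longlongrightarrow> 0) (at x)"
    using assms by (simp add: has_field_derivative_iff)
  then have "((\<lambda>t. \<bar>s t\<bar> / (t - x)) \<longlongrightarrow> 0) (at x)"
    by (rule Lim_transform_bound[rotated]) auto
  then show ?thesis using assms(2) by (simp add: has_field_derivative_iff)
qed

lemma bilinear_line_derivative:
  fixes H :: "real \<Rightarrow> 'a::euclidean_space \<Rightarrow> 'a \<Rightarrow> real"
  assumes \<delta>: "0 < \<delta>" and bl: "\<And>t. \<bar>t\<bar> < \<delta> \<Longrightarrow> bilinear (H t)"
    and H': "\<And>v w. ((\<lambda>t. H t v w) has_real_derivative H' v w) (at 0)"
  shows "((\<lambda>t. H t (v + t *\<^sub>R a) (w + t *\<^sub>R b)) has_real_derivative H' v w + H 0 a w + H 0 v b) (at 0)"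
proof -
  have D: "((\<lambda>t. H t v w + t * H t a w + t * H t v b + t * (t * H t a b)) has_real_derivative
      H' v w + H 0 a w + H 0 v b) (at 0)"
    by (auto intro!: derivative_eq_intros H')
  show ?thesis
  proof (rule has_field_derivative_transform_within_open[OF D])
    show "H t v w + t * H t a w + t * H t v b + t * (t * H t a b) = H t (v + t *\<^sub>R a) (w + t *\<^sub>R b)"
      if "t \<in> {-\<delta><..<\<delta>}" for t
    proof -
      have "bilinear (H t)" using that by (intro bl) (simp add: abs_less_iff)
      then show ?thesis by (simp add: bilinear_expand algebra_simps)
    qed
  qed (use \<delta> in auto)
qed

text \<open>The derivative of the equation along a one-parameter family, obtained from the first-order
  contact of \<open>h\<close> with the right-hand side of \<open>f mu \<le> \<Sum> p\<^sub>i H\<^sub>t(e\<^sub>i, e\<^sub>i) + O(|Gram - 1|)\<close>, where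
  \<open>e\<close> is a frame that is orthonormal up to \<open>o(t)\<close>.  No differentiability of eigenvalues is used.\<close>

lemma pencil_derivative:
  fixes G H :: "real \<Rightarrow> real^'n::finite \<Rightarrow> real^'n \<Rightarrow> real" and p lam :: "'n \<Rightarrow> real"
  assumes \<delta>: "0 < \<delta>" and blH: "\<And>t. \<bar>t\<bar> < \<delta> \<Longrightarrow> bilinear (H t)"
    and Gs: "\<And>t. \<bar>t\<bar> < \<delta> \<Longrightarrow> spd_form (G t)"
    and Hs: "\<And>v w. H 0 v w = H 0 w v"
    and eq: "\<And>t. \<bar>t\<bar> < \<delta> \<Longrightarrow> \<exists>e mu. orthonormal_wrt (G t) e \<and> (\<forall>j v. H t (e j) v = mu j * G t (e j) v)
         \<and> (\<forall>j. \<bar>mu j\<bar> \<le> Q) \<and> (\<forall>\<sigma>. \<sigma> permutes UNIV \<longrightarrow> h t \<le> (\<Sum>i\<in>UNIV. p i * mu (\<sigma> i)))"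
    and E: "orthonormal_wrt (G 0) E" and HE: "\<And>i v. H 0 (E i) v = lam i * G 0 (E i) v"
    and h0: "h 0 = (\<Sum>i\<in>UNIV. p i * lam i)"
    and G': "\<And>v w. ((\<lambda>t. G t v w) has_real_derivative G' v w) (at 0)"
    and H': "\<And>v w. ((\<lambda>t. H t v w) has_real_derivative H' v w) (at 0)"
    and h': "(h has_real_derivative h') (at 0)"
  shows "(\<Sum>i\<in>UNIV. p i * (H' (E i) (E i) - lam i * G' (E i) (E i))) = h'"
proof -
  have G0: "spd_form (G 0)" using Gs[of 0] \<delta> by simp
  have G's: "G' v w = G' w v" for v w
  proof (rule DERIV_unique[OF G'])
    show "((\<lambda>t. G t v w) has_real_derivative G' w v) (at 0)"
      using G'[of w v]
    proof (rule has_field_derivative_transform_within_open[of _ _ _ "{-\<delta><..<\<delta>}"])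
      show "G t w v = G t v w" if "t \<in> {-\<delta><..<\<delta>}" for t
        using that by (intro spd_formD(2)[OF Gs]) (simp add: abs_less_iff)
    qed (use \<delta> in auto)
  qed
  \<comment> \<open>The first-order change of the frame that compensates \<open>G'\<close>: the
    vectors \<open>E i + t *\<^sub>R a i\<close> remain orthonormal for \<open>G t\<close> up to
    o(t).\<close>
  define a where "a i = - (1/2) *\<^sub>R (\<Sum>j\<in>UNIV. G' (E i) (E j) *\<^sub>R E j)" for i
  define e where "e t i = E i + t *\<^sub>R a i" for t i
  define S where "S t i l = G t (e t i) (e t l) - (if i = l then 1 else 0)" for t i l
  have Ga: "G 0 (a i) (E l) = - (1/2) * G' (E i) (E l)" for i l
    using E by (simp add: a_def bilinear_expand[OF spd_formD(1)[OF G0]] orthonormal_wrt_def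
        if_distrib[of "\<lambda>x. _ * x"] cong: if_cong)
  have S': "((\<lambda>t. S t i l) has_real_derivative 0) (at 0)" for i l
  proof -
    have "((\<lambda>t. G t (e t i) (e t l)) has_real_derivative G' (E i) (E l) + G 0 (a i) (E l) + G 0 (E i) (a l)) (at 0)"
      unfolding e_def by (rule bilinear_line_derivative[OF \<delta> spd_formD(1)[OF Gs] G'])
    also have "G' (E i) (E l) + G 0 (a i) (E l) + G 0 (E i) (a l) = 0"
      using Ga[of i l] Ga[of l i] spd_formD(2)[OF G0, of "E i" "a l"] G's[of "E i" "E l"] by simp
    finally show ?thesis unfolding S_def by (auto intro!: derivative_eq_intros)
  qed
  define s where "s t = (\<Sum>i\<in>UNIV. \<Sum>l\<in>UNIV. \<bar>S t i l\<bar>)" for t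
  have S0: "S 0 i l = 0" for i l using E by (simp add: S_def e_def orthonormal_wrt_def)
  have s': "(s has_real_derivative 0) (at 0)"
  proof -
    have "((\<lambda>t. \<bar>S t i l\<bar>) has_real_derivative 0) (at 0)" for i l
      by (rule has_real_derivative_abs_zero[OF S' S0])
    then     have "((\<lambda>t. \<Sum>i\<in>UNIV. \<Sum>l\<in>UNIV. \<bar>S t i l\<bar>) has_real_derivative (\<Sum>i\<in>(UNIV :: 'n set). \<Sum>l\<in>(UNIV :: 'n set). 0)) (at 0)"
      by (intro DERIV_sum)
    then show ?thesis by (simp add: s_def[abs_def])
  qed
  define P where "P = (\<Sum>i\<in>UNIV. \<bar>p i\<bar>)"
  have P: "\<bar>p i\<bar> \<le> P" for i unfolding P_def by (rule member_le_sum) auto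
  define K where "K = CARD('n) * (P * Q + 4 * P * Q * CARD('n))"
  \<comment> \<open>The slack of the inequality for \<open>h\<close>. It is nonnegative on both
    sides of 0 and vanishes at 0, so its derivative is 0; in this way an inequality for
    \<open>f\<close> yields an exact equation.\<close>
  define k where "k t = (\<Sum>i\<in>UNIV. p i * H t (e t i) (e t i)) + K * s t - h t" for t
  have k': "(k has_real_derivative (\<Sum>i\<in>UNIV. p i * (H' (E i) (E i) - lam i * G' (E i) (E i))) - h') (at 0)"
  proof -
    have "((\<lambda>t. H t (e t i) (e t i)) has_real_derivative H' (E i) (E i) - lam i * G' (E i) (E i)) (at 0)" for i
    proof -
      have "((\<lambda>t. H t (e t i) (e t i)) has_real_derivative H' (E i) (E i) + H 0 (a i) (E i) + H 0 (E i) (a i)) (at 0)"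
        unfolding e_def by (rule bilinear_line_derivative[OF \<delta> blH H'])
      also have "H' (E i) (E i) + H 0 (a i) (E i) + H 0 (E i) (a i) = H' (E i) (E i) - lam i * G' (E i) (E i)"
        using Hs[of "a i" "E i"] Ga[of i i] spd_formD(2)[OF G0, of "E i" "a i"] by (simp add: HE)
      finally show ?thesis .
    qed
    then have "((\<lambda>t. (\<Sum>i\<in>UNIV. p i * H t (e t i) (e t i)) + K * s t - h t) has_real_derivative
        (\<Sum>i\<in>UNIV. p i * (H' (E i) (E i) - lam i * G' (E i) (E i))) + K * 0 - h') (at 0)"
      by (intro DERIV_diff DERIV_add DERIV_sum DERIV_cmult s' h')
    then show ?thesis by (simp add: k_def[abs_def])
  qed
  have k0: "k 0 = 0"
    using E by (simp add: k_def s_def S0 h0 e_def HE orthonormal_wrt_def)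
  have "0 \<le> k t" if t: "\<bar>t\<bar> < \<delta>" for t
  proof -
    obtain \<epsilon> mu where \<epsilon>: "orthonormal_wrt (G t) \<epsilon>" and H\<epsilon>: "\<And>j v. H t (\<epsilon> j) v = mu j * G t (\<epsilon> j) v"
      and Q: "\<And>j. \<bar>mu j\<bar> \<le> Q" and hle: "\<And>\<sigma>. \<sigma> permutes UNIV \<Longrightarrow> h t \<le> (\<Sum>i\<in>UNIV. p i * mu (\<sigma> i))"
      using eq[OF t] by metis
    define M where "M j i = G t (\<epsilon> j) (e t i)" for j i
    obtain \<sigma> where \<sigma>: "\<sigma> permutes UNIV" and le: "(\<Sum>i\<in>UNIV. p i * mu (\<sigma> i))
        \<le> (\<Sum>i\<in>UNIV. \<Sum>j\<in>UNIV. p i * mu j * (M j i)\<^sup>2) + CARD('n) * (P * Q + 4 * P * Q * CARD('n)) *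
          (\<Sum>i\<in>UNIV. \<Sum>l\<in>UNIV. \<bar>(\<Sum>j\<in>UNIV. M j i * M j l) - (if i = l then 1 else 0)\<bar>)"
      by (rule assignment_le_frame_sum[of p P mu Q M, OF P Q]) (rule that)
    have "(\<Sum>j\<in>UNIV. M j i * M j l) = G t (e t i) (e t l)" for i l
      unfolding M_def by (rule orthonormal_parseval[OF Gs[OF t] \<epsilon>, symmetric])
    then have s: "s t = (\<Sum>i\<in>UNIV. \<Sum>l\<in>UNIV. \<bar>(\<Sum>j\<in>UNIV. M j i * M j l) - (if i = l then 1 else 0)\<bar>)"
      by (simp add: s_def S_def)
    have "(\<Sum>j\<in>UNIV. p i * mu j * (M j i)\<^sup>2) = p i * H t (e t i) (e t i)" for i
      unfolding eigenframe_expansion[OF Gs[OF t] \<epsilon> blH[OF t] H\<epsilon>] sum_distrib_left M_def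
      by (simp add: mult.assoc)
    then show ?thesis using le hle[OF \<sigma>] by (simp add: k_def s K_def)
  qed
  then have "(\<Sum>i\<in>UNIV. p i * (H' (E i) (E i) - lam i * G' (E i) (E i))) - h' = 0"
    by (intro DERIV_local_min[OF k' \<delta>]) (auto simp: k0)
  then show ?thesis by simp
qed


section \<open>Calculus\<close>

lemma double_difference_mvt:
  fixes f :: "'a::real_normed_vector \<Rightarrow> real"
  assumes h: "0 < h" and U: "\<And>s r. 0 \<le> s \<Longrightarrow> s \<le> h \<Longrightarrow> 0 \<le> r \<Longrightarrow> r \<le> h \<Longrightarrow> x + s *\<^sub>R v + r *\<^sub>R w \<in> U"
    and f1: "\<And>x. x \<in> U \<Longrightarrow> (f has_derivative f1 x) (at x)"
    and f2: "\<And>x. x \<in> U \<Longrightarrow> ((\<lambda>y. f1 y v) has_derivative f2 x) (at x)"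
  obtains s r where "0 < s" "s < h" "0 < r" "r < h"
    "f (x + h *\<^sub>R v + h *\<^sub>R w) - f (x + h *\<^sub>R v) - f (x + h *\<^sub>R w) + f x = h * (h * f2 (x + s *\<^sub>R v + r *\<^sub>R w) w)"
proof -
  have line: "((\<lambda>t. k (y + t *\<^sub>R e)) has_real_derivative k' e) (at t)"
    if "(k has_derivative k') (at (y + t *\<^sub>R e))" for k k' y e t
  proof -
    have "((\<lambda>t. y + t *\<^sub>R e) has_derivative (\<lambda>t. t *\<^sub>R e)) (at t)"
      by (auto intro!: derivative_eq_intros)
    then have "((\<lambda>t. k (y + t *\<^sub>R e)) has_derivative (\<lambda>t. k' (t *\<^sub>R e))) (at t)"
      using that by (rule has_derivative_compose)
    then show ?thesis
      using has_derivative_linear[OF that]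
      by (simp add: has_field_derivative_def linear_cmul mult_commute_abs)
  qed
  define g where "g s = f ((x + h *\<^sub>R w) + s *\<^sub>R v) - f (x + s *\<^sub>R v)" for s
  have "(g has_real_derivative f1 (x + s *\<^sub>R v + h *\<^sub>R w) v - f1 (x + s *\<^sub>R v) v) (at s)"
    if "0 \<le> s" "s \<le> h" for s
  proof -
    have "x + s *\<^sub>R v + h *\<^sub>R w \<in> U" "x + s *\<^sub>R v \<in> U" using U[of s h] U[of s 0] that h by auto
    then have "((\<lambda>s. f ((x + h *\<^sub>R w) + s *\<^sub>R v)) has_real_derivative f1 (x + s *\<^sub>R v + h *\<^sub>R w) v) (at s)"
      "((\<lambda>s. f (x + s *\<^sub>R v)) has_real_derivative f1 (x + s *\<^sub>R v) v) (at s)"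
      using line[of f _ "x + h *\<^sub>R w" s v] line[of f _ x s v] f1 by (auto simp: algebra_simps)
    then show ?thesis unfolding g_def by (rule DERIV_diff)
  qed
  from MVT2[OF h this] obtain s where s: "0 < s" "s < h"
      "g h - g 0 = h * (f1 (x + s *\<^sub>R v + h *\<^sub>R w) v - f1 (x + s *\<^sub>R v) v)"
    by auto
  have "((\<lambda>r. f1 (x + s *\<^sub>R v + r *\<^sub>R w) v) has_real_derivative f2 (x + s *\<^sub>R v + r *\<^sub>R w) w) (at r)"
    if "0 \<le> r" "r \<le> h" for r
    using U[of s r] s that f2 by (intro line[of "\<lambda>y. f1 y v"]) auto
  from MVT2[OF h this] obtain r where r: "0 < r" "r < h"
      "f1 (x + s *\<^sub>R v + h *\<^sub>R w) v - f1 (x + s *\<^sub>R v) v = h * f2 (x + s *\<^sub>R v + r *\<^sub>R w) w"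
    by auto
  show thesis
    using s(3) r(3) by (intro that[OF s(1,2) r(1,2)]) (simp add: g_def algebra_simps)
qed

text \<open>The second difference over a parallelogram does not depend on the order of
  \<open>v\<close> and \<open>w\<close>, and by the mean value theorem it is \<open>h\<close>^2
  times either mixed derivative at a nearby point. Continuity then rules out two different values at
  \<open>x\<close>.\<close>

lemma second_derivative_symmetric:
  fixes f :: "'a::real_normed_vector \<Rightarrow> real"
  assumes U: "open U" "x \<in> U"
    and f1: "\<And>x. x \<in> U \<Longrightarrow> (f has_derivative f1 x) (at x)"
    and f2: "\<And>x v. x \<in> U \<Longrightarrow> ((\<lambda>y. f1 y v) has_derivative f2 x v) (at x)"
    and cont: "\<And>v w. continuous_on U (\<lambda>x. f2 x v w)"
  shows "f2 x v w = f2 x w v"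
proof (rule ccontr)
  assume ne: "f2 x v w \<noteq> f2 x w v"
  define e where "e = \<bar>f2 x v w - f2 x w v\<bar> / 2"
  have e: "0 < e" using ne by (simp add: e_def)
  have near: "\<forall>\<^sub>F y in at x. \<bar>f2 y a b - f2 x a b\<bar> < e" for a b
  proof -
    have "((\<lambda>y. f2 y a b) \<longlongrightarrow> f2 x a b) (at x)"
      using cont[of a b] U by (simp add: continuous_on_eq_continuous_at isCont_def)
    from tendstoD[OF this e] show ?thesis by (simp add: dist_real_def)
  qed
  have "\<forall>\<^sub>F y in at x. y \<in> U" using U by (rule eventually_at_in_open')
  then have "\<forall>\<^sub>F y in at x. y \<in> U \<and> \<bar>f2 y v w - f2 x v w\<bar> < e \<and> \<bar>f2 y w v - f2 x w v\<bar> < e"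
    using near[of v w] near[of w v] by eventually_elim auto
  then obtain d where d: "0 < d"
    and dU: "\<And>y. y \<noteq> x \<Longrightarrow> dist y x < d \<Longrightarrow> y \<in> U \<and> \<bar>f2 y v w - f2 x v w\<bar> < e \<and> \<bar>f2 y w v - f2 x w v\<bar> < e"
    unfolding eventually_at by blast
  have dU': "y \<in> U \<and> \<bar>f2 y v w - f2 x v w\<bar> < e \<and> \<bar>f2 y w v - f2 x w v\<bar> < e" if "dist y x < d" for y
    using dU[of y] that U e by (cases "y = x") auto
  \<comment> \<open>The parallelogram stays within distance \<open>d / 2\<close> of
    \<open>x\<close>; the summand 1 covers the case that both vectors vanish.\<close>
  define h where "h = d / (2 * (norm v + norm w + 1))"
  have nn: "0 < norm v + norm w + 1" by (simp add: add_nonneg_pos)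
  then have h: "0 < h" using d by (simp add: h_def)
  have small: "dist (x + s *\<^sub>R v + r *\<^sub>R w) x < d" if "0 \<le> s" "s \<le> h" "0 \<le> r" "r \<le> h" for s r
  proof -
    have "dist (x + s *\<^sub>R v + r *\<^sub>R w) x \<le> norm (s *\<^sub>R v) + norm (r *\<^sub>R w)"
      using norm_triangle_ineq[of "s *\<^sub>R v" "r *\<^sub>R w"] by (simp add: dist_norm add.assoc)
    also have "\<dots> \<le> h * norm v + h * norm w"
      using that by (intro add_mono) (auto intro: mult_right_mono)
    also have "\<dots> \<le> h * (norm v + norm w + 1)" using h by (simp add: algebra_simps)
    also have "\<dots> = d / 2" unfolding h_def using nn by (metis divide_divide_eq_left nonzero_eq_divide_eq less_irrefl divide_divide_eq_left')
    finally show ?thesis using d by simp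
  qed
  obtain s r where sr: "0 < s" "s < h" "0 < r" "r < h"
      "f (x + h *\<^sub>R v + h *\<^sub>R w) - f (x + h *\<^sub>R v) - f (x + h *\<^sub>R w) + f x = h * (h * f2 (x + s *\<^sub>R v + r *\<^sub>R w) v w)"
    by (rule double_difference_mvt[of h x v w U f f1 "\<lambda>x. f2 x v"]) (use h small dU' f1 f2 in auto)
  have U': "x + s *\<^sub>R w + r *\<^sub>R v \<in> U" if "0 \<le> s" "s \<le> h" "0 \<le> r" "r \<le> h" for s r
    using dU'[OF small[of r s]] that by (simp add: add.assoc add.commute[of "s *\<^sub>R w"])
  obtain s' r' where sr': "0 < s'" "s' < h" "0 < r'" "r' < h"
      "f (x + h *\<^sub>R w + h *\<^sub>R v) - f (x + h *\<^sub>R w) - f (x + h *\<^sub>R v) + f x = h * (h * f2 (x + s' *\<^sub>R w + r' *\<^sub>R v) w v)"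
    by (rule double_difference_mvt[of h x w v U f f1 "\<lambda>x. f2 x w"]) (use h U' f1 f2 in auto)
  have "h * (h * f2 (x + s *\<^sub>R v + r *\<^sub>R w) v w) = h * (h * f2 (x + s' *\<^sub>R w + r' *\<^sub>R v) w v)"
    using sr(5) sr'(5) by (simp add: algebra_simps)
  then have "f2 (x + s *\<^sub>R v + r *\<^sub>R w) v w = f2 (x + r' *\<^sub>R v + s' *\<^sub>R w) w v"
    using h by (simp add: add.assoc add.commute[of "s' *\<^sub>R w"])
  moreover have "\<bar>f2 (x + s *\<^sub>R v + r *\<^sub>R w) v w - f2 x v w\<bar> < e"
    using dU'[OF small[of s r]] sr by simp
  moreover have "\<bar>f2 (x + r' *\<^sub>R v + s' *\<^sub>R w) w v - f2 x w v\<bar> < e"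
    using dU'[OF small[of r' s']] sr' by simp
  ultimately have "\<bar>f2 x v w - f2 x w v\<bar> < 2 * e" by linarith
  then show False by (simp add: e_def)
qed

lemma Ck_on_subset: "Ck_on k S f \<Longrightarrow> T \<subseteq> S \<Longrightarrow> Ck_on k T f"
proof (induction k arbitrary: f)
  case 0
  then show ?case by (auto intro: continuous_on_subset)
next
  case (Suc k)
  then obtain f' where "\<forall>x\<in>S. (f has_derivative f' x) (at x within S)" "\<forall>v. Ck_on k S (\<lambda>x. f' x v)"
    by auto
  then have "(\<forall>x\<in>T. (f has_derivative f' x) (at x within T)) \<and> (\<forall>v. Ck_on k T (\<lambda>x. f' x v))"
    using Suc by (blast intro: has_derivative_subset)
  then show ?case by auto
qed

text \<open>The derivatives appear as explicit multilinear families, the last argument being the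
  direction of the latest differentiation, so that later computations avoid iterated
  \<open>frechet_derivative\<close>. The symmetries are part of the notion because
  \<open>Ck_on\<close> provides a derivative separately for each direction.\<close>

definition C3_jet :: "'a::euclidean_space set \<Rightarrow> ('a \<Rightarrow> real) \<Rightarrow> ('a \<Rightarrow> 'a \<Rightarrow> real) \<Rightarrow>
    ('a \<Rightarrow> 'a \<Rightarrow> 'a \<Rightarrow> real) \<Rightarrow> ('a \<Rightarrow> 'a \<Rightarrow> 'a \<Rightarrow> 'a \<Rightarrow> real) \<Rightarrow> bool" where
  "C3_jet U u u1 u2 u3 \<longleftrightarrow> (\<forall>x\<in>U. (u has_derivative u1 x) (at x) \<and>
     (\<forall>v. ((\<lambda>y. u1 y v) has_derivative u2 x v) (at x)) \<and>
     (\<forall>v w. ((\<lambda>y. u2 y v w) has_derivative u3 x v w) (at x)) \<and>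
     bilinear (u2 x) \<and> (\<forall>v w. u2 x v w = u2 x w v) \<and>
     (\<forall>v w z. u3 x v w z = u3 x w v z \<and> u3 x v w z = u3 x v z w))"

lemma C3_jet_exists:
  fixes u :: "'a::euclidean_space \<Rightarrow> real"
  assumes U: "open U" and u: "Ck_on 3 U u"
  obtains u1 u2 u3 where "C3_jet U u u1 u2 u3"
proof -
  have at: "(at x within U) = at x" if "x \<in> U" for x using that U by (rule at_within_open)
  have "Ck_on (Suc (Suc (Suc 0))) U u" using u by (simp add: numeral_3_eq_3)
  then obtain u1 where u1: "\<And>x. x \<in> U \<Longrightarrow> (u has_derivative u1 x) (at x)"
    and "\<And>v. Ck_on (Suc (Suc 0)) U (\<lambda>x. u1 x v)"
    by (simp only: Ck_on.simps(2)[of "Suc (Suc 0)"]) (metis at)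
  then have "\<forall>v. \<exists>g. (\<forall>x\<in>U. ((\<lambda>y. u1 y v) has_derivative g x) (at x)) \<and> (\<forall>w. Ck_on (Suc 0) U (\<lambda>x. g x w))"
    by (simp only: Ck_on.simps(2)[of "Suc 0"]) (metis at)
  then obtain g where "\<forall>v. (\<forall>x\<in>U. ((\<lambda>y. u1 y v) has_derivative g v x) (at x)) \<and> (\<forall>w. Ck_on (Suc 0) U (\<lambda>x. g v x w))"
    by (rule choice[THEN exE])
  then have u2: "\<And>x v. x \<in> U \<Longrightarrow> ((\<lambda>y. u1 y v) has_derivative g v x) (at x)"
    and "\<And>v w. Ck_on (Suc 0) U (\<lambda>x. g v x w)"
    by auto
  then have ex: "\<exists>k. (\<forall>x\<in>U. ((\<lambda>y. g v y w) has_derivative k x) (at x)) \<and> (\<forall>z. continuous_on U (\<lambda>x. k x z))" for v w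
    using at by (simp add: Ck_on.simps)
  define k where "k v w = (SOME k. (\<forall>x\<in>U. ((\<lambda>y. g v y w) has_derivative k x) (at x)) \<and> (\<forall>z. continuous_on U (\<lambda>x. k x z)))" for v w
  have k: "(\<forall>x\<in>U. ((\<lambda>y. g v y w) has_derivative k v w x) (at x)) \<and> (\<forall>z. continuous_on U (\<lambda>x. k v w x z))" for v w
    unfolding k_def by (rule someI_ex[OF ex])
  define u2 where "u2 x v w = g v x w" for x v w
  define u3 where "u3 x v w z = k v w x z" for x v w z
  have d2: "((\<lambda>y. u1 y v) has_derivative u2 x v) (at x)" if "x \<in> U" for x v
    using u2[OF that] by (simp add: u2_def[abs_def])
  have d3: "((\<lambda>y. u2 y v w) has_derivative u3 x v w) (at x)" if "x \<in> U" for x v w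
    using k that by (simp add: u2_def[abs_def] u3_def[abs_def])
  have c3: "continuous_on U (\<lambda>x. u3 x v w z)" for v w z using k by (simp add: u3_def)
  have c2: "continuous_on U (\<lambda>x. u2 x v w)" for v w
    using d3 U by (metis continuous_on_eq_continuous_at has_derivative_continuous)
  have s2: "u2 x v w = u2 x w v" if "x \<in> U" for x v w
    by (rule second_derivative_symmetric[OF U that u1 d2 c2])
  have lin: "linear (u1 x)" "linear (u2 x v)" "linear (u3 x v w)" if "x \<in> U" for x v w
    using u1[OF that] d2[OF that] d3[OF that] has_derivative_linear by blast+
  \<comment> \<open>Differentiability gives linearity in the last slot only; symmetry carries it
    over to the first.\<close>
  have "bilinear (u2 x)" if "x \<in> U" for x
  proof -
    have "(\<lambda>v. u2 x v w) = u2 x w" for w using s2[OF that] by auto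
    then show ?thesis using lin(2)[OF that] by (simp add: bilinear_def)
  qed
  moreover have "u3 x v w z = u3 x w v z" if "x \<in> U" for x v w z
  proof -
    have "((\<lambda>y. u2 y v w) has_derivative u3 x w v) (at x)"
      using d3[OF that, of w v] that s2
      by (rule has_derivative_transform_within_open[OF _ U])
    then show ?thesis using has_derivative_unique[OF d3[OF that]] by metis
  qed
  moreover have "u3 x v w z = u3 x v z w" if "x \<in> U" for x v w z
  proof (rule second_derivative_symmetric[OF U that, of "\<lambda>x. u1 x v" "\<lambda>x. u2 x v"])
  qed (use d2 d3 c3 in auto)
  ultimately show thesis
    using that u1 d2 d3 s2 unfolding C3_jet_def by metis
qed

lemma second_derivative_test:
  fixes k :: "real \<Rightarrow> real"
  assumes \<delta>: "0 < \<delta>" and max: "\<And>t. \<bar>t\<bar> < \<delta> \<Longrightarrow> k t \<le> k 0"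
    and k1: "\<And>t. \<bar>t\<bar> < \<delta> \<Longrightarrow> (k has_real_derivative k1 t) (at t)"
    and k2: "(k1 has_real_derivative k2) (at 0)"
  shows "k1 0 = 0" "k2 \<le> 0"
proof -
  show k10: "k1 0 = 0"
    by (rule DERIV_local_max[OF k1 \<delta>]) (use \<delta> max in auto)
  show "k2 \<le> 0"
  proof (rule ccontr)
    assume "\<not> k2 \<le> 0"
    then obtain d where d: "0 < d" "\<And>h. 0 < h \<Longrightarrow> h < d \<Longrightarrow> k1 0 < k1 (0 + h)"
      using DERIV_pos_inc_right[OF k2] by auto
    define h where "h = min d \<delta> / 2"
    have h: "0 < h" "h < d" "h < \<delta>" using d \<delta> by (auto simp: h_def)
    obtain t where "0 < t" "t < h" "k h - k 0 = (h - 0) * k1 t"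
      using MVT2[OF h(1), of k k1] k1 h by auto
    moreover from this have "0 < k1 t" using d(2)[of t] h k10 by simp
    ultimately have "k 0 < k h" using h by (metis diff_0_right diff_gt_0_iff_gt mult_pos_pos)
    then show False using max[of h] h by simp
  qed
qed


section \<open>The inequality at an interior maximum\<close>

text \<open>The relations at an interior maximum of \<open>ln |p|\<^sup>2 - ln (M - u) / 2 + 2 ln \<zeta>\<close>, where \<open>p\<close> is the
  coordinate gradient of \<open>u\<close> and \<open>|p|\<close> its Euclidean length: \<open>\<phi>1\<close> and \<open>2 \<phi>1\<^sup>2\<close> are the derivatives
  of \<open>- ln (M - u) / 2\<close>, \<open>dz\<close> is the differential of the cutoff \<open>\<zeta> = R\<^sup>2 - |x - y|\<^sup>2\<close>, \<open>S i\<close> and \<open>A3 i\<close>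
  are \<open>|\<nabla>u\<^sub>i|\<^sup>2\<close> and \<open>p\<^sub>k u\<^sub>k\<^sub>i\<^sub>i\<close>.  The differentiated equation is \<open>lin\<close>; \<open>gam' i\<close> and \<open>g' i\<close> are the terms
  with derivatives of the Christoffel symbols and of the metric.\<close>

locale gradient_max_point =
  fixes G :: "real^'n::finite \<Rightarrow> real^'n \<Rightarrow> real" and E :: "'n \<Rightarrow> real^'n"
    and Gam :: "real^'n \<Rightarrow> real^'n \<Rightarrow> real^'n" and A2 :: "real^'n \<Rightarrow> real^'n \<Rightarrow> real"
    and p :: "real^'n" and dz :: "real^'n \<Rightarrow> real" and F lam A3 S gam' g' :: "'n \<Rightarrow> real"
    and c B c1 \<phi>1 \<zeta> R h' \<nu>0 :: real
  assumes c: "0 < c" and B: "1 \<le> B" and c1: "0 < c1" "c1 \<le> \<phi>1" "\<phi>1 \<le> 1"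
    and R: "0 < R" "R \<le> 1" and \<zeta>: "0 < \<zeta>" "\<zeta> \<le> R\<^sup>2" and p0: "p \<noteq> 0" and \<nu>0: "0 < \<nu>0"
    and G: "spd_form G" and Gc: "\<And>v. c * (norm v)\<^sup>2 \<le> G v v" and GB: "\<And>v w. \<bar>G v w\<bar> \<le> B * norm v * norm w"
    and E: "orthonormal_wrt G E" and Gam: "\<And>v w. norm (Gam v w) \<le> B * norm v * norm w"
    and gam': "\<And>i. \<bar>gam' i\<bar> \<le> B * (norm p)\<^sup>2 * (norm (E i))\<^sup>2"
    and g': "\<And>i. \<bar>g' i\<bar> \<le> B * norm p * (norm (E i))\<^sup>2"
    and dz: "\<And>v. \<bar>dz v\<bar> \<le> 2 * R * norm v"
    and F: "\<And>i. 0 < F i" "\<And>i. lam i < 0 \<Longrightarrow> \<nu>0 * (1 + (\<Sum>j\<in>UNIV. F j)) \<le> F i"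
      "0 \<le> (\<Sum>i\<in>UNIV. F i * lam i)"
    and A2s: "\<And>v w. A2 v w = A2 w v" and A2S: "\<And>v i. (A2 v (E i))\<^sup>2 \<le> (norm v)\<^sup>2 * S i"
    and eig: "\<And>i v. A2 (E i) v - p \<bullet> Gam (E i) v = lam i * G (E i) v"
    and first: "\<And>v. 2 * A2 p v / (norm p)\<^sup>2 + \<phi>1 * (p \<bullet> v) + 2 * dz v / \<zeta> = 0"
    and second: "\<And>i. 2 * (S i + A3 i) / (norm p)\<^sup>2 - (2 * A2 p (E i) / (norm p)\<^sup>2)\<^sup>2
        + 2 * \<phi>1\<^sup>2 * (p \<bullet> E i)\<^sup>2 + \<phi>1 * A2 (E i) (E i)
        + 2 * (- 2 * (norm (E i))\<^sup>2 / \<zeta> - (dz (E i))\<^sup>2 / \<zeta>\<^sup>2) \<le> 0"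
    and lin: "(\<Sum>i\<in>UNIV. F i * (A3 i - gam' i - A2 p (Gam (E i) (E i)) - lam i * g' i)) = h'"
begin

abbreviation "N \<equiv> norm p"
abbreviation "\<rho> \<equiv> R / \<zeta>"

lemma N: "0 < N" using p0 by simp

lemma rho: "0 < \<rho>" using R \<zeta> by simp

lemma norm_E: "(norm (E i))\<^sup>2 \<le> 1 / c" "norm (E i) \<le> sqrt (1 / c)"
proof -
  have "c * (norm (E i))\<^sup>2 \<le> 1" using Gc[of "E i"] E by (simp add: orthonormal_wrt_def)
  then show *: "(norm (E i))\<^sup>2 \<le> 1 / c" using c by (simp add: field_simps)
  show "norm (E i) \<le> sqrt (1 / c)" by (rule real_le_rsqrt[OF *])
qed

lemma norm_Gam_E: "norm (Gam (E i) (E i)) \<le> B / c"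
proof -
  have "norm (Gam (E i) (E i)) \<le> B * (norm (E i))\<^sup>2"
    using Gam[of "E i" "E i"] by (simp add: power2_eq_square mult.assoc)
  also have "\<dots> \<le> B * (1 / c)" using norm_E(1) B by (intro mult_left_mono) auto
  finally show ?thesis by simp
qed

text \<open>Since \<open>|p|\<^sup>2 = \<Sum> G(E\<^sub>i, p) (p \<bullet> E\<^sub>i)\<close>, some term is at least \<open>|p|\<^sup>2 / n\<close>; for that index the
  first-order condition forces the eigenvalue to be negative.\<close>

lemma negative_direction:
  assumes large: "2 * sqrt (1 / c) * (2 * \<rho> + B) < c1 * (sqrt c / (CARD('n) * B)) * N"
  obtains i where "lam i < 0" "c / (CARD('n) * B)\<^sup>2 * N\<^sup>2 \<le> (p \<bullet> E i)\<^sup>2"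
proof -
  let ?n = "real CARD('n)"
  let ?w = "\<lambda>i. G (E i) p"
  let ?u = "\<lambda>i. p \<bullet> E i"
  have n: "0 < ?n" by simp
  have "p \<bullet> p = p \<bullet> (\<Sum>j\<in>UNIV. ?w j *\<^sub>R E j)"
    using orthonormal_expansion[OF G E, of p] by simp
  then have sum: "N\<^sup>2 = (\<Sum>i\<in>UNIV. ?w i * ?u i)"
    by (simp add: inner_sum_right power2_norm_eq_inner)
  have "\<exists>i. N\<^sup>2 / ?n \<le> ?w i * ?u i"
  proof (rule ccontr)
    assume "\<not> ?thesis"
    then have "(\<Sum>i\<in>UNIV. ?w i * ?u i) < (\<Sum>i\<in>(UNIV :: 'n set). N\<^sup>2 / ?n)"
      by (intro sum_strict_mono) (auto simp: not_le)
    then show False using sum by simp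
  qed
  then obtain i where i: "N\<^sup>2 / ?n \<le> ?w i * ?u i" by blast
  have "\<bar>?w i\<bar> \<le> B * sqrt (1 / c) * N"
  proof -
    have "\<bar>?w i\<bar> \<le> B * norm (E i) * N" by (rule GB)
    also have "\<dots> \<le> B * sqrt (1 / c) * N" using norm_E(2) B by (intro mult_right_mono mult_left_mono) auto
    finally show ?thesis .
  qed
  then have "\<bar>?w i\<bar> * \<bar>?u i\<bar> \<le> B * sqrt (1 / c) * N * \<bar>?u i\<bar>"
    by (rule mult_right_mono) simp
  then have "N\<^sup>2 / ?n \<le> B * sqrt (1 / c) * N * \<bar>?u i\<bar>"
    using i abs_ge_self[of "?w i * ?u i"] unfolding abs_mult by linarith
  then have "N * N \<le> N * (?n * B * sqrt (1 / c) * \<bar>?u i\<bar>)"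
    using n by (simp add: field_simps power2_eq_square)
  then have "N \<le> ?n * B * sqrt (1 / c) * \<bar>?u i\<bar>" using N by simp
  then have u: "sqrt c / (?n * B) * N \<le> \<bar>?u i\<bar>"
    using n B c by (simp add: field_simps real_sqrt_divide)
  have "(sqrt c / (?n * B) * N)\<^sup>2 \<le> (?u i)\<^sup>2"
    using power_mono[OF u, of 2] c B n N by simp
  then have u2: "c / (?n * B)\<^sup>2 * N\<^sup>2 \<le> (?u i)\<^sup>2"
    using c by (simp add: power_mult_distrib power_divide)
  have "2 * sqrt (1 / c) * (2 * \<rho> + B) < c1 * \<bar>?u i\<bar>"
  proof -
    have "c1 * (sqrt c / (?n * B) * N) \<le> c1 * \<bar>?u i\<bar>" using u c1 by (intro mult_left_mono) auto
    then show ?thesis using large by (simp add: mult.assoc)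
  qed
  also have "\<dots> \<le> \<phi>1 * \<bar>?u i\<bar>" using c1 by (intro mult_right_mono) auto
  finally have big: "2 * sqrt (1 / c) * (2 * \<rho> + B) < \<phi>1 * \<bar>?u i\<bar>" .
  have "A2 (E i) p = - (N\<^sup>2 / 2) * (\<phi>1 * ?u i + 2 * dz (E i) / \<zeta>)"
    using first[of "E i"] A2s[of p "E i"] N by (simp add: field_simps)
  then have lw: "lam i * ?w i = - (N\<^sup>2 / 2) * (\<phi>1 * ?u i + 2 * dz (E i) / \<zeta>) - p \<bullet> Gam (E i) p"
    using eig[of i p] by simp
  have dzE: "\<bar>2 * dz (E i) / \<zeta>\<bar> \<le> 4 * \<rho> * sqrt (1 / c)"
  proof -
    have "\<bar>dz (E i)\<bar> \<le> 2 * R * sqrt (1 / c)"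
      using dz[of "E i"] norm_E(2)[of i] R mult_left_mono[of "norm (E i)" "sqrt (1 / c)" "2 * R"] by linarith
    then have "2 * \<bar>dz (E i)\<bar> / \<zeta> \<le> 2 * (2 * R * sqrt (1 / c)) / \<zeta>"
      using \<zeta>(1) by (intro divide_right_mono mult_left_mono) auto
    then show ?thesis using \<zeta>(1) by (simp add: abs_mult)
  qed
  have "\<bar>p \<bullet> Gam (E i) p\<bar> \<le> N * norm (Gam (E i) p)" by (rule Cauchy_Schwarz_ineq2)
  also have "\<dots> \<le> N * (B * norm (E i) * N)" using Gam by (intro mult_left_mono) auto
  also have "\<dots> \<le> N * (B * sqrt (1 / c) * N)"
    using norm_E(2) B by (intro mult_left_mono mult_right_mono) auto
  finally have pG: "\<bar>p \<bullet> Gam (E i) p\<bar> \<le> N\<^sup>2 * (B * sqrt (1 / c))"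
    by (simp add: power2_eq_square mult_ac)
  have "0 < N\<^sup>2 / 2 * (\<phi>1 * \<bar>?u i\<bar> - 2 * sqrt (1 / c) * (2 * \<rho> + B))"
    using big N by simp
  then have "0 < N\<^sup>2 / 2 * (\<phi>1 * \<bar>?u i\<bar>) - N\<^sup>2 / 2 * (4 * \<rho> * sqrt (1 / c)) - N\<^sup>2 * (B * sqrt (1 / c))"
    by (simp add: algebra_simps)
  moreover have "N\<^sup>2 / 2 * \<bar>2 * dz (E i) / \<zeta>\<bar> \<le> N\<^sup>2 / 2 * (4 * \<rho> * sqrt (1 / c))"
    using dzE by (intro mult_left_mono) auto
  ultimately have key: "N\<^sup>2 / 2 * \<bar>2 * dz (E i) / \<zeta>\<bar> + \<bar>p \<bullet> Gam (E i) p\<bar> < N\<^sup>2 / 2 * (\<phi>1 * \<bar>?u i\<bar>)"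
    using pG by linarith
  define d where "d = N\<^sup>2 / 2 * (2 * dz (E i) / \<zeta>)"
  have d: "\<bar>d\<bar> = N\<^sup>2 / 2 * \<bar>2 * dz (E i) / \<zeta>\<bar>" by (simp add: d_def abs_mult)
  have lw': "lam i * ?w i = - (N\<^sup>2 / 2 * (\<phi>1 * ?u i)) - d - p \<bullet> Gam (E i) p"
    using lw by (simp add: d_def algebra_simps)
  have key': "\<bar>d\<bar> + \<bar>p \<bullet> Gam (E i) p\<bar> < N\<^sup>2 / 2 * (\<phi>1 * \<bar>?u i\<bar>)" unfolding d by (rule key)
  \<comment> \<open>\<open>?w i\<close> and \<open>?u i\<close> have the same sign, and the term
    with \<open>\<phi>1\<close> outweighs the rest of \<open>lam i * ?w i\<close>, so that product
    has the sign opposite to both.\<close>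
  have wu: "0 < ?w i * ?u i" using i N n by (intro less_le_trans[OF divide_pos_pos i]) auto
  have "lam i < 0"
  proof (cases "0 < ?u i")
    case True
    then have "0 < ?w i" using wu by (simp add: zero_less_mult_iff)
    moreover have "lam i * ?w i < 0" using lw' key' unfolding abs_of_pos[OF True] by linarith
    ultimately show ?thesis by (simp add: mult_less_0_iff)
  next
    case False
    then have "?w i < 0" "?u i < 0" using wu by (auto simp: zero_less_mult_iff)
    moreover have "0 < lam i * ?w i"
      using lw' key' unfolding abs_of_neg[OF \<open>?u i < 0\<close>] mult_minus_right by linarith
    ultimately show ?thesis by (simp add: zero_less_mult_iff)
  qed
  then show thesis using that u2 by blast
qed

text \<open>The sum of the error coefficients in the next lemma, where \<open>1 / c\<close> bounds
  |E_i|^2: the first summand comes from the Christoffel terms, the middle two from the eigenvalue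
  times the derivative of the metric, and 60 = 48 + 4 + 8 from the cutoff.\<close>

definition "K1 = 4 * B / c + 2 * (B / c)\<^sup>2 + B\<^sup>2 / c ^ 3 + 60 / c"

text \<open>Each bad term is paid for separately. One of the two copies of \<open>S i\<close> / N^2
  absorbs \<open>lam i * g' i\<close>, since \<open>lam i\<close> is controlled by the square root
  of \<open>S i\<close> up to order N; the other copy is nonnegative. Second derivatives of u
  contracted with \<open>p\<close>, including the squared derivative of ln |p|^2, are rewritten by
  the first-order condition. What is left has order 1 + N + \<rho> + \<rho>^2.\<close>

lemma second_order_pointwise:
  "\<phi>1\<^sup>2 * (p \<bullet> E i)\<^sup>2 / 2 - K1 * (1 + N + \<rho> + \<rho>\<^sup>2) + \<phi>1 * lam i
    + 2 * (A3 i - gam' i - A2 p (Gam (E i) (E i)) - lam i * g' i) / N\<^sup>2 \<le> 0"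
proof -
  define e where "e = 1 / c"
  let ?u = "p \<bullet> E i"
  have e: "0 < e" using c by (simp add: e_def)
  have norm_E: "(norm (E i))\<^sup>2 \<le> e" using norm_E by (simp add: e_def)
  have norm_Gam_E: "norm (Gam (E i) (E i)) \<le> B * e" using norm_Gam_E by (simp add: e_def)
  have N2: "0 < N\<^sup>2" using N by simp
  have t1: "2 * \<bar>gam' i\<bar> / N\<^sup>2 \<le> 2 * B * e"
  proof -
    have "\<bar>gam' i\<bar> \<le> B * N\<^sup>2 * e"
      using gam'[of i] order_trans mult_left_mono[OF norm_E, of "B * N\<^sup>2"] B by fastforce
    then have "2 * \<bar>gam' i\<bar> / N\<^sup>2 \<le> 2 * (B * N\<^sup>2 * e) / N\<^sup>2"
      by (intro divide_right_mono mult_left_mono) auto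
    then show ?thesis using N2 by simp
  qed
  have t2: "2 * \<bar>A2 p (Gam (E i) (E i))\<bar> / N\<^sup>2 \<le> (N + 4 * \<rho>) * (B * e)"
  proof -
    have "2 * A2 p (Gam (E i) (E i)) / N\<^sup>2 = - (\<phi>1 * (p \<bullet> Gam (E i) (E i))) - 2 * dz (Gam (E i) (E i)) / \<zeta>"
      using first[of "Gam (E i) (E i)"] by linarith
    moreover have "\<bar>\<phi>1 * (p \<bullet> Gam (E i) (E i))\<bar> \<le> N * (B * e)"
    proof -
      have "\<bar>p \<bullet> Gam (E i) (E i)\<bar> \<le> N * norm (Gam (E i) (E i))" by (rule Cauchy_Schwarz_ineq2)
      also have "\<dots> \<le> N * (B * e)" using norm_Gam_E by (intro mult_left_mono) auto
      finally show ?thesis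
        using c1 mult_left_le_one_le[of "\<bar>p \<bullet> Gam (E i) (E i)\<bar>" \<phi>1] by (simp add: abs_mult)
    qed
    moreover have "\<bar>2 * dz (Gam (E i) (E i)) / \<zeta>\<bar> \<le> 4 * \<rho> * (B * e)"
    proof -
      have "\<bar>dz (Gam (E i) (E i))\<bar> \<le> 2 * R * (B * e)"
        using dz[of "Gam (E i) (E i)"] norm_Gam_E R
          mult_left_mono[of "norm (Gam (E i) (E i))" "B * e" "2 * R"] by linarith
      then have "2 * \<bar>dz (Gam (E i) (E i))\<bar> / \<zeta> \<le> 2 * (2 * R * (B * e)) / \<zeta>"
        using \<zeta>(1) by (intro divide_right_mono mult_left_mono) auto
      then show ?thesis using \<zeta>(1) by (simp add: abs_mult mult_ac)
    qed
    moreover have "2 * \<bar>A2 p (Gam (E i) (E i))\<bar> / N\<^sup>2 = \<bar>2 * A2 p (Gam (E i) (E i)) / N\<^sup>2\<bar>"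
      by (simp add: abs_mult)
    ultimately show ?thesis by (simp only: distrib_right)
  qed
  have S0: "0 \<le> S i"
  proof -
    have "0 \<le> N\<^sup>2 * S i" using A2S[of p i] zero_le_power2 order_trans by blast
    then show ?thesis using N2 by (simp add: zero_le_mult_iff)
  qed
  have pG: "\<bar>p \<bullet> Gam (E i) (E i)\<bar> \<le> N * (B * e)"
  proof -
    have "\<bar>p \<bullet> Gam (E i) (E i)\<bar> \<le> N * norm (Gam (E i) (E i))" by (rule Cauchy_Schwarz_ineq2)
    also have "\<dots> \<le> N * (B * e)" using norm_Gam_E by (intro mult_left_mono) auto
    finally show ?thesis .
  qed
  have lamE: "lam i = A2 (E i) (E i) - p \<bullet> Gam (E i) (E i)"
    using eig[of i "E i"] E by (simp add: orthonormal_wrt_def)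
  have t3: "2 * \<bar>lam i * g' i\<bar> / N\<^sup>2 \<le> S i / N\<^sup>2 + B\<^sup>2 * e ^ 3 + 2 * (B * e)\<^sup>2"
  proof -
    have "(A2 (E i) (E i))\<^sup>2 \<le> e * S i"
      using A2S[of "E i" i] mult_right_mono[OF norm_E S0] order_trans by blast
    then have "\<bar>A2 (E i) (E i)\<bar> \<le> sqrt (e * S i)" by (metis real_sqrt_abs real_sqrt_le_mono)
    then have lamb: "\<bar>lam i\<bar> \<le> sqrt (e * S i) + N * (B * e)" using lamE pG by linarith
    have gb: "\<bar>g' i\<bar> \<le> B * N * e"
      using g'[of i] order_trans mult_left_mono[OF norm_E, of "B * N"] B by fastforce
    have "2 * \<bar>lam i * g' i\<bar> / N\<^sup>2 \<le> 2 * ((sqrt (e * S i) + N * (B * e)) * (B * N * e)) / N\<^sup>2"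
      unfolding abs_mult using lamb gb e S0 N B
      by (intro divide_right_mono mult_left_mono mult_mono) auto
    also have "\<dots> = 2 * (sqrt (S i) / N) * (B * e * sqrt e) + 2 * (B * e)\<^sup>2"
    proof -
      have alg: "2 * ((k * a + N * b) * (b * N)) / N\<^sup>2 = 2 * (a / N) * (b * k) + 2 * b\<^sup>2" for a b k :: real
        using N by (simp add: field_simps power2_eq_square)
      show ?thesis using alg[of "sqrt e" "sqrt (S i)" "B * e"] by (simp only: real_sqrt_mult mult_ac)
    qed
    also have "2 * (sqrt (S i) / N) * (B * e * sqrt e) \<le> (sqrt (S i) / N)\<^sup>2 + (B * e * sqrt e)\<^sup>2"
      by (rule sum_squares_bound)
    also have "(sqrt (S i) / N)\<^sup>2 = S i / N\<^sup>2" using S0 by (simp add: power_divide)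
    also have "(B * e * sqrt e)\<^sup>2 = B\<^sup>2 * e ^ 3"
      unfolding power_mult_distrib real_sqrt_pow2[OF less_imp_le[OF e]]
      by (simp add: power2_eq_square power3_eq_cube)
    finally show ?thesis by simp
  qed
  have dz2: "(dz (E i) / \<zeta>)\<^sup>2 \<le> 4 * e * \<rho>\<^sup>2"
  proof -
    have "(dz (E i))\<^sup>2 \<le> (2 * R * norm (E i))\<^sup>2"
      using dz[of "E i"] by (metis abs_ge_zero abs_le_square_iff abs_of_nonneg order_trans)
    also have "\<dots> \<le> 4 * R\<^sup>2 * e"
      using mult_left_mono[OF norm_E, of "4 * R\<^sup>2"] unfolding power_mult_distrib by simp
    finally have "(dz (E i))\<^sup>2 / \<zeta>\<^sup>2 \<le> 4 * R\<^sup>2 * e / \<zeta>\<^sup>2" by (rule divide_right_mono) simp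
    then show ?thesis by (simp add: power_divide mult_ac)
  qed
  \<comment> \<open>With these weights the coefficient 2 of \<open>\<phi>1\<close>^2 (p . E_i)^2 is
    reduced by 3/2 only, so 1/2 survives.\<close>
  have young: "(a + b)\<^sup>2 \<le> 3 / 2 * a\<^sup>2 + 3 * b\<^sup>2" for a b :: real
  proof -
    have "0 \<le> (a - 2 * b)\<^sup>2" by simp
    then show ?thesis by (simp add: power2_eq_square algebra_simps)
  qed
  have t4: "(2 * A2 p (E i) / N\<^sup>2)\<^sup>2 \<le> 3 / 2 * (\<phi>1\<^sup>2 * ?u\<^sup>2) + 48 * e * \<rho>\<^sup>2"
  proof -
    have "2 * A2 p (E i) / N\<^sup>2 = - (\<phi>1 * ?u + 2 * (dz (E i) / \<zeta>))"
      using first[of "E i"] by simp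
    then have "(2 * A2 p (E i) / N\<^sup>2)\<^sup>2 = (\<phi>1 * ?u + 2 * (dz (E i) / \<zeta>))\<^sup>2"
      by (simp only: power2_minus)
    also have "\<dots> \<le> 3 / 2 * (\<phi>1 * ?u)\<^sup>2 + 3 * (2 * (dz (E i) / \<zeta>))\<^sup>2"
      by (rule young)
    also have "\<dots> \<le> 3 / 2 * (\<phi>1\<^sup>2 * ?u\<^sup>2) + 48 * e * \<rho>\<^sup>2"
      unfolding power_mult_distrib using dz2 by simp
    finally show ?thesis .
  qed
  have t5: "(norm (E i))\<^sup>2 / \<zeta> \<le> e * \<rho>\<^sup>2"
  proof -
    have "1 / \<zeta> \<le> \<rho>\<^sup>2" using \<zeta> by (simp add: power_divide field_simps power2_eq_square)
    then have "(norm (E i))\<^sup>2 * (1 / \<zeta>) \<le> e * \<rho>\<^sup>2" using norm_E \<zeta> e by (intro mult_mono) auto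
    then show ?thesis by simp
  qed
  have t6: "\<phi>1 * lam i - N * (B * e) \<le> \<phi>1 * A2 (E i) (E i)"
  proof -
    have "\<phi>1 * \<bar>p \<bullet> Gam (E i) (E i)\<bar> \<le> 1 * (N * (B * e))"
      using pG c1 by (intro mult_mono) auto
    moreover have "\<bar>\<phi>1 * (p \<bullet> Gam (E i) (E i))\<bar> = \<phi>1 * \<bar>p \<bullet> Gam (E i) (E i)\<bar>"
      using c1 by (simp add: abs_mult)
    ultimately show ?thesis unfolding lamE right_diff_distrib by linarith
  qed
  define X where "X = A3 i - gam' i - A2 p (Gam (E i) (E i)) - lam i * g' i"
  have split: "2 * (S i + A3 i) / N\<^sup>2 = 2 * (S i / N\<^sup>2) + 2 * X / N\<^sup>2 + 2 * gam' i / N\<^sup>2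
      + 2 * A2 p (Gam (E i) (E i)) / N\<^sup>2 + 2 * (lam i * g' i) / N\<^sup>2"
    unfolding X_def by (simp add: add_divide_distrib diff_divide_distrib)
  have abs: "- (2 * \<bar>y\<bar> / N\<^sup>2) \<le> 2 * y / N\<^sup>2" for y
    using divide_right_mono[of "- (2 * \<bar>y\<bar>)" "2 * y" "N\<^sup>2"] N2 by (simp add: divide_minus_left)
  have "\<phi>1\<^sup>2 * ?u\<^sup>2 / 2 + \<phi>1 * lam i + 2 * X / N\<^sup>2
      \<le> 2 * B * e + (N + 4 * \<rho>) * (B * e) + (B\<^sup>2 * e ^ 3 + 2 * (B * e)\<^sup>2)
        + 60 * e * \<rho>\<^sup>2 + N * (B * e)"
  proof -
    have "0 \<le> S i / N\<^sup>2" using S0 by simp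
    have "2 * (- 2 * (norm (E i))\<^sup>2 / \<zeta> - (dz (E i))\<^sup>2 / \<zeta>\<^sup>2)
        = - 4 * ((norm (E i))\<^sup>2 / \<zeta>) - 2 * (dz (E i) / \<zeta>)\<^sup>2"
      by (simp add: power_divide)
    then have "2 * (- 2 * (norm (E i))\<^sup>2 / \<zeta> - (dz (E i))\<^sup>2 / \<zeta>\<^sup>2) \<ge> - 4 * (e * \<rho>\<^sup>2) - 8 * e * \<rho>\<^sup>2"
      using t5 dz2 by linarith
    then show ?thesis
      using second[of i] split t1 t2 t3 t4 t6 \<open>0 \<le> S i / N\<^sup>2\<close> abs[of "gam' i"]
        abs[of "A2 p (Gam (E i) (E i))"] abs[of "lam i * g' i"]
      by (simp only: mult.assoc)
  qed
  also have "\<dots> \<le> K1 * (1 + N + \<rho> + \<rho>\<^sup>2)"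
  proof -
    have "K1 = 4 * (B * e) + 2 * (B * e)\<^sup>2 + B\<^sup>2 * e ^ 3 + 60 * e"
      by (simp add: K1_def e_def power_divide power_mult_distrib)
    moreover have "0 \<le> B * e" "0 \<le> (B * e)\<^sup>2" "0 \<le> B\<^sup>2 * e ^ 3" using B e by auto
    moreover define a b d where "a = B * e" and "b = (B * e)\<^sup>2" and "d = B\<^sup>2 * e ^ 3"
    ultimately have K: "K1 = 4 * a + 2 * b + d + 60 * e" and nn: "0 \<le> a" "0 \<le> b" "0 \<le> d" by auto
    define r where "r = \<rho>"
    have r: "0 \<le> r" "0 \<le> N" using rho N by (auto simp: r_def)
    have "K1 * (1 + N + r + r\<^sup>2) - (2 * a + (N + 4 * r) * a + (d + 2 * b) + 60 * (e * r\<^sup>2) + N * a)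
        = 2 * a + 2 * (a * N) + 4 * (a * r\<^sup>2) + 2 * (b * (N + r + r\<^sup>2)) + d * (N + r + r\<^sup>2) + 60 * (e * (1 + N + r))"
      unfolding K by (simp add: algebra_simps)
    also have "\<dots> \<ge> 0" using nn r e by (intro add_nonneg_nonneg mult_nonneg_nonneg) auto
    finally have "2 * a + (N + 4 * r) * a + (d + 2 * b) + 60 * (e * r\<^sup>2) + N * a \<le> K1 * (1 + N + r + r\<^sup>2)"
      by linarith
    then show ?thesis by (simp only: a_def b_def d_def r_def mult.assoc)
  qed
  finally show ?thesis unfolding X_def by linarith
qed

text \<open>If the bound fails, N exceeds both \<open>C\<close> and \<open>C * \<rho>\<close>. The
  pointwise inequality, summed with the weights \<open>F i\<close>, contains the good term \<kappa>
  N^2 (1 + T), where T is the sum of the weights. Its part with T beats the errors, which are at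
  most 4 K1 T N^2 / C; its part without T beats the right-hand side, which is at most 4 Ch
  C^(\<gamma> - 1) N^2. The sum of \<open>F i * lam i\<close> enters with a favourable sign.\<close>

lemma gradient_bound:
  fixes C Ch \<gamma> :: real
  assumes \<gamma>: "0 < \<gamma>" "\<gamma> < 1" and Ch: "0 \<le> Ch"
    and h': "1 \<le> N \<Longrightarrow> \<bar>h'\<bar> \<le> Ch * (N powr (3 + \<gamma>) + N powr (2 + \<gamma>) * \<rho>)"
    and C: "1 \<le> C" "2 * sqrt (1 / c) * (2 + B) \<le> c1 * (sqrt c / (CARD('n) * B)) * C"
      "4 * K1 < c1\<^sup>2 / 2 * (c / (CARD('n) * B)\<^sup>2) * \<nu>0 * C"
      "4 * Ch * C powr (\<gamma> - 1) < c1\<^sup>2 / 2 * (c / (CARD('n) * B)\<^sup>2) * \<nu>0"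
  shows "N \<le> C * (1 + \<rho>)"
proof (rule ccontr)
  assume "\<not> N \<le> C * (1 + \<rho>)"
  then have NC: "C * (1 + \<rho>) < N" by simp
  have r: "0 < \<rho>" by (rule rho)
  have NCge: "C \<le> N" "C * \<rho> \<le> N" using NC C(1) r mult_pos_pos[of C \<rho>] by (auto simp: distrib_left)
  have N1: "1 \<le> N" using NCge C(1) by simp
  have "2 * sqrt (1 / c) * (2 * \<rho> + B) < c1 * (sqrt c / (CARD('n) * B)) * N"
  proof -
    have "2 * sqrt (1 / c) * (2 * \<rho> + B) \<le> 2 * sqrt (1 / c) * (2 + B) * (1 + \<rho>)"
    proof -
      have "0 \<le> B * \<rho>" using r B by (intro mult_nonneg_nonneg) linarith+
      then have "2 * \<rho> + B \<le> (2 + B) * (1 + \<rho>)" unfolding distrib_left distrib_right by linarith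
      then have "2 * sqrt (1 / c) * (2 * \<rho> + B) \<le> 2 * sqrt (1 / c) * ((2 + B) * (1 + \<rho>))"
        using c by (intro mult_left_mono) auto
      then show ?thesis by (simp only: mult.assoc)
    qed
    also have "\<dots> \<le> c1 * (sqrt c / (CARD('n) * B)) * C * (1 + \<rho>)"
      using C(2) r by (intro mult_right_mono) auto
    also have "\<dots> < c1 * (sqrt c / (CARD('n) * B)) * N"
      unfolding mult.assoc[of _ C] using NC c1 c B by (intro mult_strict_left_mono) auto
    finally show ?thesis .
  qed
  from negative_direction[OF this]
  obtain i where i: "lam i < 0" "c / (CARD('n) * B)\<^sup>2 * N\<^sup>2 \<le> (p \<bullet> E i)\<^sup>2"
    by blast
  define T where "T = (\<Sum>j\<in>UNIV. F j)"
  have T: "0 < T" unfolding T_def using F(1) by (intro sum_pos) auto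
  \<comment> \<open>The product of the factor 1/2 from \<open>second_order_pointwise\<close> with
    the lower bound for \<open>\<phi>1\<close>^2, the share of N^2 carried by (p . E_i)^2 in the
    negative direction, and \<open>\<nu>0\<close>.\<close>
  define \<kappa> where "\<kappa> = c1\<^sup>2 / 2 * (c / (CARD('n) * B)\<^sup>2) * \<nu>0"
  have "(\<Sum>j\<in>UNIV. F j * (\<phi>1\<^sup>2 * (p \<bullet> E j)\<^sup>2 / 2 - K1 * (1 + N + \<rho> + \<rho>\<^sup>2) + \<phi>1 * lam j
    + 2 * (A3 j - gam' j - A2 p (Gam (E j) (E j)) - lam j * g' j) / N\<^sup>2)) \<le> 0"
    using F(1) second_order_pointwise by (intro sum_nonpos mult_nonneg_nonpos) (auto intro: less_imp_le)
  also have "(\<Sum>j\<in>UNIV. F j * (\<phi>1\<^sup>2 * (p \<bullet> E j)\<^sup>2 / 2 - K1 * (1 + N + \<rho> + \<rho>\<^sup>2) + \<phi>1 * lam j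
    + 2 * (A3 j - gam' j - A2 p (Gam (E j) (E j)) - lam j * g' j) / N\<^sup>2))
    = (\<Sum>j\<in>UNIV. F j * (\<phi>1\<^sup>2 * (p \<bullet> E j)\<^sup>2 / 2)) - T * (K1 * (1 + N + \<rho> + \<rho>\<^sup>2)) + \<phi>1 * (\<Sum>j\<in>UNIV. F j * lam j)
      + 2 / N\<^sup>2 * h'"
    unfolding lin[symmetric] T_def
    by (simp add: algebra_simps sum.distrib sum_subtractf sum_distrib_left sum_distrib_right
        diff_divide_distrib sum_divide_distrib add_divide_distrib)
  finally have main: "(\<Sum>j\<in>UNIV. F j * (\<phi>1\<^sup>2 * (p \<bullet> E j)\<^sup>2 / 2))
      \<le> T * (K1 * (1 + N + \<rho> + \<rho>\<^sup>2)) - 2 / N\<^sup>2 * h'"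
    using F(3) c1 mult_nonneg_nonneg[of \<phi>1 "\<Sum>j\<in>UNIV. F j * lam j"] by linarith
  have low: "\<kappa> * N\<^sup>2 * (1 + T) \<le> (\<Sum>j\<in>UNIV. F j * (\<phi>1\<^sup>2 * (p \<bullet> E j)\<^sup>2 / 2))"
  proof -
    have "c1\<^sup>2 * (c / (CARD('n) * B)\<^sup>2 * N\<^sup>2) \<le> \<phi>1\<^sup>2 * (p \<bullet> E i)\<^sup>2"
      using i(2) c1 c by (intro mult_mono power_mono) auto
    then have "(\<nu>0 * (1 + T)) * (c1\<^sup>2 * (c / (CARD('n) * B)\<^sup>2 * N\<^sup>2) / 2) \<le> F i * (\<phi>1\<^sup>2 * (p \<bullet> E i)\<^sup>2 / 2)"
      using F(2)[OF i(1)] \<nu>0 T c F(1)[of i] by (intro mult_mono) (auto simp: T_def)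
    also have "\<dots> \<le> (\<Sum>j\<in>UNIV. F j * (\<phi>1\<^sup>2 * (p \<bullet> E j)\<^sup>2 / 2))"
      using F(1) by (intro member_le_sum) (simp_all add: less_imp_le)
    finally show ?thesis by (simp add: \<kappa>_def mult_ac)
  qed
  have K1: "0 \<le> K1" using B c by (simp add: K1_def)
  have poly: "C * (1 + N + \<rho> + \<rho>\<^sup>2) \<le> 4 * N\<^sup>2"
  proof -
    have "C * 1 \<le> N * N" using NCge N1 mult_mono[of C N 1 N] C(1) by simp
    moreover have "C * N \<le> N * N" using NCge N1 by (intro mult_right_mono) auto
    moreover have "C * \<rho> \<le> N * N" using NCge N1 mult_mono[of "C * \<rho>" N 1 N] r C(1) by simp
    moreover have "C * \<rho>\<^sup>2 \<le> N * N"
    proof -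
      have "\<rho> \<le> N" using NCge C(1) r mult_right_mono[of 1 C \<rho>] by simp
      then have "(C * \<rho>) * \<rho> \<le> N * N" using NCge r N1 C(1) by (intro mult_mono) auto
      then show ?thesis by (simp only: power2_eq_square mult.assoc)
    qed
    ultimately show ?thesis by (simp only: power2_eq_square distrib_left mult_1_right)
  qed
  have h: "2 / N\<^sup>2 * \<bar>h'\<bar> \<le> 4 * Ch * C powr (\<gamma> - 1) * N\<^sup>2"
  proof -
    have "N powr (2 + \<gamma>) * \<rho> \<le> N powr (2 + \<gamma>) * N"
      using NCge C(1) r mult_right_mono[of 1 C \<rho>] by (intro mult_left_mono) auto
    also have "\<dots> = N powr (3 + \<gamma>)" using N powr_add[of N "2 + \<gamma>" 1] by simp
    finally have "\<bar>h'\<bar> \<le> Ch * (2 * N powr (3 + \<gamma>))"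
      using h'[OF N1] Ch mult_left_mono[of "N powr (3 + \<gamma>) + N powr (2 + \<gamma>) * \<rho>" "2 * N powr (3 + \<gamma>)" Ch]
      by simp
    also have "N powr (3 + \<gamma>) = N powr (\<gamma> - 1) * (N\<^sup>2 * N\<^sup>2)"
      using N powr_add[of N "\<gamma> - 1" 4] by simp
    also have "N powr (\<gamma> - 1) \<le> C powr (\<gamma> - 1)"
      using NCge C(1) \<gamma> by (intro powr_mono2') auto
    finally have "\<bar>h'\<bar> \<le> Ch * (2 * (C powr (\<gamma> - 1) * (N\<^sup>2 * N\<^sup>2)))"
      using Ch by (simp add: mult_left_mono mult_right_mono)
    then show ?thesis using N by (simp add: field_simps power2_eq_square)
  qed
  have "\<kappa> * N\<^sup>2 * (1 + T) * C \<le> (T * (K1 * (1 + N + \<rho> + \<rho>\<^sup>2)) + 2 / N\<^sup>2 * \<bar>h'\<bar>) * C"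
  proof (rule mult_right_mono)
    have "2 / N\<^sup>2 * (- h') \<le> 2 / N\<^sup>2 * \<bar>h'\<bar>" by (rule mult_left_mono) auto
    then show "\<kappa> * N\<^sup>2 * (1 + T) \<le> T * (K1 * (1 + N + \<rho> + \<rho>\<^sup>2)) + 2 / N\<^sup>2 * \<bar>h'\<bar>"
      using low main unfolding mult_minus_right by linarith
  qed (use C(1) in simp)
  also have "\<dots> \<le> T * K1 * (4 * N\<^sup>2) + 4 * Ch * C powr (\<gamma> - 1) * N\<^sup>2 * C"
  proof -
    have "T * K1 * (C * (1 + N + \<rho> + \<rho>\<^sup>2)) \<le> T * K1 * (4 * N\<^sup>2)"
      using poly T K1 by (intro mult_left_mono) auto
    moreover have "2 / N\<^sup>2 * \<bar>h'\<bar> * C \<le> 4 * Ch * C powr (\<gamma> - 1) * N\<^sup>2 * C"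
      using h C(1) by (intro mult_right_mono) auto
    moreover have "T * (K1 * (1 + N + \<rho> + \<rho>\<^sup>2)) * C = T * K1 * (C * (1 + N + \<rho> + \<rho>\<^sup>2))"
      by (simp only: mult_ac)
    ultimately show ?thesis unfolding distrib_right[of _ _ C] by linarith
  qed
  also have "\<dots> < (\<kappa> * C) * (T * N\<^sup>2) + \<kappa> * (N\<^sup>2 * C)"
  proof (rule add_strict_mono)
    have "4 * K1 < \<kappa> * C" using C(3) by (simp add: \<kappa>_def)
    then have "(4 * K1) * (T * N\<^sup>2) < (\<kappa> * C) * (T * N\<^sup>2)" using T N by (intro mult_strict_right_mono) auto
    then show "T * K1 * (4 * N\<^sup>2) < (\<kappa> * C) * (T * N\<^sup>2)" by (simp add: mult_ac)
    have "4 * Ch * C powr (\<gamma> - 1) * (N\<^sup>2 * C) < \<kappa> * (N\<^sup>2 * C)"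
      using C(1,4) N unfolding \<kappa>_def by (intro mult_strict_right_mono) auto
    then show "4 * Ch * C powr (\<gamma> - 1) * N\<^sup>2 * C < \<kappa> * (N\<^sup>2 * C)" by (simp add: mult_ac)
  qed
  also have "\<dots> = \<kappa> * N\<^sup>2 * (1 + T) * C" by (simp add: algebra_simps)
  finally show False by simp
qed

end


section \<open>The local estimate in coordinates\<close>

lemma line_has_vector_derivative:
  assumes "(k has_derivative k') (at (x + t *\<^sub>R e))"
  shows "((\<lambda>t. k (x + t *\<^sub>R e)) has_vector_derivative k' e) (at t)"
proof -
  have "((\<lambda>t. x + t *\<^sub>R e) has_derivative (\<lambda>t. t *\<^sub>R e)) (at t)"
    by (auto intro!: derivative_eq_intros)
  then have "((\<lambda>t. k (x + t *\<^sub>R e)) has_derivative (\<lambda>t. k' (t *\<^sub>R e))) (at t)"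
    using assms by (rule has_derivative_compose)
  then show ?thesis
    using has_derivative_linear[OF assms] by (simp add: has_vector_derivative_def linear_cmul)
qed

text \<open>Logarithms are taken only near 0, where all three factors are positive by continuity.
  There the claim is the one-variable derivative test for ln a - (ln b) / 2 + 2 ln z.\<close>

lemma log_test_function:
  fixes a b z :: "real \<Rightarrow> real"
  assumes \<delta>: "0 < \<delta>"
    and a1: "\<And>t. \<bar>t\<bar> < \<delta> \<Longrightarrow> (a has_real_derivative a1 t) (at t)" and a2: "(a1 has_real_derivative a2) (at 0)"
    and b1: "\<And>t. \<bar>t\<bar> < \<delta> \<Longrightarrow> (b has_real_derivative b1 t) (at t)" and b2: "(b1 has_real_derivative b2) (at 0)"
    and z1: "\<And>t. \<bar>t\<bar> < \<delta> \<Longrightarrow> (z has_real_derivative z1 t) (at t)" and z2: "(z1 has_real_derivative z2) (at 0)"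
    and pos: "0 < a 0" "0 < b 0" "0 < z 0"
    and max: "\<And>t. \<bar>t\<bar> < \<delta> \<Longrightarrow> a t * (z t)\<^sup>2 / sqrt (b t) \<le> a 0 * (z 0)\<^sup>2 / sqrt (b 0)"
  shows "a1 0 / a 0 - b1 0 / b 0 / 2 + 2 * (z1 0 / z 0) = 0"
    and "a2 / a 0 - (a1 0 / a 0)\<^sup>2 - (b2 / b 0 - (b1 0 / b 0)\<^sup>2) / 2 + 2 * (z2 / z 0 - (z1 0 / z 0)\<^sup>2) \<le> 0"
proof -
  have ev: "\<forall>\<^sub>F t in nhds 0. 0 < g t" if "\<And>t. \<bar>t\<bar> < \<delta> \<Longrightarrow> (g has_real_derivative g1 t) (at t)" "0 < g 0" for g g1
  proof -
    have "isCont g 0" using that(1)[of 0] \<delta> by (auto intro: DERIV_isCont)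
    then have "(g \<longlongrightarrow> g 0) (nhds 0)" by (simp add: continuous_at_imp_continuous_within isCont_def tendsto_at_iff_tendsto_nhds)
    then show ?thesis using that(2) by (rule order_tendstoD)
  qed
  have "\<forall>\<^sub>F t in nhds 0. 0 < a t \<and> 0 < b t \<and> 0 < z t"
  proof -
    have "\<forall>\<^sub>F t in nhds 0. 0 < a t" by (rule ev[of a a1]) (use a1 pos in auto)
    moreover have "\<forall>\<^sub>F t in nhds 0. 0 < b t" by (rule ev[of b b1]) (use b1 pos in auto)
    moreover have "\<forall>\<^sub>F t in nhds 0. 0 < z t" by (rule ev[of z z1]) (use z1 pos in auto)
    ultimately show ?thesis by eventually_elim auto
  qed
  then obtain d where d: "0 < d" "\<And>t. \<bar>t\<bar> < d \<Longrightarrow> 0 < a t \<and> 0 < b t \<and> 0 < z t"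
    unfolding eventually_nhds_metric by (auto simp: dist_real_def)
  define \<epsilon> where "\<epsilon> = min d \<delta>"
  have \<epsilon>: "0 < \<epsilon>" "\<And>t. \<bar>t\<bar> < \<epsilon> \<Longrightarrow> \<bar>t\<bar> < \<delta>" "\<And>t. \<bar>t\<bar> < \<epsilon> \<Longrightarrow> 0 < a t \<and> 0 < b t \<and> 0 < z t"
    using d \<delta> by (auto simp: \<epsilon>_def)
  define k where "k t = ln (a t) - ln (b t) / 2 + 2 * ln (z t)" for t
  define k1 where "k1 t = a1 t / a t - b1 t / b t / 2 + 2 * (z1 t / z t)" for t
  have kln: "k t = ln (a t * (z t)\<^sup>2 / sqrt (b t))" if "\<bar>t\<bar> < \<epsilon>" for t
    using \<epsilon>(3)[OF that] by (simp add: k_def ln_mult ln_div ln_sqrt ln_realpow)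
  have max': "k t \<le> k 0" if "\<bar>t\<bar> < \<epsilon>" for t
    using max[OF \<epsilon>(2)[OF that]] \<epsilon>(3)[OF that] pos \<epsilon>(1) by (subst (1 2) kln) (auto simp: that)
  have D1: "(k has_real_derivative k1 t) (at t)" if "\<bar>t\<bar> < \<epsilon>" for t
    unfolding k_def k1_def using \<epsilon>(2,3)[OF that]
    by (auto intro!: derivative_eq_intros a1 b1 z1 simp: field_simps)
  have D2: "(k1 has_real_derivative a2 / a 0 - (a1 0 / a 0)\<^sup>2 - (b2 / b 0 - (b1 0 / b 0)\<^sup>2) / 2
      + 2 * (z2 / z 0 - (z1 0 / z 0)\<^sup>2)) (at 0)"
  proof -
    have q: "((\<lambda>t. g1 t / g t) has_real_derivative g2 / g 0 - (g1 0 / g 0)\<^sup>2) (at 0)"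
      if "(g has_real_derivative g1 0) (at 0)" "(g1 has_real_derivative g2) (at 0)" "0 < g 0" for g g1 g2
      using DERIV_divide[OF that(2,1)] that(3) by (simp add: field_simps power2_eq_square)
    show ?thesis unfolding k1_def
      by (intro DERIV_add DERIV_diff DERIV_cdivide DERIV_cmult q a1 b1 z1 a2 b2 z2 pos) (use \<delta> in auto)
  qed
  show "a1 0 / a 0 - b1 0 / b 0 / 2 + 2 * (z1 0 / z 0) = 0"
    using second_derivative_test(1)[OF \<epsilon>(1) max' D1 D2] by (simp add: k1_def)
  show "a2 / a 0 - (a1 0 / a 0)\<^sup>2 - (b2 / b 0 - (b1 0 / b 0)\<^sup>2) / 2 + 2 * (z2 / z 0 - (z1 0 / z 0)\<^sup>2) \<le> 0"
    by (rule second_derivative_test(2)[OF \<epsilon>(1) max' D1 D2])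
qed

lemma bilinear_basis_bound:
  fixes h :: "'a::euclidean_space \<Rightarrow> 'a \<Rightarrow> real"
  assumes "bilinear h"
  shows "\<bar>h v w\<bar> \<le> (\<Sum>a\<in>Basis. \<Sum>b\<in>Basis. \<bar>h a b\<bar>) * norm v * norm w"
proof -
  have "h v w = (\<Sum>a\<in>Basis. \<Sum>b\<in>Basis. (v \<bullet> a) * ((w \<bullet> b) * h a b))"
  proof -
    have "h v w = h (\<Sum>a\<in>Basis. (v \<bullet> a) *\<^sub>R a) (\<Sum>b\<in>Basis. (w \<bullet> b) *\<^sub>R b)"
      by (simp add: euclidean_representation)
    then have "h v w = (\<Sum>b\<in>Basis. \<Sum>a\<in>Basis. (w \<bullet> b) * ((v \<bullet> a) * h a b))"
      by (simp only: bilinear_expand[OF assms] sum_distrib_left)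
    then show ?thesis by (subst sum.swap) (simp only: mult.left_commute)
  qed
  also have "\<bar>\<dots>\<bar> \<le> (\<Sum>a\<in>Basis. \<Sum>b\<in>Basis. norm v * (norm w * \<bar>h a b\<bar>))"
    by (intro order_trans[OF sum_abs] sum_mono order_trans[OF sum_abs])
      (auto simp: abs_mult Basis_le_norm intro!: mult_mono)
  also have "\<dots> = (\<Sum>a\<in>Basis. \<Sum>b\<in>Basis. \<bar>h a b\<bar>) * norm v * norm w"
    by (simp add: sum_distrib_left sum_distrib_right mult_ac)
  finally show ?thesis .
qed

text \<open>For linear \<open>l\<close> this is its Riesz vector in the Euclidean inner product;
  applied to a differential it gives the coordinate gradient.\<close>

definition gradv :: "('a::euclidean_space \<Rightarrow> real) \<Rightarrow> 'a" where
  "gradv l = (\<Sum>b\<in>Basis. l b *\<^sub>R b)"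

lemma gradv_inner:
  assumes "linear l"
  shows "gradv l \<bullet> v = l v"
proof -
  have "l v = l (\<Sum>b\<in>Basis. (b \<bullet> v) *\<^sub>R b)"
    using euclidean_representation[of v] by (simp add: inner_commute)
  also have "\<dots> = (\<Sum>b\<in>Basis. (b \<bullet> v) * l b)"
    unfolding linear_sum[OF assms] linear_cmul[OF assms] by simp
  finally show ?thesis unfolding gradv_def inner_sum_left inner_scaleR_left by (simp only: mult.commute)
qed

lemma C3_jetD:
  assumes "C3_jet U u u1 u2 u3" "x \<in> U"
  shows "(u has_derivative u1 x) (at x)" "((\<lambda>y. u1 y v) has_derivative u2 x v) (at x)"
    "((\<lambda>y. u2 y v w) has_derivative u3 x v w) (at x)" "bilinear (u2 x)" "u2 x v w = u2 x w v"
    "u3 x v w z = u3 x w v z" "u3 x v w z = u3 x v z w" "linear (u1 x)"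
    "gradv (u1 x) \<bullet> v = u1 x v" "gradv (\<lambda>b. u2 x b w) \<bullet> v = u2 x v w" "gradv (\<lambda>b. u3 x b w z) \<bullet> v = u3 x v w z"
    "((\<lambda>y. gradv (u1 y)) has_derivative (\<lambda>e. gradv (\<lambda>b. u2 x b e))) (at x)"
    "((\<lambda>y. gradv (\<lambda>b. u2 y b w)) has_derivative (\<lambda>e. gradv (\<lambda>b. u3 x b w e))) (at x)"
proof -
  show 1: "(u has_derivative u1 x) (at x)" "((\<lambda>y. u1 y v) has_derivative u2 x v) (at x)"
    "((\<lambda>y. u2 y v w) has_derivative u3 x v w) (at x)" "bilinear (u2 x)" "u2 x v w = u2 x w v"
    "u3 x v w z = u3 x w v z" "u3 x v w z = u3 x v z w" for v w z
    using assms unfolding C3_jet_def by blast+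
  show "linear (u1 x)" by (rule has_derivative_linear[OF 1(1)])
  then show "gradv (u1 x) \<bullet> v = u1 x v" by (rule gradv_inner)
  have "linear (\<lambda>b. u2 x b w)" using 1(4) by (simp add: bilinear_def)
  then show "gradv (\<lambda>b. u2 x b w) \<bullet> v = u2 x v w" by (rule gradv_inner)
  have "u3 x b w z = u3 x w z b" for b using 1(6)[of b w z] 1(7)[of w b z] by simp
  then have "(\<lambda>b. u3 x b w z) = u3 x w z" by (rule ext)
  then have "linear (\<lambda>b. u3 x b w z)" using has_derivative_linear[OF 1(3)] by simp
  then show "gradv (\<lambda>b. u3 x b w z) \<bullet> v = u3 x v w z" by (rule gradv_inner)
  show "((\<lambda>y. gradv (u1 y)) has_derivative (\<lambda>e. gradv (\<lambda>b. u2 x b e))) (at x)"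
    unfolding gradv_def by (intro has_derivative_sum has_derivative_scaleR_left 1(2))
  show "((\<lambda>y. gradv (\<lambda>b. u2 y b w)) has_derivative (\<lambda>e. gradv (\<lambda>b. u3 x b w e))) (at x)"
    unfolding gradv_def by (intro has_derivative_sum has_derivative_scaleR_left 1(3))
qed

text \<open>The equation in one chart, with the geometry reduced to bounds: \<open>G\<close> is the
  metric, \<open>Gam\<close> the Christoffel form, \<open>Q\<close> raises an index by the inverse
  metric, and a prime marks the derivative in \<open>x\<close>, with direction \<open>e\<close>.
  Since \<open>c\<close> and \<open>B\<close> serve all of \<open>U\<close>, the resulting constants
  do not depend on the position of a point in \<open>U\<close>, in particular not on its distance
  from the edge.\<close>

locale local_equation =
  fixes U :: "(real^'n::finite) set" and G :: "real^'n \<Rightarrow> real^'n \<Rightarrow> real^'n \<Rightarrow> real"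
    and G' :: "real^'n \<Rightarrow> real^'n \<Rightarrow> real^'n \<Rightarrow> real^'n \<Rightarrow> real"
    and Gam :: "real^'n \<Rightarrow> real^'n \<Rightarrow> real^'n \<Rightarrow> real^'n"
    and Gam' :: "real^'n \<Rightarrow> real^'n \<Rightarrow> real^'n \<Rightarrow> real^'n \<Rightarrow> real^'n"
    and Q :: "real^'n \<Rightarrow> real^'n \<Rightarrow> real^'n" and Q' :: "real^'n \<Rightarrow> real^'n \<Rightarrow> real^'n \<Rightarrow> real^'n"
    and Psi :: "(real^'n) \<times> real \<times> (real^'n) \<Rightarrow> real"
    and Psi' :: "(real^'n) \<times> real \<times> (real^'n) \<Rightarrow> (real^'n) \<times> real \<times> (real^'n) \<Rightarrow> real"
    and \<Gamma> :: "(real^'n) set" and f :: "real^'n \<Rightarrow> real" and c B \<nu>0 \<gamma> C\<psi> :: real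
  assumes U: "open U" and c: "0 < c" and B: "1 \<le> B" and \<Gamma>: "admissible_cone \<Gamma>"
    and f: "admissible_operator \<Gamma> f \<nu>0" and \<gamma>: "0 < \<gamma>" "\<gamma> < 1" and C\<psi>: "0 < C\<psi>"
    and G: "\<And>x. x \<in> U \<Longrightarrow> spd_form (G x)" and Gc: "\<And>x v. x \<in> U \<Longrightarrow> c * (norm v)\<^sup>2 \<le> G x v v"
    and GB: "\<And>x v w. x \<in> U \<Longrightarrow> \<bar>G x v w\<bar> \<le> B * norm v * norm w"
    and G': "\<And>x v w. x \<in> U \<Longrightarrow> ((\<lambda>y. G y v w) has_derivative (\<lambda>e. G' x e v w)) (at x)"
    and G'B: "\<And>x e v w. x \<in> U \<Longrightarrow> \<bar>G' x e v w\<bar> \<le> B * norm e * norm v * norm w"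
    and Gam: "\<And>x. x \<in> U \<Longrightarrow> bilinear (Gam x)" and Gams: "\<And>x v w. x \<in> U \<Longrightarrow> Gam x v w = Gam x w v"
    and GamB: "\<And>x v w. x \<in> U \<Longrightarrow> norm (Gam x v w) \<le> B * norm v * norm w"
    and Gam': "\<And>x v w. x \<in> U \<Longrightarrow> ((\<lambda>y. Gam y v w) has_derivative (\<lambda>e. Gam' x e v w)) (at x)"
    and Gam'B: "\<And>x e v w. x \<in> U \<Longrightarrow> norm (Gam' x e v w) \<le> B * norm e * norm v * norm w"
    and Q: "\<And>x. x \<in> U \<Longrightarrow> linear (Q x)" and GQ: "\<And>x p v. x \<in> U \<Longrightarrow> G x (Q x p) v = p \<bullet> v"
    and Q'l: "\<And>x e. x \<in> U \<Longrightarrow> linear (Q' x e)"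
    and Q': "\<And>x p. x \<in> U \<Longrightarrow> ((\<lambda>y. Q y p) has_derivative (\<lambda>e. Q' x e p)) (at x)"
    and Q'B: "\<And>x e p. x \<in> U \<Longrightarrow> norm (Q' x e p) \<le> B * norm e * norm p"
    and Psi': "\<And>x z w. x \<in> U \<Longrightarrow> (Psi has_derivative Psi' (x, z, w)) (at (x, z, w))"
    and PsiB: "\<And>x z w (E :: 'n \<Rightarrow> real^'n) i l. x \<in> U \<Longrightarrow> orthonormal_wrt (G x) E \<Longrightarrow>
      \<bar>Psi' (x, z, w) (E i, 0, - Gam x (E i) w)\<bar> + \<bar>Psi' (x, z, w) (0, 1, 0)\<bar> * sqrt (G x w w)
      + \<bar>Psi' (x, z, w) (0, 0, E l)\<bar> * (sqrt (G x w w))\<^sup>2 \<le> C\<psi> * sqrt (G x w w) powr (2 + \<gamma>)"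
begin

definition hess :: "(real^'n \<Rightarrow> real^'n \<Rightarrow> real) \<Rightarrow> (real^'n \<Rightarrow> real^'n \<Rightarrow> real^'n \<Rightarrow> real) \<Rightarrow>
    real^'n \<Rightarrow> real^'n \<Rightarrow> real^'n \<Rightarrow> real" where
  "hess u1 u2 x v w = u2 x v w - u1 x (Gam x v w)"

definition solves :: "(real^'n \<Rightarrow> real) \<Rightarrow> (real^'n \<Rightarrow> real^'n \<Rightarrow> real) \<Rightarrow> (real^'n \<Rightarrow> real^'n \<Rightarrow> real^'n \<Rightarrow> real) \<Rightarrow> bool" where
  "solves u u1 u2 \<longleftrightarrow> (\<forall>x\<in>U. \<exists>E lam. orthonormal_wrt (G x) E \<and>
     (\<forall>i v. hess u1 u2 x (E i) v = lam $ i * G x (E i) v) \<and> lam \<in> \<Gamma> \<and>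
     f lam = Psi (x, u x, Q x (gradv (u1 x))))"

text \<open>The three summands bound the contributions of the derivatives of the right-hand side in
  x, z and p, in this order. The cube comes from |\<nabla>u|_g \<le> sqrt (1 / c) |p|, since the
  exponents 2 + \<gamma>, 1 + \<gamma> and \<gamma> all lie below 3.\<close>

definition "Ch = C\<psi> * (max 1 (sqrt (1 / c))) ^ 3 *
  (CARD('n) * (B * sqrt (1 / c)) + 1 + CARD('n) * (B * sqrt (1 / c)) * (B + 3 / c + B / c))"

lemma norm_frame:
  assumes x: "x \<in> U" and E: "orthonormal_wrt (G x) E"
  shows "norm (E i) \<le> sqrt (1 / c)"
proof -
  have "c * (norm (E i))\<^sup>2 \<le> 1" using Gc[OF x, of "E i"] E by (simp add: orthonormal_wrt_def)
  then have "(norm (E i))\<^sup>2 \<le> 1 / c" using c by (simp add: field_simps)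
  then show ?thesis by (rule real_le_rsqrt)
qed

lemma norm_Q: "x \<in> U \<Longrightarrow> norm (Q x p) \<le> norm p / c"
proof -
  assume x: "x \<in> U"
  have "c * (norm (Q x p))\<^sup>2 \<le> p \<bullet> Q x p" using Gc[OF x, of "Q x p"] GQ[OF x] by simp
  also have "\<dots> \<le> norm p * norm (Q x p)" by (rule norm_cauchy_schwarz)
  finally have "(c * norm (Q x p)) * norm (Q x p) \<le> norm p * norm (Q x p)"
    by (simp add: power2_eq_square mult.assoc)
  then have "c * norm (Q x p) \<le> norm p" by (cases "norm (Q x p) = 0") auto
  then show ?thesis using c by (simp add: field_simps)
qed

text \<open>Only upper bounds for the \<open>g\<close>-length of the gradient are needed, since after dividing by powers
  of it all the exponents \<open>2 + \<gamma>\<close>, \<open>1 + \<gamma>\<close>, \<open>\<gamma>\<close> are positive.\<close>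

lemma rhs_derivative_bound:
  fixes E :: "'n \<Rightarrow> real^'n"
  assumes x: "x \<in> U" and E: "orthonormal_wrt (G x) E" and p1: "1 \<le> norm p"
    and r: "0 \<le> r" and a: "norm a \<le> (norm p)\<^sup>2 / 2 * (norm p + 4 * r)"
  shows "\<bar>Psi' (x, z, Q x p) (p, (norm p)\<^sup>2, Q' x p p + Q x a)\<bar>
    \<le> Ch * (norm p powr (3 + \<gamma>) + norm p powr (2 + \<gamma>) * r)"
proof -
  define N where "N = norm p"
  have N: "1 \<le> N" using p1 by (simp add: N_def)
  define w where "w = Q x p"
  define g where "g = sqrt (G x w w)"
  define s where "s = sqrt (1 / c)"
  define D where "D = Psi' (x, z, w)"
  have D: "linear D" unfolding D_def by (rule has_derivative_linear[OF Psi'[OF x]])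
  have s: "0 < s" "s\<^sup>2 = 1 / c" using c by (auto simp: s_def)
  have p0: "p \<noteq> 0" using p1 by auto
  have w0: "w \<noteq> 0"
  proof
    assume "w = 0"
    then have "p \<bullet> p = 0" using GQ[OF x, of p p] spd_formD(1)[OF G[OF x]] by (simp add: w_def bilinear_expand)
    then show False using p0 by simp
  qed
  have g: "0 < g" using spd_formD(3)[OF G[OF x] w0] by (simp add: g_def)
  have gN: "g \<le> s * N"
  proof -
    have "g\<^sup>2 = p \<bullet> w" using GQ[OF x, of p w] g by (simp add: g_def w_def)
    also have "\<dots> \<le> N * norm w" unfolding N_def by (rule norm_cauchy_schwarz)
    also have "\<dots> \<le> N * (N / c)" using norm_Q[OF x, of p] N by (intro mult_left_mono) (auto simp: w_def N_def)
    also have "\<dots> = (s * N)\<^sup>2" unfolding power_mult_distrib s(2) by (simp add: power2_eq_square)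
    finally show ?thesis by (rule power2_le_imp_le) (use s(1) N in simp)
  qed
  define m where "m = max 1 s"
  have m: "1 \<le> m" "s \<le> m" by (auto simp: m_def)
  have gpow: "g powr (k + \<gamma>) \<le> m ^ 3 * N powr (k + \<gamma>)" if "0 \<le> k" "k \<le> 2" for k
  proof -
    have "g powr (k + \<gamma>) \<le> (m * N) powr (k + \<gamma>)"
    proof (rule powr_mono2)
      have "s * N \<le> m * N" using m N by (intro mult_right_mono) auto
      then show "g \<le> m * N" using gN by simp
    qed (use that \<gamma> g in auto)
    also have "\<dots> = m powr (k + \<gamma>) * N powr (k + \<gamma>)" using m N by (simp add: powr_mult)
    also have "m powr (k + \<gamma>) \<le> m powr 3" using that \<gamma> m by (intro powr_mono) auto
    also have "m powr 3 = m ^ 3" using m by simp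
    finally show ?thesis by (simp add: mult_right_mono)
  qed
  have bnd: "\<bar>D (E i, 0, - Gam x (E i) w)\<bar> + \<bar>D (0, 1, 0)\<bar> * g + \<bar>D (0, 0, E l)\<bar> * g\<^sup>2 \<le> C\<psi> * g powr (2 + \<gamma>)"
    for i l unfolding D_def g_def by (rule PsiB[OF x E])
  have nn: "0 \<le> \<bar>D (E i, 0, - Gam x (E i) w)\<bar>" "0 \<le> \<bar>D (0, 1, 0)\<bar> * g" "0 \<le> \<bar>D (0, 0, E l)\<bar> * g\<^sup>2" for i l
    using g by auto
  have X: "\<bar>D (E i, 0, - Gam x (E i) w)\<bar> \<le> C\<psi> * (m ^ 3 * N powr (2 + \<gamma>))" for i
  proof -
    have "\<bar>D (E i, 0, - Gam x (E i) w)\<bar> \<le> C\<psi> * g powr (2 + \<gamma>)" using bnd[of i i] nn(2) nn(3)[of i] by linarith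
    also have "\<dots> \<le> C\<psi> * (m ^ 3 * N powr (2 + \<gamma>))" using gpow[of 2] C\<psi> by (intro mult_left_mono) auto
    finally show ?thesis .
  qed
  have Z: "\<bar>D (0, 1, 0)\<bar> \<le> C\<psi> * (m ^ 3 * N powr (1 + \<gamma>))"
  proof -
    \<comment> \<open>\<open>undefined\<close> serves as an arbitrary index; the two other terms of
      the structure condition are nonnegative.\<close>
    have "\<bar>D (0, 1, 0)\<bar> * g \<le> C\<psi> * g powr (2 + \<gamma>)" using bnd[of undefined undefined] nn(1,3)[of undefined] by linarith
    also have "\<dots> = C\<psi> * g powr (1 + \<gamma>) * g" using g powr_add[of g "1 + \<gamma>" 1] by simp
    finally have "\<bar>D (0, 1, 0)\<bar> \<le> C\<psi> * g powr (1 + \<gamma>)" using g by simp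
    also have "\<dots> \<le> C\<psi> * (m ^ 3 * N powr (1 + \<gamma>))" using gpow[of 1] C\<psi> by (intro mult_left_mono) auto
    finally show ?thesis .
  qed
  have Y: "\<bar>D (0, 0, E l)\<bar> \<le> C\<psi> * (m ^ 3 * N powr \<gamma>)" for l
  proof -
    have "\<bar>D (0, 0, E l)\<bar> * g\<^sup>2 \<le> C\<psi> * g powr (2 + \<gamma>)" using bnd[of l l] nn(1)[of l] nn(2) by linarith
    also have "\<dots> = C\<psi> * g powr \<gamma> * g\<^sup>2" using g powr_add[of g \<gamma> 2] by (simp add: add.commute)
    finally have "\<bar>D (0, 0, E l)\<bar> \<le> C\<psi> * g powr \<gamma>" using g by simp
    also have "\<dots> \<le> C\<psi> * (m ^ 3 * N powr \<gamma>)" using gpow[of 0] C\<psi> by (intro mult_left_mono) auto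
    finally show ?thesis .
  qed
  \<comment> \<open>The velocity of the fibre variable splits into the parallel part
    \<open>- Gam x p w\<close>, which belongs to the derivative in x, and this vertical
    remainder.\<close>
  define d where "d = Q' x p p + Q x a + Gam x p w"
  have GE: "\<bar>G x (E i) v\<bar> \<le> B * s * norm v" for i v
  proof -
    have "\<bar>G x (E i) v\<bar> \<le> B * norm (E i) * norm v" by (rule GB[OF x])
    also have "\<dots> \<le> B * s * norm v"
      using norm_frame[OF x E] B by (intro mult_right_mono mult_left_mono) (auto simp: s_def)
    finally show ?thesis .
  qed
  have GamE: "Gam x p w = (\<Sum>i\<in>UNIV. G x (E i) p *\<^sub>R Gam x (E i) w)"
  proof -
    have l: "linear (\<lambda>v. Gam x v w)" using Gam[OF x] by (simp add: bilinear_def)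
    have "Gam x p w = Gam x (\<Sum>i\<in>UNIV. G x (E i) p *\<^sub>R E i) w"
      using orthonormal_expansion[OF G[OF x] E, of p] by simp
    also have "\<dots> = (\<Sum>i\<in>UNIV. Gam x (G x (E i) p *\<^sub>R E i) w)" by (rule linear_sum[OF l])
    finally show ?thesis by (simp add: linear_cmul[OF l])
  qed
  have dec: "(p, N\<^sup>2, Q' x p p + Q x a) = (\<Sum>i\<in>UNIV. G x (E i) p *\<^sub>R (E i, 0, - Gam x (E i) w))
      + N\<^sup>2 *\<^sub>R (0, 1, 0) + (\<Sum>l\<in>UNIV. G x (E l) d *\<^sub>R (0, 0, E l))"
  proof -
    have "(\<Sum>i\<in>UNIV. G x (E i) p *\<^sub>R (E i, 0::real, - Gam x (E i) w)) = (p, 0, - Gam x p w)"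
    proof -
      have "(\<Sum>i\<in>UNIV. G x (E i) p *\<^sub>R (E i, 0::real, - Gam x (E i) w))
          = (\<Sum>i\<in>UNIV. G x (E i) p *\<^sub>R E i, 0, - (\<Sum>i\<in>UNIV. G x (E i) p *\<^sub>R Gam x (E i) w))"
        by (simp add: prod_eq_iff fst_sum snd_sum sum_negf)
      then show ?thesis using orthonormal_expansion[OF G[OF x] E, of p] GamE by simp
    qed
    moreover have "(\<Sum>l\<in>UNIV. G x (E l) d *\<^sub>R (0::real^'n, 0::real, E l)) = (0, 0, d)"
    proof -
      have "(\<Sum>l\<in>UNIV. G x (E l) d *\<^sub>R (0::real^'n, 0::real, E l)) = (0, 0, \<Sum>l\<in>UNIV. G x (E l) d *\<^sub>R E l)"
        by (simp add: prod_eq_iff fst_sum snd_sum)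
      then show ?thesis using orthonormal_expansion[OF G[OF x] E, of d] by simp
    qed
    ultimately show ?thesis by (simp add: d_def)
  qed
  have Deq: "D (p, N\<^sup>2, Q' x p p + Q x a) = (\<Sum>i\<in>UNIV. G x (E i) p * D (E i, 0, - Gam x (E i) w))
      + N\<^sup>2 * D (0, 1, 0) + (\<Sum>l\<in>UNIV. G x (E l) d * D (0, 0, E l))"
    unfolding dec by (simp only: linear_add[OF D] linear_sum[OF D] linear_cmul[OF D] real_scaleR_def)
  define M where "M = C\<psi> * m ^ 3"
  have M: "0 \<le> M" using C\<psi> m by (simp add: M_def)
  let ?n = "real CARD('n)"
  have T1: "\<bar>\<Sum>i\<in>UNIV. G x (E i) p * D (E i, 0, - Gam x (E i) w)\<bar> \<le> ?n * (B * s * N * (M * N powr (2 + \<gamma>)))"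
  proof -
    have "\<bar>\<Sum>i\<in>UNIV. G x (E i) p * D (E i, 0, - Gam x (E i) w)\<bar>
        \<le> (\<Sum>i\<in>(UNIV :: 'n set). B * s * N * (M * N powr (2 + \<gamma>)))"
      by (intro order_trans[OF sum_abs] sum_mono, unfold abs_mult, intro mult_mono)
        (use GE[of _ p] X M B s N in \<open>auto simp: M_def N_def mult.assoc\<close>)
    then show ?thesis by simp
  qed
  have T2: "\<bar>N\<^sup>2 * D (0, 1, 0)\<bar> \<le> N\<^sup>2 * (M * N powr (1 + \<gamma>))"
    using mult_left_mono[OF Z, of "N\<^sup>2"] by (simp add: abs_mult M_def mult.assoc)
  have T3: "\<bar>\<Sum>l\<in>UNIV. G x (E l) d * D (0, 0, E l)\<bar> \<le> ?n * (B * s * norm d * (M * N powr \<gamma>))"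
  proof -
    have "\<bar>\<Sum>l\<in>UNIV. G x (E l) d * D (0, 0, E l)\<bar> \<le> (\<Sum>l\<in>(UNIV :: 'n set). B * s * norm d * (M * N powr \<gamma>))"
      by (intro order_trans[OF sum_abs] sum_mono, unfold abs_mult, intro mult_mono)
        (use GE[of _ d] Y M B s N in \<open>auto simp: M_def mult.assoc\<close>)
    then show ?thesis by simp
  qed
  have nd: "norm d \<le> N\<^sup>2 * (N + r) * (B + 3 / c + B / c)"
  proof -
    have "norm d \<le> norm (Q' x p p) + norm (Q x a) + norm (Gam x p w)"
      unfolding d_def by (meson add_mono norm_triangle_ineq order_refl order_trans)
    also have "\<dots> \<le> B * N\<^sup>2 + (N\<^sup>2 / 2 * (N + 4 * r)) / c + B * N * (N / c)"
    proof (intro add_mono)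
      show "norm (Q' x p p) \<le> B * N\<^sup>2" using Q'B[OF x, of p p] by (simp add: N_def power2_eq_square mult.assoc)
      show "norm (Q x a) \<le> (N\<^sup>2 / 2 * (N + 4 * r)) / c"
        using norm_Q[OF x, of a] divide_right_mono[OF a, of c] c by (simp add: N_def)
      have "norm (Gam x p w) \<le> B * N * norm w" unfolding N_def by (rule GamB[OF x])
      also have "\<dots> \<le> B * N * (N / c)"
        using norm_Q[OF x, of p] B N by (intro mult_left_mono) (auto simp: w_def N_def)
      finally show "norm (Gam x p w) \<le> B * N * (N / c)" .
    qed
    also have "\<dots> = N\<^sup>2 * (B + (N / 2 + 2 * r) / c + B / c)"
      by (simp add: power2_eq_square algebra_simps add_divide_distrib)
    also have "\<dots> \<le> N\<^sup>2 * ((N + r) * (B + 3 / c + B / c))"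
    proof (rule mult_left_mono)
      have "1 * B \<le> (N + r) * B" "1 * (B / c) \<le> (N + r) * (B / c)"
        using N r B c by (intro mult_right_mono; simp)+
      moreover have "(N / 2 + 2 * r) / c \<le> (N + r) * (3 / c)"
        using N r c by (simp add: divide_right_mono)
      ultimately show "B + (N / 2 + 2 * r) / c + B / c \<le> (N + r) * (B + 3 / c + B / c)"
        unfolding distrib_left by linarith
    qed simp
    finally show ?thesis by (simp add: mult.assoc)
  qed
  define W where "W = N powr (3 + \<gamma>) + N powr (2 + \<gamma>) * r"
  have pw: "N powr (3 + \<gamma>) = N * N powr (2 + \<gamma>)" "N powr (3 + \<gamma>) = N\<^sup>2 * N powr (1 + \<gamma>)"
    "N powr (2 + \<gamma>) = N\<^sup>2 * N powr \<gamma>"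
    using N powr_add[of N 1 "2 + \<gamma>"] powr_add[of N 2 "1 + \<gamma>"] powr_add[of N 2 \<gamma>] by auto
  have W: "N powr (3 + \<gamma>) \<le> W" "N\<^sup>2 * (N + r) * N powr \<gamma> = W"
    using r pw(1) pw(3) by (auto simp: W_def algebra_simps)
  have "\<bar>D (p, N\<^sup>2, Q' x p p + Q x a)\<bar> \<le> ?n * (B * s * N * (M * N powr (2 + \<gamma>)))
      + N\<^sup>2 * (M * N powr (1 + \<gamma>)) + ?n * (B * s * norm d * (M * N powr \<gamma>))"
    unfolding Deq using T1 T2 T3 by linarith
  also have "\<dots> \<le> ?n * (B * s) * M * W + M * W + ?n * (B * s) * (B + 3 / c + B / c) * M * W"
  proof (intro add_mono)
    have "?n * (B * s * N * (M * N powr (2 + \<gamma>))) = ?n * (B * s) * M * N powr (3 + \<gamma>)"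
      unfolding pw(1) by (simp only: mult_ac)
    also have "\<dots> \<le> ?n * (B * s) * M * W" using W M B s by (intro mult_left_mono) auto
    finally show "?n * (B * s * N * (M * N powr (2 + \<gamma>))) \<le> ?n * (B * s) * M * W" .
    have "N\<^sup>2 * (M * N powr (1 + \<gamma>)) = M * N powr (3 + \<gamma>)" unfolding pw(2) by (simp only: mult_ac)
    then show "N\<^sup>2 * (M * N powr (1 + \<gamma>)) \<le> M * W" using mult_left_mono[OF W(1) M] by linarith
    have "?n * (B * s * norm d * (M * N powr \<gamma>)) = ?n * (B * s) * M * N powr \<gamma> * norm d" by (simp only: mult_ac)
    also have "\<dots> \<le> ?n * (B * s) * M * N powr \<gamma> * (N\<^sup>2 * (N + r) * (B + 3 / c + B / c))"
      using nd M B s by (intro mult_left_mono) auto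
    also have "\<dots> = ?n * (B * s) * (B + 3 / c + B / c) * M * (N\<^sup>2 * (N + r) * N powr \<gamma>)" by (simp only: mult_ac)
    finally show "?n * (B * s * norm d * (M * N powr \<gamma>)) \<le> ?n * (B * s) * (B + 3 / c + B / c) * M * W"
      unfolding W(2) .
  qed
  also have "\<dots> = Ch * W" unfolding Ch_def M_def m_def s_def by (simp add: algebra_simps)
  finally show ?thesis unfolding D_def W_def N_def w_def .
qed

text \<open>The exponential of the logarithmic expression whose maximum is studied. In product form
  it is continuous on the closed ball (for u < M) and vanishes on the sphere, which forces a
  positive maximum into the interior.\<close>

definition "test u u1 M R y x = (norm (gradv (u1 x)))\<^sup>2 * (R\<^sup>2 - (norm (x - y))\<^sup>2)\<^sup>2 / sqrt (M - u x)"

text \<open>The one-variable test is applied on the line through \<open>x\<close> in direction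
  \<open>e\<close>. The gradient already costs one derivative of \<open>u\<close>, so the
  second-order test reaches the third derivatives.\<close>

lemma test_function_conditions:
  fixes e :: "real^'n"
  assumes jet: "C3_jet U u u1 u2 u3" and d: "0 < d" "ball x d \<subseteq> U"
    and \<zeta>: "0 < R\<^sup>2 - (norm (x - y))\<^sup>2" and b: "0 < M - u x" and p0: "gradv (u1 x) \<noteq> 0"
    and max: "\<And>x'. x' \<in> ball x d \<Longrightarrow> test u u1 M R y x' \<le> test u u1 M R y x"
  defines "p \<equiv> gradv (u1 x)" and "\<zeta> \<equiv> R\<^sup>2 - (norm (x - y))\<^sup>2" and "\<phi>1 \<equiv> 1 / (2 * (M - u x))"
    and "dz \<equiv> \<lambda>v. - 2 * ((x - y) \<bullet> v)"
  shows "2 * u2 x p e / (norm p)\<^sup>2 + \<phi>1 * (p \<bullet> e) + 2 * dz e / \<zeta> = 0"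
    and "2 * ((norm (gradv (\<lambda>b. u2 x b e)))\<^sup>2 + u3 x p e e) / (norm p)\<^sup>2 - (2 * u2 x p e / (norm p)\<^sup>2)\<^sup>2
        + 2 * \<phi>1\<^sup>2 * (p \<bullet> e)\<^sup>2 + \<phi>1 * u2 x e e + 2 * (- 2 * (norm e)\<^sup>2 / \<zeta> - (dz e)\<^sup>2 / \<zeta>\<^sup>2) \<le> 0"
proof -
  have x: "x \<in> U" using d by auto
  define \<delta> where "\<delta> = d / (norm e + 1)"
  have ne: "0 < norm e + 1" by (simp add: add_nonneg_pos)
  have \<delta>: "0 < \<delta>" using d ne by (simp add: \<delta>_def)
  have near: "x + t *\<^sub>R e \<in> ball x d" if "\<bar>t\<bar> < \<delta>" for t
  proof -
    have "\<bar>t\<bar> * (norm e + 1) < d" using that ne by (simp add: \<delta>_def field_simps)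
    moreover have "\<bar>t\<bar> * norm e \<le> \<bar>t\<bar> * (norm e + 1)" by (intro mult_left_mono) auto
    ultimately show ?thesis by (simp add: dist_norm)
  qed
  then have inU: "x + t *\<^sub>R e \<in> U" if "\<bar>t\<bar> < \<delta>" for t using that d(2) by blast
  define P where "P t = gradv (u1 (x + t *\<^sub>R e))" for t
  define A where "A t = gradv (\<lambda>b. u2 (x + t *\<^sub>R e) b e)" for t
  define A3 where "A3 = gradv (\<lambda>b. u3 x b e e)"
  have P: "(P has_vector_derivative A t) (at t)" if "\<bar>t\<bar> < \<delta>" for t
    unfolding P_def A_def by (rule line_has_vector_derivative[OF C3_jetD(12)[OF jet inU[OF that]]])
  have A: "(A has_vector_derivative A3) (at 0)"
    unfolding A_def A3_def
    by (rule line_has_vector_derivative[where k = "\<lambda>y. gradv (\<lambda>b. u2 y b e)" and k' = "\<lambda>v. gradv (\<lambda>b. u3 x b e v)"])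
      (use C3_jetD(13)[OF jet x, of e] in simp)
  have inner: "((\<lambda>t. f t \<bullet> g t) has_real_derivative f t \<bullet> g' + f' \<bullet> g t) (at t)"
    if "(f has_vector_derivative f') (at t)" "(g has_vector_derivative g') (at t)"
    for f g :: "real \<Rightarrow> real^'n" and f' g' t
    unfolding has_real_derivative_iff_has_vector_derivative
    by (rule bounded_bilinear.has_vector_derivative[OF bounded_bilinear_inner that])
  have a1: "((\<lambda>t. P t \<bullet> P t) has_real_derivative 2 * (P t \<bullet> A t)) (at t)" if "\<bar>t\<bar> < \<delta>" for t
    using inner[OF P[OF that] P[OF that]] by (simp add: inner_commute)
  have a2: "((\<lambda>t. 2 * (P t \<bullet> A t)) has_real_derivative 2 * (A 0 \<bullet> A 0 + P 0 \<bullet> A3)) (at 0)"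
    using DERIV_cmult[OF inner[OF P A], of 2] \<delta> by (simp add: add.commute)
  have b1: "((\<lambda>t. M - u (x + t *\<^sub>R e)) has_real_derivative - u1 (x + t *\<^sub>R e) e) (at t)" if "\<bar>t\<bar> < \<delta>" for t
    using line_has_vector_derivative[OF C3_jetD(1)[OF jet inU[OF that]]]
    by (auto intro!: derivative_eq_intros simp: has_real_derivative_iff_has_vector_derivative)
  have b2: "((\<lambda>t. - u1 (x + t *\<^sub>R e) e) has_real_derivative - u2 x e e) (at 0)"
    using line_has_vector_derivative[of "\<lambda>y. u1 y e" "u2 x e" x 0 e] C3_jetD(2)[OF jet x]
    by (auto intro!: derivative_eq_intros simp: has_real_derivative_iff_has_vector_derivative)
  have l: "((\<lambda>t. x + t *\<^sub>R e - y) has_vector_derivative e) (at t)" for t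
    by (auto intro!: derivative_eq_intros simp: has_vector_derivative_def)
  have z1: "((\<lambda>t. R\<^sup>2 - (x + t *\<^sub>R e - y) \<bullet> (x + t *\<^sub>R e - y)) has_real_derivative - 2 * ((x + t *\<^sub>R e - y) \<bullet> e)) (at t)"
    if "\<bar>t\<bar> < \<delta>" for t
    using DERIV_diff[OF DERIV_const[of "R\<^sup>2"] inner[OF l l]] by (simp add: inner_commute)
  have z2: "((\<lambda>t. - 2 * ((x + t *\<^sub>R e - y) \<bullet> e)) has_real_derivative - 2 * (e \<bullet> e)) (at 0)"
    using DERIV_cmult[OF inner[OF l[of 0] has_vector_derivative_const[of e "at 0"]], of "- 2"] by simp
  have p: "P 0 = p" by (simp add: P_def p_def)
  have pA: "p \<bullet> A 0 = u2 x p e" using C3_jetD(10)[OF jet x, of e p] by (simp add: A_def inner_commute)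
  have pA3: "p \<bullet> A3 = u3 x p e e" using C3_jetD(11)[OF jet x, of e e p] by (simp add: A3_def inner_commute)
  have pe: "u1 x e = p \<bullet> e" using C3_jetD(9)[OF jet x, of e] by (simp add: p_def)
  have mx: "P t \<bullet> P t * (R\<^sup>2 - (x + t *\<^sub>R e - y) \<bullet> (x + t *\<^sub>R e - y))\<^sup>2 / sqrt (M - u (x + t *\<^sub>R e))
      \<le> P 0 \<bullet> P 0 * (R\<^sup>2 - (x + 0 *\<^sub>R e - y) \<bullet> (x + 0 *\<^sub>R e - y))\<^sup>2 / sqrt (M - u (x + 0 *\<^sub>R e))"
    if "\<bar>t\<bar> < \<delta>" for t
    using max[OF near[OF that]] by (simp add: test_def P_def power2_norm_eq_inner)
  have pos: "0 < P 0 \<bullet> P 0" "0 < M - u (x + 0 *\<^sub>R e)" "0 < R\<^sup>2 - (x + 0 *\<^sub>R e - y) \<bullet> (x + 0 *\<^sub>R e - y)"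
    using p0 b \<zeta> by (auto simp: P_def power2_norm_eq_inner)
  note conds = log_test_function[OF \<delta> a1 a2 b1 b2 z1 z2 pos mx]
  have n: "p \<bullet> p = (norm p)\<^sup>2" "R\<^sup>2 - (x - y) \<bullet> (x - y) = \<zeta>" "A 0 \<bullet> A 0 = (norm (A 0))\<^sup>2" "e \<bullet> e = (norm e)\<^sup>2"
    by (simp_all add: \<zeta>_def power2_norm_eq_inner)
  have "1 / z = 2 * (1 / (2 * z))" for z :: real by simp
  then have b': "1 / (M - u x) = 2 * \<phi>1" unfolding \<phi>1_def .
  have div: "w / (M - u x) = w * (2 * \<phi>1)" for w unfolding b'[symmetric] by simp
  show "2 * u2 x p e / (norm p)\<^sup>2 + \<phi>1 * (p \<bullet> e) + 2 * dz e / \<zeta> = 0"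
    using conds(1) by (simp add: p pA n pe div dz_def mult.commute)
  have "2 * ((norm (A 0))\<^sup>2 + u3 x p e e) / (norm p)\<^sup>2 - (2 * u2 x p e / (norm p)\<^sup>2)\<^sup>2
      - ((- u2 x e e) * (2 * \<phi>1) - ((- (p \<bullet> e)) * (2 * \<phi>1))\<^sup>2) / 2 + 2 * (- 2 * (norm e)\<^sup>2 / \<zeta> - (dz e / \<zeta>)\<^sup>2) \<le> 0"
    using conds(2) unfolding p pA n pe div pA3 dz_def by (simp add: n div p pA pe pA3)
  moreover have "((- u2 x e e) * (2 * \<phi>1) - ((- (p \<bullet> e)) * (2 * \<phi>1))\<^sup>2) / 2 = - (2 * \<phi>1\<^sup>2 * (p \<bullet> e)\<^sup>2 + \<phi>1 * u2 x e e)"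
    by (simp add: power2_eq_square field_simps)
  moreover have A0: "A 0 = gradv (\<lambda>b. u2 x b e)" by (simp add: A_def)
  ultimately show "2 * ((norm (gradv (\<lambda>b. u2 x b e)))\<^sup>2 + u3 x p e e) / (norm p)\<^sup>2 - (2 * u2 x p e / (norm p)\<^sup>2)\<^sup>2
        + 2 * \<phi>1\<^sup>2 * (p \<bullet> e)\<^sup>2 + \<phi>1 * u2 x e e + 2 * (- 2 * (norm e)\<^sup>2 / \<zeta> - (dz e)\<^sup>2 / \<zeta>\<^sup>2) \<le> 0"
    unfolding A0[symmetric] power_divide[of "dz e" \<zeta>] by linarith
qed

text \<open>The equation is differentiated in the direction \<open>p\<close> itself, along a
  coordinate line; this produces exactly the contraction of \<open>u3\<close> with \<open>p\<close>
  that occurs in the second-order condition. The term with \<open>G'\<close> appears because the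
  eigenvalues are relative to a metric that varies along the line.\<close>

lemma linearized_equation:
  fixes E :: "'n \<Rightarrow> real^'n"
  assumes jet: "C3_jet U u u1 u2 u3" and sol: "solves u u1 u2" and x: "x \<in> U"
    and E: "orthonormal_wrt (G x) E" and ev: "\<And>i v. hess u1 u2 x (E i) v = lam $ i * G x (E i) v"
    and lam: "lam \<in> \<Gamma>" and eq: "f lam = Psi (x, u x, Q x (gradv (u1 x)))"
  defines "p \<equiv> gradv (u1 x)" and "F \<equiv> \<lambda>i. partial_deriv \<Gamma> i f lam"
  shows "(\<Sum>i\<in>UNIV. F i * (u3 x p (E i) (E i) - p \<bullet> Gam' x p (E i) (E i) - u2 x p (Gam x (E i) (E i))
      - lam $ i * G' x p (E i) (E i)))
    = Psi' (x, u x, Q x p) (p, (norm p)\<^sup>2, Q' x p p + Q x (gradv (\<lambda>b. u2 x b p)))"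
proof -
  define X where "X t = x + t *\<^sub>R p" for t
  have X0: "X 0 = x" by (simp add: X_def)
  \<comment> \<open>Bounds the Hessian form at \<open>X t\<close> and thereby its eigenvalues;
    continuity at 0 makes the bound uniform for small \<open>t\<close>, as
    \<open>pencil_derivative\<close> demands.\<close>
  define m where "m t = (\<Sum>a\<in>Basis. \<Sum>b\<in>Basis. \<bar>hess u1 u2 (X t) a b\<bar>)" for t
  have hd: "((\<lambda>t. hess u1 u2 (X t) v w) has_real_derivative
      u3 x v w p - (u2 x p (Gam x v w) + p \<bullet> Gam' x p v w)) (at 0)" for v w
  proof -
    have 1: "((\<lambda>t. u2 (X t) v w) has_vector_derivative u3 x v w p) (at 0)"
      unfolding X_def using line_has_vector_derivative[of "\<lambda>y. u2 y v w" "u3 x v w" x 0 p] C3_jetD(3)[OF jet x] by simp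
    have 2: "((\<lambda>t. gradv (u1 (X t))) has_vector_derivative gradv (\<lambda>b. u2 x b p)) (at 0)"
      unfolding X_def
      using line_has_vector_derivative[of "\<lambda>y. gradv (u1 y)" "\<lambda>e. gradv (\<lambda>b. u2 x b e)" x 0 p] C3_jetD(12)[OF jet x] by simp
    have 3: "((\<lambda>t. Gam (X t) v w) has_vector_derivative Gam' x p v w) (at 0)"
      unfolding X_def using line_has_vector_derivative[of "\<lambda>y. Gam y v w" "\<lambda>e. Gam' x e v w" x 0 p] Gam'[OF x] by simp
    have "((\<lambda>t. u2 (X t) v w - gradv (u1 (X t)) \<bullet> Gam (X t) v w) has_vector_derivative
        u3 x v w p - (gradv (u1 (X 0)) \<bullet> Gam' x p v w + gradv (\<lambda>b. u2 x b p) \<bullet> Gam (X 0) v w)) (at 0)"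
      by (intro has_vector_derivative_diff 1 bounded_bilinear.has_vector_derivative[OF bounded_bilinear_inner 2 3])
    then have D: "((\<lambda>t. u2 (X t) v w - gradv (u1 (X t)) \<bullet> Gam (X t) v w) has_real_derivative
        u3 x v w p - (u2 x p (Gam x v w) + p \<bullet> Gam' x p v w)) (at 0)"
      using C3_jetD(10)[OF jet x] C3_jetD(5)[OF jet x]
      by (simp add: has_real_derivative_iff_has_vector_derivative X0 p_def add.commute)
    have "open (X -` U)" unfolding X_def using U by (intro open_vimage) (auto intro!: continuous_intros)
    moreover have "0 \<in> X -` U" using x X0 by simp
    ultimately show ?thesis
      by (rule has_field_derivative_transform_within_open[OF D])
        (use C3_jetD(9)[OF jet] in \<open>auto simp: hess_def\<close>)
  qed
  have "open (X -` U)" unfolding X_def using U by (intro open_vimage) (auto intro!: continuous_intros)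
  moreover have "0 \<in> X -` U" using x X0 by simp
  ultimately have evU: "\<forall>\<^sub>F t in nhds 0. X t \<in> U"
    unfolding eventually_nhds by blast
  have "isCont m 0" unfolding m_def by (intro continuous_intros DERIV_isCont[OF hd])
  then have "(m \<longlongrightarrow> m 0) (nhds 0)" by (simp add: isCont_def tendsto_at_iff_tendsto_nhds)
  then have "\<forall>\<^sub>F t in nhds 0. m t < m 0 + 1" by (rule order_tendstoD) simp
  with evU have "\<forall>\<^sub>F t in nhds 0. X t \<in> U \<and> m t < m 0 + 1" by eventually_elim simp
  then obtain \<delta> where \<delta>: "0 < \<delta>" "\<And>t. \<bar>t\<bar> < \<delta> \<Longrightarrow> X t \<in> U \<and> m t < m 0 + 1"
    unfolding eventually_nhds_metric by (auto simp: dist_real_def)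
  have blH: "bilinear (hess u1 u2 y)" if "y \<in> U" for y
  proof -
    have l1: "linear (u1 y)" by (rule C3_jetD(8)[OF jet that])
    have "linear (\<lambda>v. u1 y (Gam y v w))" "linear (\<lambda>w. u1 y (Gam y v w))" for v w
      using linear_compose[OF _ l1] Gam[OF that] by (auto simp: bilinear_def o_def)
    then show ?thesis
      using C3_jetD(4)[OF jet that] unfolding bilinear_def hess_def by (auto intro: linear_compose_sub)
  qed
  have main: "(\<Sum>i\<in>UNIV. F i * ((u3 x (E i) (E i) p - (u2 x p (Gam x (E i) (E i)) + p \<bullet> Gam' x p (E i) (E i)))
      - lam $ i * G' x p (E i) (E i))) = Psi' (x, u x, Q x p) (p, (norm p)\<^sup>2, Q' x p p + Q x (gradv (\<lambda>b. u2 x b p)))"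
  proof (rule pencil_derivative[where G = "\<lambda>t. G (X t)" and H = "\<lambda>t. hess u1 u2 (X t)"
      and Q = "(m 0 + 1) * (1 / c)" and h = "\<lambda>t. Psi (X t, u (X t), Q (X t) (gradv (u1 (X t))))"
      and G' = "G' x p" and H' = "\<lambda>v w. u3 x v w p - (u2 x p (Gam x v w) + p \<bullet> Gam' x p v w)", OF \<delta>(1)])
    fix t :: real assume t: "\<bar>t\<bar> < \<delta>"
    then have Xt: "X t \<in> U" "m t < m 0 + 1" using \<delta>(2) by auto
    show "bilinear (hess u1 u2 (X t))" by (rule blH[OF Xt(1)])
    show "spd_form (G (X t))" by (rule G[OF Xt(1)])
    obtain \<epsilon> mu where \<epsilon>: "orthonormal_wrt (G (X t)) \<epsilon>"
      and H\<epsilon>: "\<And>j v. hess u1 u2 (X t) (\<epsilon> j) v = mu $ j * G (X t) (\<epsilon> j) v"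
      and mu: "mu \<in> \<Gamma>" "f mu = Psi (X t, u (X t), Q (X t) (gradv (u1 (X t))))"
      using sol Xt(1) unfolding solves_def by blast
    have "\<bar>mu $ j\<bar> \<le> (m 0 + 1) * (1 / c)" for j
    proof -
      have "mu $ j = hess u1 u2 (X t) (\<epsilon> j) (\<epsilon> j)" using H\<epsilon> \<epsilon> by (simp add: orthonormal_wrt_def)
      also have "\<bar>\<dots>\<bar> \<le> m t * norm (\<epsilon> j) * norm (\<epsilon> j)"
        unfolding m_def by (rule bilinear_basis_bound[OF blH[OF Xt(1)]])
      also have "\<dots> = m t * (norm (\<epsilon> j))\<^sup>2" by (simp add: power2_eq_square)
      also have "\<dots> \<le> (m 0 + 1) * (1 / c)"
      proof (rule mult_mono)
        have "(norm (\<epsilon> j))\<^sup>2 \<le> (sqrt (1 / c))\<^sup>2" using norm_frame[OF Xt(1) \<epsilon>] by (intro power_mono) auto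
        then show "(norm (\<epsilon> j))\<^sup>2 \<le> 1 / c" using c by simp
        have "0 \<le> m t" by (auto simp: m_def intro!: sum_nonneg)
        then show "0 \<le> m 0 + 1" using Xt(2) by simp
      qed (use Xt(2) in auto)
      finally show ?thesis .
    qed
    moreover have "Psi (X t, u (X t), Q (X t) (gradv (u1 (X t)))) \<le> (\<Sum>i\<in>UNIV. F i * mu $ \<sigma> i)"
      if "\<sigma> permutes UNIV" for \<sigma>
      using concave_operator_le(2)[OF \<Gamma> f lam mu(1) that] by (simp add: mu(2) F_def)
    ultimately show "\<exists>e mu. orthonormal_wrt (G (X t)) e \<and> (\<forall>j v. hess u1 u2 (X t) (e j) v = mu j * G (X t) (e j) v)
         \<and> (\<forall>j. \<bar>mu j\<bar> \<le> (m 0 + 1) * (1 / c)) \<and> (\<forall>\<sigma>. \<sigma> permutes UNIV \<longrightarrow>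
           Psi (X t, u (X t), Q (X t) (gradv (u1 (X t)))) \<le> (\<Sum>i\<in>UNIV. F i * mu (\<sigma> i)))"
      using \<epsilon> H\<epsilon> by (intro exI[of _ \<epsilon>] exI[of _ "($) mu"]) auto
  next
    show "hess u1 u2 (X 0) v w = hess u1 u2 (X 0) w v" for v w
      using C3_jetD(5)[OF jet x] Gams[OF x] by (simp add: hess_def X0)
    show "orthonormal_wrt (G (X 0)) E" using E by (simp add: X0)
    show "hess u1 u2 (X 0) (E i) v = lam $ i * G (X 0) (E i) v" for i v using ev by (simp add: X0)
    show "Psi (X 0, u (X 0), Q (X 0) (gradv (u1 (X 0)))) = (\<Sum>i\<in>UNIV. F i * lam $ i)"
      using concave_operator_le(1)[OF \<Gamma> f lam] eq by (simp add: X0 F_def)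
    show "((\<lambda>t. G (X t) v w) has_real_derivative G' x p v w) (at 0)" for v w
      unfolding X_def has_real_derivative_iff_has_vector_derivative
      using line_has_vector_derivative[of "\<lambda>y. G y v w" "\<lambda>e. G' x e v w" x 0 p] G'[OF x] by simp
    show "((\<lambda>t. hess u1 u2 (X t) v w) has_real_derivative u3 x v w p - (u2 x p (Gam x v w) + p \<bullet> Gam' x p v w)) (at 0)" for v w
      by (rule hd)
    show "((\<lambda>t. Psi (X t, u (X t), Q (X t) (gradv (u1 (X t))))) has_real_derivative
        Psi' (x, u x, Q x p) (p, (norm p)\<^sup>2, Q' x p p + Q x (gradv (\<lambda>b. u2 x b p)))) (at 0)"
    proof -
      have Qd: "((\<lambda>y. Q y (gradv (u1 y))) has_derivative (\<lambda>e. Q' x e p + Q x (gradv (\<lambda>b. u2 x b e)))) (at x)"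
      proof -
        \<comment> \<open>\<open>Q y p\<close> is known to be differentiable in \<open>y\<close> for
          fixed \<open>p\<close>, so the varying gradient is expanded in the basis before the
          product rule is applied.\<close>
        have D: "((\<lambda>y. \<Sum>b\<in>Basis. u1 y b *\<^sub>R Q y b) has_derivative
            (\<lambda>e. \<Sum>b\<in>Basis. u1 x b *\<^sub>R Q' x e b + u2 x b e *\<^sub>R Q x b)) (at x)"
          by (intro has_derivative_sum has_derivative_scaleR C3_jetD(2)[OF jet x] Q'[OF x])
        have eq1: "(\<Sum>b\<in>Basis. u1 x b *\<^sub>R Q' x e b + u2 x b e *\<^sub>R Q x b)
            = Q' x e p + Q x (gradv (\<lambda>b. u2 x b e))" for e
          unfolding p_def gradv_def
          by (simp only: linear_sum[OF Q'l[OF x]] linear_cmul[OF Q'l[OF x]] linear_sum[OF Q[OF x]]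
              linear_cmul[OF Q[OF x]] sum.distrib)
        have eq2: "(\<Sum>b\<in>Basis. u1 y b *\<^sub>R Q y b) = Q y (gradv (u1 y))" if "y \<in> U" for y
          unfolding gradv_def by (simp only: linear_sum[OF Q[OF that]] linear_cmul[OF Q[OF that]])
        show ?thesis
          by (rule has_derivative_transform_within_open[OF D[unfolded eq1] U x eq2])
      qed
      have "((\<lambda>y. (y, u y, Q y (gradv (u1 y)))) has_derivative
          (\<lambda>e. (e, u1 x e, Q' x e p + Q x (gradv (\<lambda>b. u2 x b e))))) (at x)"
        by (intro has_derivative_Pair has_derivative_ident C3_jetD(1)[OF jet x] Qd)
      then have "((\<lambda>y. Psi (y, u y, Q y (gradv (u1 y)))) has_derivative
          (\<lambda>e. Psi' (x, u x, Q x p) (e, u1 x e, Q' x e p + Q x (gradv (\<lambda>b. u2 x b e))))) (at x)"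
        using has_derivative_compose[of _ _ x UNIV Psi] Psi'[OF x, of "u x" "Q x p"] by (simp add: p_def)
      from line_has_vector_derivative[of _ _ x 0 p, simplified, OF this]
      have "((\<lambda>t. Psi (X t, u (X t), Q (X t) (gradv (u1 (X t))))) has_vector_derivative
          Psi' (x, u x, Q x p) (p, u1 x p, Q' x p p + Q x (gradv (\<lambda>b. u2 x b p)))) (at 0)"
        by (simp add: X_def)
      moreover have "u1 x p = (norm p)\<^sup>2"
        using C3_jetD(9)[OF jet x, of p] by (simp add: p_def power2_norm_eq_inner)
      ultimately show ?thesis by (simp add: has_real_derivative_iff_has_vector_derivative)
    qed
  qed
  have "u3 x (E i) (E i) p = u3 x p (E i) (E i)" for i
    using C3_jetD(7)[OF jet x, of "E i" "E i" p] C3_jetD(6)[OF jet x, of "E i" p "E i"] by simp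
  then have "(u3 x (E i) (E i) p - (u2 x p (Gam x (E i) (E i)) + p \<bullet> Gam' x p (E i) (E i))) - lam $ i * G' x p (E i) (E i)
      = u3 x p (E i) (E i) - p \<bullet> Gam' x p (E i) (E i) - u2 x p (Gam x (E i) (E i)) - lam $ i * G' x p (E i) (E i)" for i
    by simp
  then show ?thesis using main by (simp only:)
qed

end


text \<open>The power has a negative exponent, so all four demands hold once \<open>C\<close> is
  large; none of them involves the solution.\<close>

lemma large_constant_exists:
  fixes a1 a2 a3 b1 b2 b3 s :: real
  assumes "0 < b1" "0 < b2" "0 < b3" "0 \<le> a3" "s < 0"
  obtains C where "1 \<le> C" "a1 \<le> b1 * C" "a2 < b2 * C" "a3 * C powr s < b3"
proof -
  have "((\<lambda>C. C powr s) \<longlongrightarrow> 0) at_top" using assms(5) by (rule tendsto_neg_powr) (rule filterlim_ident)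
  then have "\<forall>\<^sub>F C in at_top. C powr s < b3 / (a3 + 1)" by (rule order_tendstoD) (use assms in auto)
  moreover have "\<forall>\<^sub>F C in at_top. max 1 (max (a1 / b1) (a2 / b2 + 1)) \<le> C" by (rule eventually_ge_at_top)
  ultimately have "\<forall>\<^sub>F C in at_top. C powr s < b3 / (a3 + 1) \<and> max 1 (max (a1 / b1) (a2 / b2 + 1)) \<le> C"
    by (rule eventually_conj)
  then obtain C :: real where C: "C powr s < b3 / (a3 + 1)" "max 1 (max (a1 / b1) (a2 / b2 + 1)) \<le> C"
    using eventually_happens'[OF trivial_limit_at_top_linorder] by blast
  have "(a3 + 1) * C powr s < b3" using C(1) assms(4) by (simp add: field_simps)
  moreover have "a3 * C powr s \<le> (a3 + 1) * C powr s" by (intro mult_right_mono) auto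
  ultimately have 3: "a3 * C powr s < b3" by linarith
  have "a1 / b1 \<le> C" "a2 / b2 < C" using C(2) by auto
  then have "a1 \<le> b1 * C" "a2 < b2 * C" using assms by (auto simp: field_simps)
  then show thesis using that 3 C(2) by auto
qed

context local_equation
begin

lemma max_point_bound:
  assumes jet: "C3_jet U u u1 u2 u3" and sol: "solves u u1 u2" and d: "0 < d" "ball x d \<subseteq> U"
    and R: "0 < R" "R \<le> 1" and xy: "norm (x - y) < R" and b: "1 \<le> M - u x" "M - u x \<le> L"
    and p0: "gradv (u1 x) \<noteq> 0"
    and max: "\<And>x'. x' \<in> ball x d \<Longrightarrow> test u u1 M R y x' \<le> test u u1 M R y x"
    and C: "1 \<le> C" "2 * sqrt (1 / c) * (2 + B) \<le> 1 / (2 * L) * (sqrt c / (CARD('n) * B)) * C"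
      "4 * gradient_max_point.K1 c B < (1 / (2 * L))\<^sup>2 / 2 * (c / (CARD('n) * B)\<^sup>2) * \<nu>0 * C"
      "4 * Ch * C powr (\<gamma> - 1) < (1 / (2 * L))\<^sup>2 / 2 * (c / (CARD('n) * B)\<^sup>2) * \<nu>0"
  shows "norm (gradv (u1 x)) \<le> C * (1 + R / (R\<^sup>2 - (norm (x - y))\<^sup>2))"
proof -
  have x: "x \<in> U" using d by auto
  define p where "p = gradv (u1 x)"
  define \<zeta> where "\<zeta> = R\<^sup>2 - (norm (x - y))\<^sup>2"
  define \<phi>1 where "\<phi>1 = 1 / (2 * (M - u x))"
  define dz where "dz v = - 2 * ((x - y) \<bullet> v)" for v
  have \<zeta>: "0 < \<zeta>" using xy R by (simp add: \<zeta>_def power_strict_mono)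
  obtain E lam where E: "orthonormal_wrt (G x) E"
    and ev: "\<And>i v. hess u1 u2 x (E i) v = lam $ i * G x (E i) v"
    and lam: "lam \<in> \<Gamma>" and eq: "f lam = Psi (x, u x, Q x (gradv (u1 x)))"
    using sol x unfolding solves_def by blast
  define F where "F i = partial_deriv \<Gamma> i f lam" for i
  define h' where "h' = Psi' (x, u x, Q x p) (p, (norm p)\<^sup>2, Q' x p p + Q x (gradv (\<lambda>b. u2 x b p)))"
  have bpos: "0 < M - u x" using b by simp
  note conds = test_function_conditions[OF jet d \<zeta>[unfolded \<zeta>_def] bpos p0 max, folded p_def \<zeta>_def \<phi>1_def, folded dz_def]
  have \<nu>0: "0 < \<nu>0" and Fpos: "\<And>i. 0 < F i"
    and Fneg: "\<And>i. lam $ i < 0 \<Longrightarrow> \<nu>0 * (1 + (\<Sum>j\<in>UNIV. F j)) \<le> F i" and fpos: "0 < f lam"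
    using f lam unfolding admissible_operator_def F_def by blast+
  interpret gmp: gradient_max_point "G x" E "Gam x" "u2 x" p dz F "\<lambda>i. lam $ i" "\<lambda>i. u3 x p (E i) (E i)"
    "\<lambda>i. (norm (gradv (\<lambda>b. u2 x b (E i))))\<^sup>2" "\<lambda>i. p \<bullet> Gam' x p (E i) (E i)" "\<lambda>i. G' x p (E i) (E i)"
    c B "1 / (2 * L)" \<phi>1 \<zeta> R h' \<nu>0
  proof
    show "0 < 1 / (2 * L)" "1 / (2 * L) \<le> \<phi>1" "\<phi>1 \<le> 1"
      using b by (auto simp: \<phi>1_def frac_le)
    show "\<zeta> \<le> R\<^sup>2" by (simp add: \<zeta>_def)
    show "p \<noteq> 0" using p0 by (simp add: p_def)
    show "\<bar>p \<bullet> Gam' x p (E i) (E i)\<bar> \<le> B * (norm p)\<^sup>2 * (norm (E i))\<^sup>2" for i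
    proof -
      have "\<bar>p \<bullet> Gam' x p (E i) (E i)\<bar> \<le> norm p * norm (Gam' x p (E i) (E i))" by (rule Cauchy_Schwarz_ineq2)
      also have "\<dots> \<le> norm p * (B * norm p * norm (E i) * norm (E i))"
        using Gam'B[OF x] by (intro mult_left_mono) auto
      finally show ?thesis by (simp add: power2_eq_square mult_ac)
    qed
    show "\<bar>G' x p (E i) (E i)\<bar> \<le> B * norm p * (norm (E i))\<^sup>2" for i
      using G'B[OF x, of p "E i" "E i"] by (simp add: power2_eq_square mult_ac)
    show "\<bar>dz v\<bar> \<le> 2 * R * norm v" for v
    proof -
      have "\<bar>(x - y) \<bullet> v\<bar> \<le> norm (x - y) * norm v" by (rule Cauchy_Schwarz_ineq2)
      also have "\<dots> \<le> R * norm v" using xy by (intro mult_right_mono) auto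
      finally show ?thesis by (simp add: dz_def abs_mult)
    qed
    show "0 \<le> (\<Sum>i\<in>UNIV. F i * lam $ i)"
      using concave_operator_le(1)[OF \<Gamma> f lam] fpos by (simp add: F_def)
    show "(u2 x v (E i))\<^sup>2 \<le> (norm v)\<^sup>2 * (norm (gradv (\<lambda>b. u2 x b (E i))))\<^sup>2" for v i
      using Cauchy_Schwarz_ineq[of v "gradv (\<lambda>b. u2 x b (E i))"] C3_jetD(10)[OF jet x, of "E i" v]
      by (simp add: power2_norm_eq_inner inner_commute)
    show "u2 x (E i) v - p \<bullet> Gam x (E i) v = lam $ i * G x (E i) v" for i v
      using ev[of i v] C3_jetD(9)[OF jet x] by (simp add: hess_def p_def)
    show "(\<Sum>i\<in>UNIV. F i * (u3 x p (E i) (E i) - p \<bullet> Gam' x p (E i) (E i) - u2 x p (Gam x (E i) (E i))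
        - lam $ i * G' x p (E i) (E i))) = h'"
      unfolding h'_def F_def p_def by (rule linearized_equation[OF jet sol x E ev lam eq])
    show "2 * u2 x p v / (norm p)\<^sup>2 + \<phi>1 * (p \<bullet> v) + 2 * dz v / \<zeta> = 0" for v by (rule conds(1))
    show "2 * ((norm (gradv (\<lambda>b. u2 x b (E i))))\<^sup>2 + u3 x p (E i) (E i)) / (norm p)\<^sup>2 - (2 * u2 x p (E i) / (norm p)\<^sup>2)\<^sup>2
        + 2 * \<phi>1\<^sup>2 * (p \<bullet> E i)\<^sup>2 + \<phi>1 * u2 x (E i) (E i)
        + 2 * (- 2 * (norm (E i))\<^sup>2 / \<zeta> - (dz (E i))\<^sup>2 / \<zeta>\<^sup>2) \<le> 0" for i by (rule conds(2))
    show "u2 x v w = u2 x w v" for v w by (rule C3_jetD(5)[OF jet x])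
  qed (use c B R \<zeta> \<nu>0 G[OF x] Gc[OF x] GB[OF x] E GamB[OF x] Fpos Fneg in \<open>simp_all\<close>)
  have "norm p \<le> C * (1 + R / \<zeta>)"
  proof (rule gmp.gradient_bound[OF \<gamma>, of Ch])
    show "0 \<le> Ch" using C\<psi> B c unfolding Ch_def
      by (intro mult_nonneg_nonneg add_nonneg_nonneg) auto
    assume p1: "1 \<le> norm p"
    let ?a = "gradv (\<lambda>b. u2 x b p)"
    \<comment> \<open>The first-order condition is tested with \<open>?a\<close> itself: |a|^2 is
      the value of \<open>u2\<close> at \<open>p\<close> and \<open>a\<close>, so after division by
      |a| the bound contains no second derivative.\<close>
    have "norm ?a \<le> (norm p)\<^sup>2 / 2 * (norm p + 4 * (R / \<zeta>))"
    proof -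
      have N: "0 < (norm p)\<^sup>2" using p1 by auto
      have "(norm ?a)\<^sup>2 = u2 x p ?a"
        using C3_jetD(10)[OF jet x, of p ?a] C3_jetD(5)[OF jet x] by (simp add: power2_norm_eq_inner)
      also have "\<dots> = - ((norm p)\<^sup>2 / 2) * (\<phi>1 * (p \<bullet> ?a) + 2 * dz ?a / \<zeta>)"
      proof -
        have "2 * u2 x p ?a / (norm p)\<^sup>2 = - (\<phi>1 * (p \<bullet> ?a) + 2 * dz ?a / \<zeta>)"
          using gmp.first[of ?a] by linarith
        then have "2 * u2 x p ?a = - (\<phi>1 * (p \<bullet> ?a) + 2 * dz ?a / \<zeta>) * (norm p)\<^sup>2"
          using N by (simp only: nonzero_divide_eq_eq)
        moreover have "a = - (n / 2) * s" if "2 * a = - s * n" for a s n :: real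
          using that by (simp add: algebra_simps)
        ultimately show ?thesis by blast
      qed
      also have "\<dots> \<le> (norm p)\<^sup>2 / 2 * ((norm p + 4 * (R / \<zeta>)) * norm ?a)"
      proof -
        have "\<bar>p \<bullet> ?a\<bar> \<le> norm p * norm ?a" by (rule Cauchy_Schwarz_ineq2)
        moreover have "0 \<le> \<phi>1" using bpos by (simp add: \<phi>1_def)
        ultimately have "\<phi>1 * \<bar>p \<bullet> ?a\<bar> \<le> 1 * (norm p * norm ?a)"
          using gmp.c1 by (intro mult_mono) auto
        then have 1: "\<bar>\<phi>1 * (p \<bullet> ?a)\<bar> \<le> norm p * norm ?a" using \<open>0 \<le> \<phi>1\<close> by (simp add: abs_mult)
        have "2 * \<bar>dz ?a\<bar> / \<zeta> \<le> 2 * (2 * R * norm ?a) / \<zeta>"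
          using gmp.dz[of ?a] \<zeta> by (intro divide_right_mono mult_left_mono) auto
        then have 2: "\<bar>2 * dz ?a / \<zeta>\<bar> \<le> 4 * (R / \<zeta>) * norm ?a" using \<zeta> by (simp add: abs_mult mult_ac)
        have "- (\<phi>1 * (p \<bullet> ?a) + 2 * dz ?a / \<zeta>) \<le> (norm p + 4 * (R / \<zeta>)) * norm ?a"
          using 1 2 unfolding distrib_right by linarith
        then have "(norm p)\<^sup>2 / 2 * - (\<phi>1 * (p \<bullet> ?a) + 2 * dz ?a / \<zeta>)
            \<le> (norm p)\<^sup>2 / 2 * ((norm p + 4 * (R / \<zeta>)) * norm ?a)" by (rule mult_left_mono) simp
        then show ?thesis by (simp only: mult_minus_left mult_minus_right)
      qed
      finally have "norm ?a * norm ?a \<le> ((norm p)\<^sup>2 / 2 * (norm p + 4 * (R / \<zeta>))) * norm ?a"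
        by (simp only: power2_eq_square mult.assoc)
      moreover have "0 \<le> (norm p)\<^sup>2 / 2 * (norm p + 4 * (R / \<zeta>))" using R \<zeta> by simp
      ultimately show ?thesis by (cases "norm ?a = 0") auto
    qed
    then show "\<bar>h'\<bar> \<le> Ch * (norm p powr (3 + \<gamma>) + norm p powr (2 + \<gamma>) * (R / \<zeta>))"
      unfolding h'_def p_def[symmetric] using R \<zeta> by (intro rhs_derivative_bound[OF x E p1]) auto
  qed (use C in auto)
  then show ?thesis by (simp add: p_def \<zeta>_def)
qed

text \<open>At the maximum of the test function over the ball, \<open>max_point_bound\<close> gives
  |p| \<zeta> \<le> 2 C R. At the centre \<zeta> equals R^2, so comparing the two values gives |p|
  R^2 \<le> 2 C L R there. The exponent of \<zeta> in the test function is matched to this.\<close>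

lemma local_gradient_estimate:
  assumes K: "0 \<le> K"
  shows "\<exists>C>0. \<forall>u u1 u2 u3 y R. C3_jet U u u1 u2 u3 \<longrightarrow> solves u u1 u2 \<longrightarrow> (\<forall>x\<in>U. \<bar>u x\<bar> \<le> K) \<longrightarrow>
    0 < R \<longrightarrow> R \<le> 1 \<longrightarrow> cball y R \<subseteq> U \<longrightarrow> norm (gradv (u1 y)) \<le> C / R"
proof -
  \<comment> \<open>With M = K + 1 the quantity M - u lies between 1 and this
    \<open>L\<close>.\<close>
  define L where "L = 2 * K + 1"
  have L: "1 \<le> L" using K by (simp add: L_def)
  have \<nu>0: "0 < \<nu>0" using f by (simp add: admissible_operator_def)
  have Ch0: "0 \<le> 4 * Ch" using C\<psi> B c unfolding Ch_def
    by (intro mult_nonneg_nonneg add_nonneg_nonneg) auto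
  obtain C where C: "1 \<le> C" "2 * sqrt (1 / c) * (2 + B) \<le> 1 / (2 * L) * (sqrt c / (CARD('n) * B)) * C"
      "4 * gradient_max_point.K1 c B < (1 / (2 * L))\<^sup>2 / 2 * (c / (CARD('n) * B)\<^sup>2) * \<nu>0 * C"
      "4 * Ch * C powr (\<gamma> - 1) < (1 / (2 * L))\<^sup>2 / 2 * (c / (CARD('n) * B)\<^sup>2) * \<nu>0"
  proof (rule large_constant_exists[of "1 / (2 * L) * (sqrt c / (CARD('n) * B))"
      "(1 / (2 * L))\<^sup>2 / 2 * (c / (CARD('n) * B)\<^sup>2) * \<nu>0" "(1 / (2 * L))\<^sup>2 / 2 * (c / (CARD('n) * B)\<^sup>2) * \<nu>0"
      "4 * Ch" "\<gamma> - 1" "2 * sqrt (1 / c) * (2 + B)" "4 * gradient_max_point.K1 c B"])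
  qed (use L c B \<nu>0 \<gamma> Ch0 in auto)
  show ?thesis
  proof (intro exI[of _ "2 * C * L"] conjI allI impI)
    show "0 < 2 * C * L" using C(1) L by simp
    fix u u1 u2 u3 y and R :: real
    assume jet: "C3_jet U u u1 u2 u3" and sol: "solves u u1 u2" and uK: "\<forall>x\<in>U. \<bar>u x\<bar> \<le> K"
      and R: "0 < R" "R \<le> 1" and yR: "cball y R \<subseteq> U"
    define M where "M = K + 1"
    have bU: "1 \<le> M - u x" "M - u x \<le> L" if "x \<in> U" for x
      using uK[rule_format, OF that] by (auto simp: M_def L_def abs_le_iff)
    have y: "y \<in> U" using yR R by auto
    let ?\<Theta> = "test u u1 M R y"
    show "norm (gradv (u1 y)) \<le> 2 * C * L / R"
    proof (cases "gradv (u1 y) = 0")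
      case True
      then show ?thesis using C(1) L R by simp
    next
      case False
      have "continuous_on (cball y R) ?\<Theta>"
      proof -
        have "continuous_on U (\<lambda>x. gradv (u1 x))" "continuous_on U u"
          using C3_jetD(12)[OF jet] C3_jetD(1)[OF jet] U
          by (auto simp: continuous_on_eq_continuous_at intro: has_derivative_continuous)
        then have "continuous_on (cball y R) (\<lambda>x. gradv (u1 x))" "continuous_on (cball y R) u"
          using yR continuous_on_subset by blast+
        moreover have "sqrt (M - u x) \<noteq> 0" if "x \<in> cball y R" for x
          using bU(1)[of x] that yR by auto
        ultimately show ?thesis unfolding test_def by (intro continuous_intros) auto
      qed
      then obtain x where x: "x \<in> cball y R" "\<And>x'. x' \<in> cball y R \<Longrightarrow> ?\<Theta> x' \<le> ?\<Theta> x"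
        using continuous_attains_sup[of "cball y R" ?\<Theta>] R by auto
      have xU: "x \<in> U" using x(1) yR by blast
      have pos: "0 < sqrt (M - u x)" using bU(1)[OF xU] by simp
      have ypos: "(norm (gradv (u1 y)))\<^sup>2 * R ^ 4 / L \<le> ?\<Theta> y"
      proof -
        have "sqrt (M - u y) \<le> sqrt L" using bU(2)[OF y] by simp
        also have "\<dots> \<le> L" using L by (intro real_le_lsqrt) (auto simp: power2_eq_square mult_left_mono)
        finally show ?thesis
          using bU(1)[OF y] by (auto simp: test_def intro!: frac_le)
      qed
      moreover have "0 < (norm (gradv (u1 y)))\<^sup>2 * R ^ 4 / L" using False R L by simp
      ultimately have "0 < ?\<Theta> y" by linarith
      also have "?\<Theta> y \<le> ?\<Theta> x" using x(2)[of y] R by simp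
      finally have \<Theta>pos: "0 < ?\<Theta> x" .
      \<comment> \<open>A positive value of the test function excludes a vanishing gradient as well
        as a point on the sphere, so the derivative tests apply at \<open>x\<close>.\<close>
      then have p0: "gradv (u1 x) \<noteq> 0" and ne: "R\<^sup>2 \<noteq> (norm (x - y))\<^sup>2" by (auto simp: test_def)
      then have xy: "norm (x - y) < R" using x(1) by (cases "norm (x - y) = R") (auto simp: dist_norm norm_minus_commute)
      define d where "d = R - norm (x - y)"
      have d: "0 < d" using xy by (simp add: d_def)
      have bd: "ball x d \<subseteq> cball y R"
      proof
        fix z assume "z \<in> ball x d"
        then show "z \<in> cball y R"
          using dist_triangle[of y z x] by (simp add: d_def dist_norm norm_minus_commute)
      qed
      define \<zeta> where "\<zeta> = R\<^sup>2 - (norm (x - y))\<^sup>2"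
      have "(norm (x - y))\<^sup>2 < R\<^sup>2" using xy by (intro power_strict_mono) auto
      moreover have "R\<^sup>2 \<le> R" using R by (simp add: power2_eq_square mult_left_le)
      ultimately have \<zeta>: "0 < \<zeta>" "\<zeta> \<le> R" by (auto simp: \<zeta>_def intro: order_trans[rotated])
      have "norm (gradv (u1 x)) \<le> C * (1 + R / \<zeta>)" unfolding \<zeta>_def
        by (rule max_point_bound[OF jet sol d _ R xy bU[OF xU] p0 _ C]) (use bd yR x(2) in blast)+
      then have "norm (gradv (u1 x)) * \<zeta> \<le> C * (1 + R / \<zeta>) * \<zeta>" using \<zeta> by (intro mult_right_mono) auto
      also have "\<dots> = C * (\<zeta> + R)" using \<zeta> by (simp add: field_simps)
      also have "\<dots> \<le> C * (2 * R)" using \<zeta> C(1) by (intro mult_left_mono) auto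
      finally have N\<zeta>: "norm (gradv (u1 x)) * \<zeta> \<le> 2 * C * R" by simp
      have "?\<Theta> x = (norm (gradv (u1 x)) * \<zeta>)\<^sup>2 / sqrt (M - u x)"
        by (simp add: test_def \<zeta>_def power_mult_distrib)
      also have "\<dots> \<le> (norm (gradv (u1 x)) * \<zeta>)\<^sup>2 / 1"
        using bU(1)[OF xU] by (intro divide_left_mono) auto
      also have "\<dots> \<le> (2 * C * R)\<^sup>2" unfolding div_by_1 using N\<zeta> \<zeta> by (intro power_mono) auto
      finally have "(norm (gradv (u1 y)))\<^sup>2 * R ^ 4 / L \<le> (2 * C * R)\<^sup>2"
        using ypos x(2)[of y] R by simp
      then have "(norm (gradv (u1 y)))\<^sup>2 * R ^ 4 \<le> (2 * C * R)\<^sup>2 * L" using L by (simp add: field_simps)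
      also have "\<dots> \<le> (2 * C * R)\<^sup>2 * L\<^sup>2"
        using L by (intro mult_left_mono self_le_power) auto
      finally have "(norm (gradv (u1 y)) * R\<^sup>2)\<^sup>2 \<le> (2 * C * R * L)\<^sup>2"
        by (simp add: power_mult_distrib)
      then have "norm (gradv (u1 y)) * R\<^sup>2 \<le> 2 * C * R * L"
        by (rule power2_le_imp_le) (use C(1) R L in simp)
      then have "(norm (gradv (u1 y)) * R) * R \<le> (2 * C * L) * R" by (simp add: power2_eq_square mult_ac)
      then have "norm (gradv (u1 y)) * R \<le> 2 * C * L" using R by simp
      then show ?thesis using R by (simp add: field_simps)
    qed
  qed
qed

end


section \<open>Functions of class C1 up to the boundary\<close>

lemma Ck_on_Suc_imp: "Ck_on (Suc k) S f \<Longrightarrow> Ck_on k S f"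
proof (induction k arbitrary: f)
  case 0
  then obtain f' where "\<And>x. x \<in> S \<Longrightarrow> (f has_derivative f' x) (at x within S)" by auto
  then have "continuous_on S f" by (rule has_derivative_continuous_on)
  then show ?case by simp
next
  case (Suc k)
  from Suc.prems obtain f' where f': "\<forall>x\<in>S. (f has_derivative f' x) (at x within S)"
      "\<forall>v. Ck_on (Suc k) S (\<lambda>x. f' x v)"
    unfolding Ck_on.simps(2)[of "Suc k"] by (elim exE conjE) (rule that)
  have "\<forall>v. Ck_on k S (\<lambda>x. f' x v)" by (intro allI Suc.IH f'(2)[rule_format])
  with f'(1) show ?case unfolding Ck_on.simps(2)[of k] by (intro exI[of _ f'] conjI)
qed

lemma Ck_on_cong: "Ck_on k S f \<Longrightarrow> (\<And>x. x \<in> S \<Longrightarrow> f x = g x) \<Longrightarrow> Ck_on k S g"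
proof (cases k)
  case 0
  assume "Ck_on k S f" "\<And>x. x \<in> S \<Longrightarrow> f x = g x"
  then show ?thesis using 0 by (simp cong: continuous_on_cong)
next
  case (Suc j)
  assume *: "Ck_on k S f" "\<And>x. x \<in> S \<Longrightarrow> f x = g x"
  then obtain f' where f': "\<forall>x\<in>S. (f has_derivative f' x) (at x within S)" "\<forall>v. Ck_on j S (\<lambda>x. f' x v)"
    unfolding Suc Ck_on.simps(2) by blast
  have "(g has_derivative f' x) (at x within S)" if "x \<in> S" for x
    by (rule has_derivative_transform[OF that, of g f]) (use *(2) f'(1) that in auto)
  then show ?thesis unfolding Suc Ck_on.simps(2) using f'(2) by blast
qed

lemma Ck_on_const: "Ck_on k S (\<lambda>_. a)"
proof (induction k arbitrary: a)
  case (Suc k)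
  show ?case unfolding Ck_on.simps(2)
    by (intro exI[of _ "\<lambda>_ _. 0"] conjI ballI allI has_derivative_const Suc)
qed simp

lemma Ck_on_add:
  assumes "Ck_on k S f" "Ck_on k S g"
  shows "Ck_on k S (\<lambda>x. f x + g x)"
  using assms
proof (induction k arbitrary: f g)
  case 0
  then show ?case by (auto intro: continuous_on_add)
next
  case (Suc k)
  then obtain f' g' where "\<forall>x\<in>S. (f has_derivative f' x) (at x within S)" "\<forall>v. Ck_on k S (\<lambda>x. f' x v)"
    "\<forall>x\<in>S. (g has_derivative g' x) (at x within S)" "\<forall>v. Ck_on k S (\<lambda>x. g' x v)"
    unfolding Ck_on.simps(2) by blast
  then have "\<forall>x\<in>S. ((\<lambda>x. f x + g x) has_derivative (\<lambda>v. f' x v + g' x v)) (at x within S)"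
    "\<forall>v. Ck_on k S (\<lambda>x. f' x v + g' x v)"
    using Suc.IH by (auto intro: has_derivative_add)
  then show ?case unfolding Ck_on.simps(2) by (intro exI[of _ "\<lambda>x v. f' x v + g' x v"]) simp
qed

lemma Ck_on_mult:
  fixes f g :: "'a::real_normed_vector \<Rightarrow> real"
  assumes "Ck_on k S f" "Ck_on k S g"
  shows "Ck_on k S (\<lambda>x. f x * g x)"
  using assms
proof (induction k arbitrary: f g)
  case 0
  then show ?case by (auto intro: continuous_on_mult)
next
  case (Suc k)
  then obtain f' g' where 1: "\<forall>x\<in>S. (f has_derivative f' x) (at x within S)" "\<forall>v. Ck_on k S (\<lambda>x. f' x v)"
    "\<forall>x\<in>S. (g has_derivative g' x) (at x within S)" "\<forall>v. Ck_on k S (\<lambda>x. g' x v)"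
    unfolding Ck_on.simps(2) by blast
  have 2: "\<forall>x\<in>S. ((\<lambda>x. f x * g x) has_derivative (\<lambda>v. f x * g' x v + f' x v * g x)) (at x within S)"
    using 1 by (auto intro: has_derivative_mult)
  have "Ck_on k S (\<lambda>x. f x * g' x v + f' x v * g x)" for v
    by (intro Ck_on_add Suc.IH[OF Ck_on_Suc_imp[OF Suc.prems(1)] 1(4)[rule_format]]
        Suc.IH[OF 1(2)[rule_format] Ck_on_Suc_imp[OF Suc.prems(2)]])
  then show ?case using 2 unfolding Ck_on.simps(2) by (intro exI[of _ "\<lambda>x v. f x * g' x v + f' x v * g x"]) simp
qed

lemma Ck_on_cmult: "Ck_on k S f \<Longrightarrow> Ck_on k S (\<lambda>x. (a::real) * f x)"
  by (intro Ck_on_mult Ck_on_const)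

lemma Ck_on_inverse:
  fixes f :: "'a::real_normed_vector \<Rightarrow> real"
  assumes "Ck_on k S f" "\<And>x. x \<in> S \<Longrightarrow> f x \<noteq> 0"
  shows "Ck_on k S (\<lambda>x. inverse (f x))"
  using assms
proof (induction k arbitrary: f)
  case 0
  then show ?case by (auto intro: continuous_on_inverse)
next
  case (Suc k)
  then obtain f' where 1: "\<forall>x\<in>S. (f has_derivative f' x) (at x within S)" "\<forall>v. Ck_on k S (\<lambda>x. f' x v)"
    unfolding Ck_on.simps(2) by blast
  have inv: "Ck_on k S (\<lambda>x. inverse (f x))" using Suc Ck_on_Suc_imp by blast
  have "((\<lambda>x. inverse (f x)) has_derivative (\<lambda>v. - 1 * (inverse (f x) * f' x v * inverse (f x)))) (at x within S)"
    if "x \<in> S" for x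
    using Deriv.has_derivative_inverse[of f x "f' x" S] 1(1) Suc.prems(2)[OF that] that
    by auto
  moreover have "Ck_on k S (\<lambda>x. - 1 * (inverse (f x) * f' x v * inverse (f x)))" for v
    using 1 inv by (intro Ck_on_cmult Ck_on_mult) blast+
  ultimately show ?case unfolding Ck_on.simps(2)
    by (intro exI[of _ "\<lambda>x v. - 1 * (inverse (f x) * f' x v * inverse (f x))"]) blast
qed

lemma Ck_on_sum:
  "(\<And>i. i \<in> I \<Longrightarrow> Ck_on k S (f i)) \<Longrightarrow> Ck_on k S (\<lambda>x. \<Sum>i\<in>I. f i x)"
proof (induction I rule: infinite_finite_induct)
  case (insert i I)
  then have "Ck_on k S (\<lambda>x. f i x + (\<Sum>i\<in>I. f i x))" by (intro Ck_on_add) auto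
  then show ?case using insert by simp
qed (auto intro: Ck_on_const)

lemma Ck_on_prod:
  fixes f :: "'i \<Rightarrow> 'a::real_normed_vector \<Rightarrow> real"
  shows "(\<And>i. i \<in> I \<Longrightarrow> Ck_on k S (f i)) \<Longrightarrow> Ck_on k S (\<lambda>x. \<Prod>i\<in>I. f i x)"
proof (induction I rule: infinite_finite_induct)
  case (insert i I)
  then have "Ck_on k S (\<lambda>x. f i x * (\<Prod>i\<in>I. f i x))" by (intro Ck_on_mult) auto
  then show ?case using insert by simp
qed (auto intro: Ck_on_const)

lemma Ck_on_det:
  fixes M :: "'a::real_normed_vector \<Rightarrow> real^'n^'n"
  assumes "\<And>i j. Ck_on k S (\<lambda>x. M x $ i $ j)"
  shows "Ck_on k S (\<lambda>x. det (M x))"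
  unfolding det_def by (rule Ck_on_sum, rule Ck_on_cmult, rule Ck_on_prod, rule assms)

lemma matrix_inv_right:
  fixes M :: "real^'n^'n"
  shows "invertible M \<Longrightarrow> M ** matrix_inv M = mat 1" "invertible M \<Longrightarrow> matrix_inv M ** M = mat 1"
  using someI_ex[of "\<lambda>A'. M ** A' = mat 1 \<and> A' ** M = mat 1"] by (auto simp: invertible_def matrix_inv_def)

text \<open>Cramer's rule writes an entry of the inverse as a quotient of determinants, and these
  are polynomials in the entries.\<close>

lemma Ck_on_matrix_inv:
  fixes M :: "'a::real_normed_vector \<Rightarrow> real^'n^'n"
  assumes M: "\<And>i j. Ck_on k S (\<lambda>x. M x $ i $ j)" and inv: "\<And>x. x \<in> S \<Longrightarrow> invertible (M x)"
  shows "Ck_on k S (\<lambda>x. matrix_inv (M x) $ i $ j)"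
proof -
  define N where "N x = (\<chi> r s. if s = i then (axis j 1 :: real^'n) $ r else M x $ r $ s)" for x
  have "Ck_on k S (\<lambda>x. N x $ r $ s)" for r s
  proof (cases "s = i")
    case True
    then show ?thesis by (simp add: N_def Ck_on_const)
  qed (use M in \<open>simp add: N_def\<close>)
  then have "Ck_on k S (\<lambda>x. det (N x) * inverse (det (M x)))"
    using inv M by (intro Ck_on_mult Ck_on_inverse Ck_on_det) (auto simp: invertible_det_nz)
  then show ?thesis
  proof (rule Ck_on_cong)
    fix x assume x: "x \<in> S"
    have "M x *v (matrix_inv (M x) *v axis j 1) = axis j 1"
      using matrix_inv_right(1)[OF inv[OF x]] by (simp add: matrix_vector_mul_assoc)
    then have "matrix_inv (M x) *v axis j 1 = (\<chi> k. det (\<chi> r s. if s = k then (axis j 1 :: real^'n) $ r else M x $ r $ s) / det (M x))"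
      using cramer[of "M x"] inv[OF x] by (simp add: invertible_det_nz)
    then have "(matrix_inv (M x) *v axis j 1) $ i = det (N x) / det (M x)" by (simp add: N_def)
    then show "det (N x) * inverse (det (M x)) = matrix_inv (M x) $ i $ j"
      by (simp add: matrix_vector_mul_component inner_axis divide_inverse)
  qed
qed

section \<open>Uniform bounds near a point of the set\<close>

definition C1_bounded_at :: "real \<Rightarrow> ('a::euclidean_space \<Rightarrow> real) \<Rightarrow> 'a \<Rightarrow> bool" where
  "C1_bounded_at B h y \<longleftrightarrow> (h has_derivative frechet_derivative h (at y)) (at y) \<and> \<bar>h y\<bar> \<le> B \<and>
     (\<forall>e. \<bar>frechet_derivative h (at y) e\<bar> \<le> B * norm e)"

text \<open>The bounds hold near every point of \<open>S\<close>, also at those of its boundary, because \<open>Ck_on\<close> gives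
  derivatives that are continuous up to there.\<close>

lemma C1_bounded:
  fixes k h :: "'a::euclidean_space \<Rightarrow> real"
  assumes a: "a \<in> S" and k: "Ck_on (Suc 0) S k" and eq: "\<And>y. y \<in> interior S \<Longrightarrow> h y = k y"
  shows "\<exists>B. \<forall>\<^sub>F y in inf (nhds a) (principal (interior S)). C1_bounded_at B h y"
proof -
  obtain k' where k': "\<And>x. x \<in> S \<Longrightarrow> (k has_derivative k' x) (at x within S)" "\<And>v. continuous_on S (\<lambda>x. k' x v)"
    using k by auto
  have ck: "continuous_on S k" using Ck_on_Suc_imp[OF k] by simp
  \<comment> \<open>\<open>m\<close> dominates the value of \<open>k\<close> and, through the basis,
    the norm of its derivative; being continuous on all of \<open>S\<close>, it is bounded near
    \<open>a\<close> even if \<open>a\<close> is a boundary point.\<close>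
  define m where "m y = \<bar>k y\<bar> + (\<Sum>b\<in>Basis. \<bar>k' y b\<bar>)" for y
  have "continuous_on S m" unfolding m_def by (intro continuous_intros ck k'(2))
  then obtain d where d: "0 < d" "\<And>y. y \<in> S \<Longrightarrow> dist y a < d \<Longrightarrow> dist (m y) (m a) < 1"
    using a unfolding continuous_on_iff by (meson zero_less_one)
  have "C1_bounded_at (m a + 1) h y" if y: "y \<in> interior S" "dist y a < d" for y
  proof -
    have yS: "y \<in> S" using y interior_subset by blast
    have my: "m y \<le> m a + 1" using d(2)[OF yS y(2)] by (simp add: dist_real_def)
    have D: "(k has_derivative k' y) (at y)" using k'(1)[OF yS] unfolding at_within_interior[OF y(1)] .
    have Dh: "(h has_derivative k' y) (at y)"
      by (rule has_derivative_transform_within_open[OF D open_interior y(1)]) (simp add: eq)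
    have fd: "frechet_derivative h (at y) = k' y" using frechet_derivative_at[OF Dh] by simp
    have s0: "0 \<le> (\<Sum>b\<in>Basis. \<bar>k' y b\<bar>)" by (intro sum_nonneg) auto
    have "\<bar>k' y e\<bar> \<le> (m a + 1) * norm e" for e
    proof -
      have "k' y e = k' y (\<Sum>b\<in>Basis. (e \<bullet> b) *\<^sub>R b)" by (simp add: euclidean_representation)
      also have "\<dots> = (\<Sum>b\<in>Basis. (e \<bullet> b) * k' y b)"
        unfolding linear_sum[OF has_derivative_linear[OF D]] linear_cmul[OF has_derivative_linear[OF D]] by simp
      also have "\<bar>\<dots>\<bar> \<le> (\<Sum>b\<in>Basis. norm e * \<bar>k' y b\<bar>)"
        by (intro order_trans[OF sum_abs] sum_mono) (auto simp: abs_mult Basis_le_norm intro: mult_right_mono)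
      also have "\<dots> = (\<Sum>b\<in>Basis. \<bar>k' y b\<bar>) * norm e" by (simp add: sum_distrib_left mult.commute)
      also have "\<dots> \<le> (m a + 1) * norm e" using my by (intro mult_right_mono) (auto simp: m_def)
      finally show ?thesis .
    qed
    moreover have "\<bar>h y\<bar> \<le> m a + 1" using my s0 eq[OF y(1)] unfolding m_def[of y] by linarith
    ultimately show ?thesis using Dh by (simp add: C1_bounded_at_def fd)
  qed
  then have "\<forall>\<^sub>F y in inf (nhds a) (principal (interior S)). C1_bounded_at (m a + 1) h y"
    using d(1) unfolding eventually_inf_principal eventually_nhds_metric by (intro exI[of _ d]) simp
  then show ?thesis by (rule exI)
qed

lemma C1_bounded_at_mono:
  assumes "B \<le> B'" "C1_bounded_at B h y"
  shows "C1_bounded_at B' h y"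
proof -
  have "\<bar>frechet_derivative h (at y) e\<bar> \<le> B' * norm e" for e
  proof -
    have "\<bar>frechet_derivative h (at y) e\<bar> \<le> B * norm e" using assms(2) by (simp add: C1_bounded_at_def)
    also have "\<dots> \<le> B' * norm e" using assms(1) by (rule mult_right_mono) simp
    finally show ?thesis .
  qed
  then show ?thesis using assms by (simp add: C1_bounded_at_def)
qed

lemma C1_bounded_family:
  assumes "finite I" "\<And>i. i \<in> I \<Longrightarrow> \<exists>B. eventually (\<lambda>y. C1_bounded_at B (h i) y) F"
  shows "\<exists>B. \<forall>\<^sub>F y in F. \<forall>i\<in>I. C1_bounded_at B (h i) y"
proof -
  have "\<forall>i\<in>I. \<exists>B. eventually (\<lambda>y. C1_bounded_at B (h i) y) F" using assms(2) by simp
  then obtain B where "\<forall>i\<in>I. eventually (\<lambda>y. C1_bounded_at (B i) (h i) y) F"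
    by (rule bchoice[THEN exE])
  then have B: "\<And>i. i \<in> I \<Longrightarrow> eventually (\<lambda>y. C1_bounded_at (B i) (h i) y) F" by simp
  have "eventually (\<lambda>y. C1_bounded_at (\<Sum>j\<in>I. \<bar>B j\<bar>) (h i) y) F" if "i \<in> I" for i
  proof -
    have "\<bar>B i\<bar> \<le> (\<Sum>j\<in>I. \<bar>B j\<bar>)" using assms(1) that by (intro member_le_sum) auto
    then have "B i \<le> (\<Sum>j\<in>I. \<bar>B j\<bar>)" by simp
    from C1_bounded_at_mono[OF this] show ?thesis by (rule eventually_mono[OF B[OF that]])
  qed
  then have "\<forall>\<^sub>F y in F. \<forall>i\<in>I. C1_bounded_at (\<Sum>j\<in>I. \<bar>B j\<bar>) (h i) y"
    by (intro eventually_ball_finite assms(1)) simp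
  then show ?thesis by (rule exI)
qed

lemma has_derivative_vec:
  fixes f :: "'a::real_normed_vector \<Rightarrow> real^'n"
  assumes "\<And>i. ((\<lambda>x. f x $ i) has_derivative (\<lambda>e. f' e $ i)) (at x)"
  shows "(f has_derivative f') (at x)"
  unfolding has_derivative_componentwise_within[of f f' x UNIV]
  using assms by (auto simp: Basis_vec_def inner_axis)

lemma double_sum_bound:
  fixes v w :: "real^'n"
  assumes "\<And>i j. \<bar>m i j\<bar> \<le> b"
  shows "\<bar>\<Sum>i\<in>UNIV. \<Sum>j\<in>UNIV. m i j * v $ i * w $ j\<bar> \<le> real (CARD('n))^2 * b * norm v * norm w"
proof -
  have b: "0 \<le> b" using assms[of undefined undefined] by simp
  have "\<bar>\<Sum>i\<in>UNIV. \<Sum>j\<in>UNIV. m i j * v $ i * w $ j\<bar> \<le> (\<Sum>i\<in>(UNIV::'n set). \<Sum>j\<in>(UNIV::'n set). b * norm v * norm w)"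
    unfolding abs_mult using assms b
    by (intro order_trans[OF sum_abs] sum_mono order_trans[OF sum_abs], unfold abs_mult, intro mult_mono)
      (auto simp: component_le_norm_cart)
  then show ?thesis by (simp add: power2_eq_square mult_ac)
qed

lemma norm_vec_bound:
  fixes z :: "real^'n" and b :: real
  assumes "\<And>k. \<bar>z $ k\<bar> \<le> b"
  shows "norm z \<le> CARD('n) * b"
proof -
  have "norm z \<le> (\<Sum>k\<in>UNIV. \<bar>z $ k\<bar>)" by (rule norm_le_l1_cart)
  also have "\<dots> \<le> (\<Sum>k\<in>(UNIV::'n set). b)" by (intro sum_mono assms)
  finally show ?thesis by simp
qed

lemma matrix_form_sum:
  fixes v w :: "real^'n"
  shows "v \<bullet> (M *v w) = (\<Sum>i\<in>UNIV. \<Sum>j\<in>UNIV. M $ i $ j * v $ i * w $ j)"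
proof -
  have "v \<bullet> (M *v w) = (\<Sum>i\<in>UNIV. v $ i * (\<Sum>j\<in>UNIV. M $ i $ j * w $ j))"
    by (simp add: inner_vec_def matrix_vector_mult_def)
  also have "\<dots> = (\<Sum>i\<in>UNIV. \<Sum>j\<in>UNIV. M $ i $ j * v $ i * w $ j)"
    unfolding sum_distrib_left by (intro sum.cong refl) (simp only: mult_ac)
  finally show ?thesis .
qed

text \<open>By compactness the form at \<open>a\<close> has a positive minimum on the unit sphere,
  hence by scaling a quadratic lower bound; nearby, the continuous entries consume at most half of
  it.\<close>

lemma uniform_positivity_near:
  fixes M :: "real^'n \<Rightarrow> real^'n^'n"
  assumes a: "a \<in> S" and cont: "\<And>i j. continuous_on S (\<lambda>y. M y $ i $ j)"
    and pos: "\<And>v. v \<noteq> 0 \<Longrightarrow> 0 < v \<bullet> (M a *v v)"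
  obtains c d where "0 < c" "0 < d" "\<And>y v. y \<in> S \<Longrightarrow> dist y a < d \<Longrightarrow> c * (norm v)\<^sup>2 \<le> v \<bullet> (M y *v v)"
proof -
  have co: "continuous_on (sphere 0 1) (\<lambda>v. v \<bullet> (M a *v v))"
    by (intro continuous_on_inner continuous_on_id matrix_vector_mult_linear_continuous_on)
  have ne: "sphere (0::real^'n) 1 \<noteq> {}" by simp
  from continuous_attains_inf[OF compact_sphere ne co] obtain v0 where v0': "v0 \<in> sphere 0 1" "\<forall>v\<in>sphere 0 1. v0 \<bullet> (M a *v v0) \<le> v \<bullet> (M a *v v)"
    by (rule bexE)
  then have v0: "v0 \<in> sphere 0 1" "\<And>v. v \<in> sphere 0 1 \<Longrightarrow> v0 \<bullet> (M a *v v0) \<le> v \<bullet> (M a *v v)" by simp_all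
  define c0 where "c0 = v0 \<bullet> (M a *v v0)"
  have "v0 \<noteq> 0" using v0(1) by auto
  then have c0: "0 < c0" using pos[of v0] by (simp add: c0_def)
  have low: "c0 * (norm v)\<^sup>2 \<le> v \<bullet> (M a *v v)" for v
  proof (cases "v = 0")
    case False
    have "c0 \<le> (v /\<^sub>R norm v) \<bullet> (M a *v (v /\<^sub>R norm v))" using v0(2)[of "v /\<^sub>R norm v"] False by (simp add: c0_def)
    also have "\<dots> = (v \<bullet> (M a *v v)) / (norm v)\<^sup>2"
      by (simp add: matrix_vector_mult_scaleR power2_eq_square field_simps)
    finally show ?thesis using False by (simp add: field_simps)
  qed simp
  define m where "m y = (\<Sum>i\<in>UNIV. \<Sum>j\<in>UNIV. \<bar>M y $ i $ j - M a $ i $ j\<bar>)" for y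
  \<comment> \<open>Entries that deviate by at most \<open>b\<close> change the form by at most n^2
    b |v|^2, which this choice keeps below half of the lower bound.\<close>
  define b where "b = c0 / (2 * (real (CARD('n))^2 + 1))"
  have n1: "0 < real (CARD('n))^2 + 1" by (rule add_nonneg_pos) auto
  then have b0: "0 < b" using c0 by (simp add: b_def)
  have "continuous_on S m" unfolding m_def by (intro continuous_intros cont)
  then obtain d where d: "0 < d" "\<And>y. y \<in> S \<Longrightarrow> dist y a < d \<Longrightarrow> dist (m y) (m a) < b"
    using a b0 unfolding continuous_on_iff by blast
  show thesis
  proof (rule that[of "c0 / 2" d])
    fix y v assume y: "y \<in> S" "dist y a < d"
    have "m a = 0" by (simp add: m_def)
    then have my: "m y < b" using d(2)[OF y] by (simp add: dist_real_def)
    have "\<bar>M y $ i $ j - M a $ i $ j\<bar> \<le> m y" for i j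
    proof -
      have "\<bar>M y $ i $ j - M a $ i $ j\<bar> \<le> (\<Sum>j\<in>UNIV. \<bar>M y $ i $ j - M a $ i $ j\<bar>)" by (rule member_le_sum) auto
      also have "\<dots> \<le> m y" unfolding m_def by (rule member_le_sum) (auto intro: sum_nonneg)
      finally show ?thesis .
    qed
    then have "\<bar>(M y - M a) $ i $ j\<bar> \<le> b" for i j
      using order_trans[OF _ less_imp_le[OF my]] by simp
    then have "\<bar>v \<bullet> ((M y - M a) *v v)\<bar> \<le> real (CARD('n))^2 * b * norm v * norm v"
      unfolding matrix_form_sum by (rule double_sum_bound)
    also have "\<dots> = (real (CARD('n))^2 * b) * (norm v)\<^sup>2" by (simp add: power2_eq_square)
    also have "\<dots> \<le> c0 / 2 * (norm v)\<^sup>2"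
    proof (rule mult_right_mono)
      have "z * (c0 / (2 * z)) = c0 / 2" if "z \<noteq> 0" for z using that by simp
      from this[of "real (CARD('n))^2 + 1"] have "(real (CARD('n))^2 + 1) * b = c0 / 2"
        unfolding b_def using n1 by simp
      then show "real (CARD('n))^2 * b \<le> c0 / 2" using b0 by (simp add: distrib_right)
    qed simp
    finally have "\<bar>v \<bullet> ((M y - M a) *v v)\<bar> \<le> c0 / 2 * (norm v)\<^sup>2" .
    moreover have "v \<bullet> ((M y - M a) *v v) = v \<bullet> (M y *v v) - v \<bullet> (M a *v v)"
      by (simp add: matrix_vector_mult_diff_rdistrib inner_diff_right)
    ultimately have "v \<bullet> (M a *v v) - v \<bullet> (M y *v v) \<le> c0 / 2 * (norm v)\<^sup>2" by linarith
    then show "c0 / 2 * (norm v)\<^sup>2 \<le> v \<bullet> (M y *v v)" using low[of v] by simp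
  qed (use c0 d in auto)
qed


section \<open>Charts and tangent vectors\<close>

lemma Ck_on_Suc_differentiable:
  assumes "Ck_on (Suc k) S f" "x \<in> S"
  shows "f differentiable (at x within S)"
proof -
  from assms(1) obtain f' where "\<forall>x\<in>S. (f has_derivative f' x) (at x within S)" by auto
  then have "(f has_derivative f' x) (at x within S)" using assms(2) by simp
  then show ?thesis unfolding differentiable_def by blast
qed

lemma chart_basics:
  assumes atlas: "smooth_atlas X A" and c: "c \<in> A"
  shows "openin X (chart_dom c)" "inj_on (chart_map c) (chart_dom c)"
    "x \<in> chart_dom c \<Longrightarrow> chart_inv c (chart_map c x) = x"
    "x \<in> chart_dom c \<Longrightarrow> chart_map c x \<in> chart_img c"
    "y \<in> chart_img c \<Longrightarrow> chart_inv c y \<in> chart_dom c"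
    "y \<in> chart_img c \<Longrightarrow> chart_map c (chart_inv c y) = y"
    "openin X W \<Longrightarrow> W \<subseteq> chart_dom c \<Longrightarrow> openin (top_of_set (chart_img c)) (chart_map c ` W)"
    "continuous_map (subtopology X (chart_dom c)) (top_of_set (chart_img c)) (chart_map c)"
    "continuous_map (top_of_set (chart_img c)) X (chart_inv c)"
proof -
  have ch: "is_chart X c" using atlas c by (simp add: smooth_atlas_def)
  then have hm: "homeomorphic_map (subtopology X (chart_dom c)) (top_of_set (chart_img c)) (chart_map c)"
    and op: "openin X (chart_dom c)" by (auto simp: is_chart_def)
  show "openin X (chart_dom c)" by (rule op)
  have ts: "topspace (subtopology X (chart_dom c)) = chart_dom c"
    using openin_subset[OF op] by (auto simp: topspace_subtopology)
  show inj: "inj_on (chart_map c) (chart_dom c)"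
    using homeomorphic_imp_injective_map[OF hm] unfolding ts .
  show inv1: "chart_inv c (chart_map c x) = x" if "x \<in> chart_dom c" for x
    unfolding chart_inv_def by (rule inv_into_f_f[OF inj that])
  show img: "chart_map c x \<in> chart_img c" if "x \<in> chart_dom c" for x
    using that by (simp add: chart_img_def)
  show inv2: "chart_inv c y \<in> chart_dom c" if "y \<in> chart_img c" for y
    using that unfolding chart_img_def chart_inv_def by (rule inv_into_into)
  show inv3: "chart_map c (chart_inv c y) = y" if "y \<in> chart_img c" for y
    using that unfolding chart_img_def chart_inv_def by (rule f_inv_into_f)
  have om: "open_map (subtopology X (chart_dom c)) (top_of_set (chart_img c)) (chart_map c)"
    by (rule homeomorphic_imp_open_map[OF hm])
  show opm: "openin (top_of_set (chart_img c)) (chart_map c ` W)" if "openin X W" "W \<subseteq> chart_dom c" for W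
  proof -
    have "openin (subtopology X (chart_dom c)) W" using that op by (simp add: openin_open_subtopology)
    then show ?thesis using om by (simp add: open_map_def)
  qed
  show "continuous_map (subtopology X (chart_dom c)) (top_of_set (chart_img c)) (chart_map c)"
    by (rule homeomorphic_imp_continuous_map[OF hm])
  show "continuous_map (top_of_set (chart_img c)) X (chart_inv c)"
    unfolding continuous_map_def
  proof (intro conjI allI impI)
    show "chart_inv c \<in> topspace (top_of_set (chart_img c)) \<rightarrow> topspace X"
      using inv2 openin_subset[OF op] by auto
    fix V assume V: "openin X V"
    have "{y \<in> topspace (top_of_set (chart_img c)). chart_inv c y \<in> V} = chart_map c ` (V \<inter> chart_dom c)"
    proof (rule set_eqI, rule iffI)
      fix y assume "y \<in> {y \<in> topspace (top_of_set (chart_img c)). chart_inv c y \<in> V}"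
      then have "y \<in> chart_img c" "chart_inv c y \<in> V" by auto
      then show "y \<in> chart_map c ` (V \<inter> chart_dom c)"
        using inv2 inv3 by (intro image_eqI[of _ _ "chart_inv c y"]) auto
    qed (use inv1 img in auto)
    moreover have "openin X (V \<inter> chart_dom c)" using V op by (rule openin_Int)
    ultimately show "openin (top_of_set (chart_img c)) {y \<in> topspace (top_of_set (chart_img c)). chart_inv c y \<in> V}"
      using opm[of "V \<inter> chart_dom c"] by simp
  qed
qed

lemma transition_interior:
  assumes atlas: "smooth_atlas X A" and c: "c \<in> A" and d: "d \<in> A" and x: "x \<in> chart_dom c" "x \<in> chart_dom d"
    and int: "chart_map c x \<in> interior (chart_img c)"
  shows "chart_map c x \<in> interior (chart_map c ` (chart_dom c \<inter> chart_dom d))"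
proof -
  have "openin X (chart_dom c \<inter> chart_dom d)"
    using chart_basics(1)[OF atlas c] chart_basics(1)[OF atlas d] by (rule openin_Int)
  then have "openin (top_of_set (chart_img c)) (chart_map c ` (chart_dom c \<inter> chart_dom d))"
    by (rule chart_basics(7)[OF atlas c]) simp
  then obtain T where T: "open T" "chart_map c ` (chart_dom c \<inter> chart_dom d) = chart_img c \<inter> T"
    by (auto simp: openin_open)
  have "chart_map c x \<in> T" using x T(2) by auto
  then show ?thesis unfolding T(2) interior_Int interior_open[OF T(1)] using int by simp
qed

lemma transition_differentiable:
  assumes atlas: "smooth_atlas X A" and c: "c \<in> A" and d: "d \<in> A" and x: "x \<in> chart_dom c" "x \<in> chart_dom d"
    and int: "chart_map c x \<in> interior (chart_img c)"
  shows "((chart_map d \<circ> chart_inv c) has_derivative coord_change c d x) (at (chart_map c x))"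
proof -
  let ?W = "chart_map c ` (chart_dom c \<inter> chart_dom d)"
  have iW: "chart_map c x \<in> interior ?W" by (rule transition_interior[OF assms])
  have "smooth_on ?W (chart_map d \<circ> chart_inv c)" using atlas c d by (simp add: smooth_atlas_def)
  then have "Ck_on (Suc 0) ?W (chart_map d \<circ> chart_inv c)" unfolding smooth_on_def by (rule spec)
  then have "(chart_map d \<circ> chart_inv c) differentiable (at (chart_map c x) within ?W)"
    by (rule Ck_on_Suc_differentiable) (use x in simp)
  then have "((chart_map d \<circ> chart_inv c) has_derivative coord_change c d x) (at (chart_map c x) within ?W)"
    unfolding coord_change_def by (simp only: frechet_derivative_works)
  then show ?thesis unfolding at_within_interior[OF iW] .
qed

text \<open>A boundary point is one that some chart sees as such, so interiority concerns every
  chart around the point. At such points coordinate changes have ordinary derivatives in all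
  directions and the chain rule applies.\<close>

definition interior_point :: "('m, 'n::finite) chart set \<Rightarrow> 'm \<Rightarrow> bool" where
  "interior_point A x \<longleftrightarrow> (\<forall>c\<in>A. x \<in> chart_dom c \<longrightarrow> chart_map c x \<in> interior (chart_img c))"

lemma manifold_interiorD: "x \<in> manifold_interior X A \<Longrightarrow> interior_point A x"
  by (auto simp: manifold_interior_def manifold_boundary_def interior_point_def)

lemma coord_change_cocycle:
  assumes atlas: "smooth_atlas X A" and A: "c \<in> A" "d \<in> A" "e \<in> A"
    and x: "x \<in> chart_dom c" "x \<in> chart_dom d" "x \<in> chart_dom e" and int: "interior_point A x"
  shows "coord_change c e x v = coord_change d e x (coord_change c d x v)"
proof -
  let ?y = "chart_map c x"
  have iv: "chart_map c x \<in> interior (chart_img c)" "chart_map d x \<in> interior (chart_img d)"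
    using int A x by (auto simp: interior_point_def)
  note D1 = transition_differentiable[OF atlas A(1,2) x(1,2) iv(1)]
  note D2 = transition_differentiable[OF atlas A(2,3) x(2,3) iv(2)]
  note D3 = transition_differentiable[OF atlas A(1,3) x(1,3) iv(1)]
  have y: "(chart_map d \<circ> chart_inv c) ?y = chart_map d x"
    using chart_basics(3)[OF atlas A(1) x(1)] by simp
  have "((chart_map e \<circ> chart_inv d) \<circ> (chart_map d \<circ> chart_inv c) has_derivative
      coord_change d e x \<circ> coord_change c d x) (at ?y)"
    by (rule diff_chain_at[OF D1]) (use D2 y in simp)
  then have "((chart_map e \<circ> chart_inv c) has_derivative coord_change d e x \<circ> coord_change c d x) (at ?y)"
  proof (rule has_derivative_transform_within_open)
    show "open (interior (chart_map c ` (chart_dom c \<inter> chart_dom d)))" by simp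
    show "?y \<in> interior (chart_map c ` (chart_dom c \<inter> chart_dom d))"
      by (rule transition_interior[OF atlas A(1,2) x(1,2) iv(1)])
    fix z assume "z \<in> interior (chart_map c ` (chart_dom c \<inter> chart_dom d))"
    then have "z \<in> chart_map c ` (chart_dom c \<inter> chart_dom d)" using interior_subset by auto
    then obtain x' where x': "x' \<in> chart_dom c" "x' \<in> chart_dom d" "z = chart_map c x'" by auto
    then have "chart_inv c z = x'" using chart_basics(3)[OF atlas A(1)] by simp
    then show "((chart_map e \<circ> chart_inv d) \<circ> (chart_map d \<circ> chart_inv c)) z = (chart_map e \<circ> chart_inv c) z"
      using chart_basics(3)[OF atlas A(2) x'(2)] by simp
  qed
  from has_derivative_unique[OF D3 this] show ?thesis by (simp add: fun_eq_iff)
qed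

lemma tvec_coord_change:
  assumes atlas: "smooth_atlas X A" and A: "c \<in> A" "d \<in> A" and x: "x \<in> chart_dom c" "x \<in> chart_dom d"
    and int: "interior_point A x"
  shows "tvec A c x v = tvec A d x (coord_change c d x v)"
  unfolding tvec_def
  using coord_change_cocycle[OF atlas A _ x _ int] by (intro ext) simp

lemma coord_change_self:
  assumes atlas: "smooth_atlas X A" and A: "c \<in> A" and x: "x \<in> chart_dom c" and int: "interior_point A x"
  shows "coord_change c c x v = v"
proof -
  have iv: "chart_map c x \<in> interior (chart_img c)" using int A x by (simp add: interior_point_def)
  have "((chart_map c \<circ> chart_inv c) has_derivative (\<lambda>v. v)) (at (chart_map c x))"
  proof (rule has_derivative_transform_within_open[OF has_derivative_ident])
    show "z = (chart_map c \<circ> chart_inv c) z" if "z \<in> interior (chart_img c)" for z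
      using chart_basics(6)[OF atlas A] interior_subset that by (metis comp_apply subsetD)
  qed (use iv in auto)
  from has_derivative_unique[OF transition_differentiable[OF atlas A A x x iv] this]
  show ?thesis by simp
qed

section \<open>Metric and gradient under coordinate changes\<close>

lemma metric_form:
  assumes g: "riemannian_metric A g" and c: "c \<in> A" "x \<in> chart_dom c"
  shows "w \<bullet> (metric_matrix A g c x *v v) = g x (tvec A c x w) (tvec A c x v)"
proof -
  define h where "h = (\<lambda>v w. g x (tvec A c x v) (tvec A c x w))"
  have bl: "bilinear h" using g c by (auto simp: riemannian_metric_def h_def)
  have "h w v = h (\<Sum>i\<in>UNIV. w $ i *\<^sub>R axis i 1) (\<Sum>j\<in>UNIV. v $ j *\<^sub>R axis j 1)"
    using basis_expansion[of w] basis_expansion[of v] by (simp add: scalar_mult_eq_scaleR)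
  also have "\<dots> = (\<Sum>j\<in>UNIV. \<Sum>i\<in>UNIV. v $ j * (w $ i * h (axis i 1) (axis j 1)))"
    by (simp only: bilinear_expand[OF bl] sum_distrib_left)
  also have "\<dots> = (\<Sum>i\<in>UNIV. \<Sum>j\<in>UNIV. v $ j * (w $ i * h (axis i 1) (axis j 1)))" by (rule sum.swap)
  also have "\<dots> = w \<bullet> (metric_matrix A g c x *v v)"
    unfolding matrix_form_sum metric_matrix_def h_def
    by (intro sum.cong refl) (simp add: mult_ac)
  finally show ?thesis by (simp add: h_def)
qed

lemma metric_matrix_spd:
  assumes g: "riemannian_metric A g" and c: "c \<in> A" "x \<in> chart_dom c"
  shows "transpose (metric_matrix A g c x) = metric_matrix A g c x"
    "v \<noteq> 0 \<Longrightarrow> 0 < v \<bullet> (metric_matrix A g c x *v v)"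
proof -
  show "transpose (metric_matrix A g c x) = metric_matrix A g c x"
    using metric_matrix_symmetric[OF assms] by (simp add: transpose_def vec_eq_iff)
  show "v \<noteq> 0 \<Longrightarrow> 0 < v \<bullet> (metric_matrix A g c x *v v)"
    using g c unfolding metric_form[OF assms] by (auto simp: riemannian_metric_def)
qed

lemma matrix_inv_form:
  assumes g: "riemannian_metric A g" and c: "c \<in> A" "x \<in> chart_dom c"
  shows "(matrix_inv (metric_matrix A g c x) *v p) \<bullet> (metric_matrix A g c x *v v) = p \<bullet> v"
proof -
  let ?M = "metric_matrix A g c x"
  have "(matrix_inv ?M *v p) \<bullet> (?M *v v) = v \<bullet> (?M *v (matrix_inv ?M *v p))"
    using spd_formD(2)[OF spd_form_matrix[OF metric_matrix_spd[OF assms]]] by blast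
  also have "?M *v (matrix_inv ?M *v p) = p"
    using matrix_inv_right(1)[OF metric_matrix_invertible[OF assms]] by (simp add: matrix_vector_mul_assoc)
  finally show ?thesis by (simp add: inner_commute)
qed

text \<open>Writing \<open>J\<close> for the derivative of the coordinate change, \<open>G\<^sub>c = J\<^sup>T G\<^sub>d J\<close> and \<open>p\<^sub>c = J\<^sup>T p\<^sub>d\<close>, hence
  \<open>J G\<^sub>c\<^sup>-\<^sup>1 p\<^sub>c = G\<^sub>d\<^sup>-\<^sup>1 p\<^sub>d\<close>.\<close>

lemma grad_eq_tvec:
  fixes A :: "('m, 'n::finite) chart set"
  assumes atlas: "smooth_atlas X A" and g: "riemannian_metric A g" and u: "C3_fun A u"
    and c: "c \<in> A" "x \<in> chart_dom c" and int: "interior_point A x"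
  shows "tvec A c x (grad A g u x c) = grad A g u x"
proof -
  define P where "P d = (\<chi> j. partial_deriv (chart_img d) j (u \<circ> chart_inv d) (chart_map d x))" for d :: "('m, 'n) chart"
  have der: "((u \<circ> chart_inv d) has_derivative (\<lambda>v. P d \<bullet> v)) (at (chart_map d x))"
    if d: "d \<in> A" "x \<in> chart_dom d" for d
  proof -
    have iv: "chart_map d x \<in> interior (chart_img d)" using int d by (simp add: interior_point_def)
    have "Ck_on (Suc (Suc (Suc 0))) (chart_img d) (u \<circ> chart_inv d)"
      using u d(1) by (simp add: C3_fun_def numeral_3_eq_3)
    then have "(u \<circ> chart_inv d) differentiable (at (chart_map d x) within chart_img d)"
      using chart_basics(4)[OF atlas d] by (rule Ck_on_Suc_differentiable)
    then have D: "((u \<circ> chart_inv d) has_derivative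
        frechet_derivative (u \<circ> chart_inv d) (at (chart_map d x) within chart_img d)) (at (chart_map d x))"
      unfolding frechet_derivative_works at_within_interior[OF iv] .
    have "frechet_derivative (u \<circ> chart_inv d) (at (chart_map d x) within chart_img d) v = P d \<bullet> v" for v
    proof -
      let ?D = "frechet_derivative (u \<circ> chart_inv d) (at (chart_map d x) within chart_img d)"
      have "?D v = ?D (\<Sum>i\<in>UNIV. v $ i *\<^sub>R axis i 1)"
        using basis_expansion[of v] by (simp add: scalar_mult_eq_scaleR)
      also have "\<dots> = (\<Sum>i\<in>UNIV. v $ i * ?D (axis i 1))"
        unfolding linear_sum[OF has_derivative_linear[OF D]] linear_cmul[OF has_derivative_linear[OF D]] by simp
      finally show ?thesis by (simp add: P_def partial_deriv_def inner_vec_def mult.commute)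
    qed
    then have "frechet_derivative (u \<circ> chart_inv d) (at (chart_map d x) within chart_img d) = (\<lambda>v. P d \<bullet> v)" by (rule ext)
    with D show ?thesis by simp
  qed
  have gr: "grad A g u x d = matrix_inv (metric_matrix A g d x) *v P d" if "d \<in> A" "x \<in> chart_dom d" for d
    using that by (simp add: grad_def P_def)
  have "coord_change c d x (grad A g u x c) = grad A g u x d" if d: "d \<in> A" "x \<in> chart_dom d" for d
  proof -
    have iv: "chart_map c x \<in> interior (chart_img c)" using int c by (simp add: interior_point_def)
    let ?J = "coord_change c d x"
    note J = transition_differentiable[OF atlas c(1) d(1) c(2) d(2) iv]
    have y: "(chart_map d \<circ> chart_inv c) (chart_map c x) = chart_map d x"
      using chart_basics(3)[OF atlas c] by simp
    have "((u \<circ> chart_inv d) \<circ> (chart_map d \<circ> chart_inv c) has_derivative (\<lambda>v. P d \<bullet> v) \<circ> ?J) (at (chart_map c x))"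
      by (rule diff_chain_at[OF J]) (use der[OF d] y in simp)
    then have "((u \<circ> chart_inv c) has_derivative (\<lambda>v. P d \<bullet> v) \<circ> ?J) (at (chart_map c x))"
    proof (rule has_derivative_transform_within_open)
      show "open (interior (chart_map c ` (chart_dom c \<inter> chart_dom d)))" by simp
      show "chart_map c x \<in> interior (chart_map c ` (chart_dom c \<inter> chart_dom d))"
        by (rule transition_interior[OF atlas c(1) d(1) c(2) d(2) iv])
      fix z assume "z \<in> interior (chart_map c ` (chart_dom c \<inter> chart_dom d))"
      then have "z \<in> chart_map c ` (chart_dom c \<inter> chart_dom d)" using interior_subset by auto
      then obtain x' where x': "x' \<in> chart_dom c" "x' \<in> chart_dom d" "z = chart_map c x'" by auto
      then have "chart_inv c z = x'" using chart_basics(3)[OF atlas c(1)] by simp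
      then show "((u \<circ> chart_inv d) \<circ> (chart_map d \<circ> chart_inv c)) z = (u \<circ> chart_inv c) z"
        using chart_basics(3)[OF atlas d(1) x'(2)] by simp
    qed
    from has_derivative_unique[OF der[OF c] this] have Pc: "P c \<bullet> v = P d \<bullet> ?J v" for v
      by (simp add: fun_eq_iff)
    let ?w = "grad A g u x c" and ?w' = "grad A g u x d"
    have "(?J ?w - ?w') \<bullet> (metric_matrix A g d x *v ?J v) = 0" for v
    proof -
      have "?J ?w \<bullet> (metric_matrix A g d x *v ?J v) = ?w \<bullet> (metric_matrix A g c x *v v)"
        unfolding metric_form[OF g d] metric_form[OF g c]
        using tvec_coord_change[OF atlas c(1) d(1) c(2) d(2) int] by simp
      also have "\<dots> = P c \<bullet> v" unfolding gr[OF c] by (rule matrix_inv_form[OF g c])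
      also have "\<dots> = ?w' \<bullet> (metric_matrix A g d x *v ?J v)"
        unfolding Pc gr[OF d] by (rule matrix_inv_form[OF g d, symmetric])
      finally show ?thesis by (simp add: inner_diff_left)
    qed
    \<comment> \<open>The derivative of the reverse coordinate change inverts \<open>?J\<close>, so
      the test vector becomes the difference itself, and definiteness of the metric makes it
      vanish.\<close>
    from this[of "coord_change d c x (?J ?w - ?w')"]
    have "(?J ?w - ?w') \<bullet> (metric_matrix A g d x *v (?J ?w - ?w')) = 0"
      using coord_change_cocycle[OF atlas d(1) c(1) d(1) d(2) c(2) d(2) int]
        coord_change_self[OF atlas d int] by simp
    then show ?thesis using metric_matrix_spd(2)[OF g d, of "?J ?w - ?w'"] by fastforce
  qed
  then show ?thesis unfolding tvec_def by (intro ext) (auto simp: grad_def)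
qed


section \<open>Coordinate form of the equation\<close>

definition loc_G where
  "loc_G A g c y v w = v \<bullet> (metric_matrix A g c (chart_inv c y) *v w)"

definition loc_dG where
  "loc_dG A g c y e v w = (\<Sum>i\<in>UNIV. \<Sum>j\<in>UNIV.
     frechet_derivative (\<lambda>y. metric_matrix A g c (chart_inv c y) $ i $ j) (at y) e * v $ i * w $ j)"

definition loc_Gam where
  "loc_Gam A g c y = christoffel_map A g c (chart_inv c y)"

definition loc_dGam :: "('m, 'n::finite) chart set \<Rightarrow> ('m, 'n) metric \<Rightarrow> ('m, 'n) chart \<Rightarrow>
    real^'n \<Rightarrow> real^'n \<Rightarrow> real^'n \<Rightarrow> real^'n \<Rightarrow> real^'n" where
  "loc_dGam A g c y e v w = (\<chi> k. \<Sum>i\<in>UNIV. \<Sum>j\<in>UNIV.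
     frechet_derivative (\<lambda>y. christoffel A g c (chart_inv c y) k i j) (at y) e * v $ i * w $ j)"

definition loc_Q where
  "loc_Q A g c y p = matrix_inv (metric_matrix A g c (chart_inv c y)) *v p"

definition loc_dQ :: "('m, 'n::finite) chart set \<Rightarrow> ('m, 'n) metric \<Rightarrow> ('m, 'n) chart \<Rightarrow>
    real^'n \<Rightarrow> real^'n \<Rightarrow> real^'n \<Rightarrow> real^'n" where
  "loc_dQ A g c y e p = (\<chi> k. \<Sum>l\<in>UNIV.
     frechet_derivative (\<lambda>y. matrix_inv (metric_matrix A g c (chart_inv c y)) $ k $ l) (at y) e * p $ l)"

definition loc_dPsi where
  "loc_dPsi A \<psi> c = (\<lambda>(y, z, w). rhs_deriv A \<psi> c (chart_inv c y) z w)"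

lemma vec_bilinearI:
  fixes m :: "'n::finite \<Rightarrow> 'n \<Rightarrow> 'n \<Rightarrow> real"
  shows "bilinear (\<lambda>v w :: real^'n. (\<chi> k. \<Sum>i\<in>UNIV. \<Sum>j\<in>UNIV. m k i j * v $ i * w $ j) :: real^'n)"
  unfolding bilinear_def linear_iff
  by (auto simp: vec_eq_iff sum.distrib distrib_left distrib_right sum_distrib_left mult_ac)

text \<open>\<open>metric_deriv\<close> uses the derivative picked by
  \<open>frechet_derivative\<close> within the chart image, whereas \<open>h\<close> is built from
  the derivatives that \<open>Ck_on\<close> supplies. The two are compared in the interior, where
  uniqueness is immediate; \<open>h\<close> carries the regularity up to the boundary.\<close>

lemma christoffel_Ck:
  assumes atlas: "smooth_atlas X A" and g: "riemannian_metric A g" and c: "c \<in> A"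
  obtains h where "Ck_on (Suc 0) (chart_img c) h"
    "\<And>y. y \<in> interior (chart_img c) \<Longrightarrow> christoffel A g c (chart_inv c y) k i j = h y"
proof -
  let ?S = "chart_img c"
  define GM where "GM y = metric_matrix A g c (chart_inv c y)" for y
  have sm: "Ck_on q ?S (\<lambda>y. GM y $ i $ j)" for q i j
    using g c by (simp add: riemannian_metric_def smooth_on_def GM_def)
  have "\<forall>i j. \<exists>f'. (\<forall>y\<in>?S. ((\<lambda>y. GM y $ i $ j) has_derivative f' y) (at y within ?S)) \<and> (\<forall>v. Ck_on (Suc 0) ?S (\<lambda>y. f' y v))"
    using sm[of "Suc (Suc 0)"] unfolding Ck_on.simps(2)[of "Suc 0"] by simp
  then obtain D where D: "\<forall>i j. (\<forall>y\<in>?S. ((\<lambda>y. GM y $ i $ j) has_derivative D i j y) (at y within ?S)) \<and>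
      (\<forall>v. Ck_on (Suc 0) ?S (\<lambda>y. D i j y v))"
    by (simp only: choice_iff) (elim exE, rule that)
  have inv: "Ck_on (Suc 0) ?S (\<lambda>y. matrix_inv (GM y) $ k $ l)" for k l
    by (rule Ck_on_matrix_inv[OF sm])
      (unfold GM_def, rule metric_matrix_invertible[OF g c chart_basics(5)[OF atlas c]])
  define h where "h y = 1/2 * (\<Sum>l\<in>UNIV. matrix_inv (GM y) $ k $ l *
      (D j l y (axis i 1) + (D i l y (axis j 1) + - 1 * D i j y (axis l 1))))" for y
  have DC: "Ck_on (Suc 0) ?S (\<lambda>y. D i j y v)" for i j v using D by simp
  have "Ck_on (Suc 0) ?S h"
    unfolding h_def
    by (rule Ck_on_cmult, rule Ck_on_sum, rule Ck_on_mult[OF inv], rule Ck_on_add[OF DC], rule Ck_on_add[OF DC],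
        rule Ck_on_cmult[OF DC])
  moreover have "christoffel A g c (chart_inv c y) k i j = h y" if y: "y \<in> interior ?S" for y
  proof -
    have yS: "y \<in> ?S" using y interior_subset by auto
    have md: "metric_deriv A g c (chart_inv c y) l i j = D i j y (axis l 1)" for l i j
    proof -
      have "((\<lambda>y. GM y $ i $ j) has_derivative D i j y) (at y)"
        using D yS unfolding at_within_interior[OF y, symmetric] by simp
      then have "D i j y = frechet_derivative (\<lambda>y. GM y $ i $ j) (at y)" by (rule frechet_derivative_at)
      then show ?thesis
        using at_within_interior[OF y] chart_basics(6)[OF atlas c yS]
        by (simp add: metric_deriv_def partial_deriv_def GM_def[symmetric])
    qed
    show ?thesis unfolding christoffel_def md h_def GM_def[symmetric] by (simp add: add_diff_eq)
  qed
  ultimately show thesis by (rule that)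
qed

text \<open>Here \<open>a\<close> may lie on the edge of the chart image: ellipticity and the bounds
  on the metric, the Christoffel symbols and the inverse metric hold on a full ball around
  \<open>a\<close>, intersected with the interior. The constants therefore do not degenerate towards
  the boundary.\<close>

lemma chart_local_equation:
  fixes A :: "('m, 'n::finite) chart set"
  assumes atlas: "smooth_atlas X A" and g: "riemannian_metric A g" and \<Gamma>: "admissible_cone \<Gamma>"
    and f: "admissible_operator \<Gamma> f \<nu>0" and \<psi>: "admissible_rhs X A g \<psi> \<gamma> C\<psi>"
    and c: "c \<in> A" and a: "a \<in> chart_img c"
  obtains \<epsilon> c0 B where "0 < \<epsilon>" "local_equation (interior (chart_img c) \<inter> ball a \<epsilon>) (loc_G A g c) (loc_dG A g c)
    (loc_Gam A g c) (loc_dGam A g c) (loc_Q A g c) (loc_dQ A g c) (rhs_local A \<psi> c) (loc_dPsi A \<psi> c)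
    \<Gamma> f c0 B \<nu>0 \<gamma> C\<psi>"
proof -
  let ?S = "chart_img c"
  let ?F = "inf (nhds a) (principal (interior ?S))"
  define GM where "GM y = metric_matrix A g c (chart_inv c y)" for y
  define h1 where "h1 p y = GM y $ fst p $ snd p" for p :: "'n \<times> 'n" and y
  define h2 where "h2 p y = christoffel A g c (chart_inv c y) (fst p) (fst (snd p)) (snd (snd p))" for p :: "'n \<times> 'n \<times> 'n" and y
  define h3 where "h3 p y = matrix_inv (GM y) $ fst p $ snd p" for p :: "'n \<times> 'n" and y
  have dom: "chart_inv c y \<in> chart_dom c" if "y \<in> ?S" for y by (rule chart_basics(5)[OF atlas c that])
  have sm: "Ck_on q ?S (\<lambda>y. GM y $ i $ j)" for q i j
    using g c by (simp add: riemannian_metric_def smooth_on_def GM_def)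
  have inv: "Ck_on (Suc 0) ?S (\<lambda>y. matrix_inv (GM y) $ k $ l)" for k l
    by (rule Ck_on_matrix_inv[OF sm]) (unfold GM_def, rule metric_matrix_invertible[OF g c dom])
  have "\<exists>B. \<forall>\<^sub>F y in ?F. \<forall>p\<in>UNIV. C1_bounded_at B (h1 p) y"
    by (rule C1_bounded_family) (simp, rule C1_bounded[OF a], rule sm, simp add: h1_def)
  then obtain B1 where B1: "\<forall>\<^sub>F y in ?F. \<forall>p\<in>UNIV. C1_bounded_at B1 (h1 p) y" by (rule exE)
  have "\<exists>B. \<forall>\<^sub>F y in ?F. \<forall>p\<in>UNIV. C1_bounded_at B (h3 p) y"
    by (rule C1_bounded_family) (simp, rule C1_bounded[OF a], rule inv, simp add: h3_def)
  then obtain B3 where B3: "\<forall>\<^sub>F y in ?F. \<forall>p\<in>UNIV. C1_bounded_at B3 (h3 p) y" by (rule exE)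
  have "\<exists>B. \<forall>\<^sub>F y in ?F. \<forall>p\<in>UNIV. C1_bounded_at B (h2 p) y"
  proof (rule C1_bounded_family)
    fix p :: "'n \<times> 'n \<times> 'n"
    obtain h where h: "Ck_on (Suc 0) ?S h"
      "\<And>y. y \<in> interior ?S \<Longrightarrow> christoffel A g c (chart_inv c y) (fst p) (fst (snd p)) (snd (snd p)) = h y"
      by (rule christoffel_Ck[OF atlas g c]) (rule that)
    show "\<exists>B. \<forall>\<^sub>F y in ?F. C1_bounded_at B (h2 p) y"
      by (rule C1_bounded[OF a h(1)]) (simp add: h2_def h(2))
  qed simp
  then obtain B2 where B2: "\<forall>\<^sub>F y in ?F. \<forall>p\<in>UNIV. C1_bounded_at B2 (h2 p) y" by (rule exE)
  have cont: "continuous_on ?S (\<lambda>y. GM y $ i $ j)" for i j using sm[of 0] by simp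
  have posa: "0 < v \<bullet> (GM a *v v)" if "v \<noteq> 0" for v
    unfolding GM_def by (rule metric_matrix_spd(2)[OF g c dom[OF a] that])
  obtain c0 d where c0: "0 < c0" and d: "0 < d" "\<And>y v. y \<in> ?S \<Longrightarrow> dist y a < d \<Longrightarrow> c0 * (norm v)\<^sup>2 \<le> v \<bullet> (GM y *v v)"
    by (rule uniform_positivity_near[of a ?S GM, OF a cont]) (erule posa, rule that)
  have "\<forall>\<^sub>F y in ?F. (\<forall>p\<in>UNIV. C1_bounded_at B1 (h1 p) y) \<and> (\<forall>p\<in>UNIV. C1_bounded_at B2 (h2 p) y) \<and>
      (\<forall>p\<in>UNIV. C1_bounded_at B3 (h3 p) y)"
    by (intro eventually_conj B1 B2 B3)
  then obtain d' where d': "0 < d'" "\<And>y. dist y a < d' \<Longrightarrow> y \<in> interior ?S \<Longrightarrow>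
      (\<forall>p\<in>UNIV. C1_bounded_at B1 (h1 p) y) \<and> (\<forall>p\<in>UNIV. C1_bounded_at B2 (h2 p) y) \<and>
      (\<forall>p\<in>UNIV. C1_bounded_at B3 (h3 p) y)"
    unfolding eventually_inf_principal eventually_nhds_metric by auto
  define \<epsilon> where "\<epsilon> = min d d'"
  define b where "b = \<bar>B1\<bar> + \<bar>B2\<bar> + \<bar>B3\<bar>"
  let ?n = "real CARD('n)"
  \<comment> \<open>The double sum over components gives n^2, and the norm of a vector-valued form
    one more factor n.\<close>
  define B where "B = ?n ^ 3 * b + 1"
  let ?U = "interior ?S \<inter> ball a \<epsilon>"
  have n1: "1 \<le> ?n" by (simp add: Suc_leI)
  have b0: "0 \<le> b" "B1 \<le> b" "B2 \<le> b" "B3 \<le> b" by (auto simp: b_def)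
  have nB: "?n * b \<le> B" "?n\<^sup>2 * b \<le> B" "?n ^ 3 * b \<le> B"
  proof -
    have "?n ^ 1 \<le> ?n ^ 3" "?n\<^sup>2 \<le> ?n ^ 3" using n1 by (intro power_increasing; simp)+
    then show "?n * b \<le> B" "?n\<^sup>2 * b \<le> B" "?n ^ 3 * b \<le> B"
      using mult_right_mono[OF _ b0(1), of "?n ^ 1" "?n ^ 3"] mult_right_mono[OF _ b0(1), of "?n\<^sup>2" "?n ^ 3"]
      by (auto simp: B_def)
  qed
  have U: "y \<in> interior ?S" "y \<in> ?S" "dist y a < d" "dist y a < d'" if "y \<in> ?U" for y
    using that interior_subset by (auto simp: \<epsilon>_def dist_commute)
  have bd1: "C1_bounded_at b (\<lambda>y. GM y $ i $ j) y" if "y \<in> ?U" for y i j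
    using d'(2)[OF U(4,1)[OF that]] C1_bounded_at_mono[OF b0(2), of "h1 (i, j)" y] by (simp add: h1_def[abs_def])
  have bd2: "C1_bounded_at b (\<lambda>y. christoffel A g c (chart_inv c y) k i j) y" if "y \<in> ?U" for y k i j
    using d'(2)[OF U(4,1)[OF that]] C1_bounded_at_mono[OF b0(3), of "h2 (k, i, j)" y] by (simp add: h2_def[abs_def])
  have bd3: "C1_bounded_at b (\<lambda>y. matrix_inv (GM y) $ k $ l) y" if "y \<in> ?U" for y k l
    using d'(2)[OF U(4,1)[OF that]] C1_bounded_at_mono[OF b0(4), of "h3 (k, l)" y] by (simp add: h3_def[abs_def])
  note bdD = bd1[unfolded C1_bounded_at_def] bd2[unfolded C1_bounded_at_def] bd3[unfolded C1_bounded_at_def]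
  have be: "0 \<le> b * norm e" for e :: "real^'n" using b0 by simp
  have up: "?n\<^sup>2 * (b * norm e) * norm v * norm w \<le> B * norm e * norm v * norm w" for e v w :: "real^'n"
    using nB(2) mult_right_mono[OF nB(2), of "norm e * norm v * norm w"] by (simp add: mult_ac)
  have rhs: "0 < \<gamma>" "\<gamma> < 1" "0 < C\<psi>" "Ck_on 3 (?S \<times> UNIV \<times> UNIV) (rhs_local A \<psi> c)"
    using \<psi> c unfolding admissible_rhs_def by auto
  have "local_equation ?U (loc_G A g c) (loc_dG A g c) (loc_Gam A g c) (loc_dGam A g c) (loc_Q A g c) (loc_dQ A g c)
      (rhs_local A \<psi> c) (loc_dPsi A \<psi> c) \<Gamma> f c0 B \<nu>0 \<gamma> C\<psi>"
  proof (rule local_equation.intro)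
    show "open ?U" by (intro open_Int open_interior open_ball)
    show "1 \<le> B" using b0 by (simp add: B_def)
    show "spd_form (loc_G A g c y)" if "y \<in> ?U" for y
      unfolding loc_G_def by (rule spd_form_matrix[OF metric_matrix_spd[OF g c dom[OF U(2)[OF that]]]])
    show "c0 * (norm v)\<^sup>2 \<le> loc_G A g c y v v" if "y \<in> ?U" for y v
      unfolding loc_G_def GM_def[symmetric] by (rule d(2)[OF U(2,3)[OF that]])
    show "\<bar>loc_G A g c y v w\<bar> \<le> B * norm v * norm w" if "y \<in> ?U" for y v w
    proof -
      have "\<bar>loc_G A g c y v w\<bar> \<le> ?n\<^sup>2 * b * norm v * norm w"
        unfolding loc_G_def GM_def[symmetric] matrix_form_sum by (rule double_sum_bound) (simp add: bdD(1)[OF that])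
      also have "\<dots> \<le> B * norm v * norm w" using nB(2) by (intro mult_right_mono) auto
      finally show ?thesis .
    qed
    show "((\<lambda>y. loc_G A g c y v w) has_derivative (\<lambda>e. loc_dG A g c y e v w)) (at y)" if "y \<in> ?U" for y v w
      unfolding loc_G_def loc_dG_def GM_def[symmetric] matrix_form_sum
      by (intro has_derivative_sum has_derivative_mult_left) (simp add: bdD(1)[OF that])
    show "\<bar>loc_dG A g c y e v w\<bar> \<le> B * norm e * norm v * norm w" if "y \<in> ?U" for y e v w
    proof -
      have "\<bar>loc_dG A g c y e v w\<bar> \<le> ?n\<^sup>2 * (b * norm e) * norm v * norm w"
        unfolding loc_dG_def GM_def[symmetric] by (rule double_sum_bound) (simp add: bdD(1)[OF that])
      then show ?thesis using up order_trans by blast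
    qed
    show "bilinear (loc_Gam A g c y)" for y
      unfolding loc_Gam_def christoffel_map_def[abs_def] by (rule vec_bilinearI)
    show "loc_Gam A g c y v w = loc_Gam A g c y w v" if "y \<in> ?U" for y v w
    proof -
      have "christoffel A g c (chart_inv c y) k i j = christoffel A g c (chart_inv c y) k j i" for k i j
        by (rule christoffel_torsion_free[OF g c dom[OF U(2)[OF that]]])
      then have "(\<Sum>i\<in>UNIV. \<Sum>j\<in>UNIV. christoffel A g c (chart_inv c y) k i j * v $ i * w $ j)
          = (\<Sum>i\<in>UNIV. \<Sum>j\<in>UNIV. christoffel A g c (chart_inv c y) k j i * w $ j * v $ i)" for k
        by (intro sum.cong refl) (simp only: mult_ac)
      also have "(\<Sum>i\<in>UNIV. \<Sum>j\<in>UNIV. christoffel A g c (chart_inv c y) k j i * w $ j * v $ i)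
          = (\<Sum>j\<in>UNIV. \<Sum>i\<in>UNIV. christoffel A g c (chart_inv c y) k j i * w $ j * v $ i)" for k
        by (rule sum.swap)
      finally show ?thesis by (simp add: loc_Gam_def christoffel_map_def vec_eq_iff)
    qed
    show "norm (loc_Gam A g c y v w) \<le> B * norm v * norm w" if "y \<in> ?U" for y v w
    proof -
      have "norm (loc_Gam A g c y v w) \<le> ?n * (?n\<^sup>2 * b * norm v * norm w)"
        unfolding loc_Gam_def christoffel_map_def
        by (rule norm_vec_bound, unfold vec_lambda_beta, rule double_sum_bound) (simp add: bdD(2)[OF that])
      also have "\<dots> = (?n ^ 3 * b) * norm v * norm w" by (simp add: power2_eq_square power3_eq_cube)
      also have "\<dots> \<le> B * norm v * norm w" using nB(3) by (intro mult_right_mono) auto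
      finally show ?thesis .
    qed
    show "((\<lambda>y. loc_Gam A g c y v w) has_derivative (\<lambda>e. loc_dGam A g c y e v w)) (at y)" if "y \<in> ?U" for y v w
      unfolding loc_Gam_def loc_dGam_def christoffel_map_def
      by (rule has_derivative_vec, unfold vec_lambda_beta, intro has_derivative_sum has_derivative_mult_left)
        (simp add: bdD(2)[OF that])
    show "norm (loc_dGam A g c y e v w) \<le> B * norm e * norm v * norm w" if "y \<in> ?U" for y e v w
    proof -
      have "norm (loc_dGam A g c y e v w) \<le> ?n * (?n\<^sup>2 * (b * norm e) * norm v * norm w)"
        unfolding loc_dGam_def
        by (rule norm_vec_bound, unfold vec_lambda_beta, rule double_sum_bound) (simp add: bdD(2)[OF that])
      also have "\<dots> = (?n ^ 3 * b) * (norm e * norm v * norm w)" by (simp add: power2_eq_square power3_eq_cube)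
      also have "\<dots> \<le> B * (norm e * norm v * norm w)" using nB(3) by (intro mult_right_mono) auto
      finally show ?thesis by (simp only: mult.assoc)
    qed
    show "linear (loc_Q A g c y)" for y
      unfolding loc_Q_def[abs_def] by (rule matrix_vector_mul_linear)
    show "loc_G A g c y (loc_Q A g c y p) v = p \<bullet> v" if "y \<in> ?U" for y p v
      unfolding loc_G_def loc_Q_def by (rule matrix_inv_form[OF g c dom[OF U(2)[OF that]]])
    show "linear (loc_dQ A g c y e)" for y e
      unfolding loc_dQ_def[abs_def] linear_iff
      by (auto simp: vec_eq_iff sum.distrib distrib_left distrib_right sum_distrib_left mult_ac)
    show "((\<lambda>y. loc_Q A g c y p) has_derivative (\<lambda>e. loc_dQ A g c y e p)) (at y)" if "y \<in> ?U" for y p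
      unfolding loc_Q_def loc_dQ_def GM_def[symmetric] matrix_vector_mult_def
      by (rule has_derivative_vec, unfold vec_lambda_beta, intro has_derivative_sum has_derivative_mult_left)
        (simp add: bdD(3)[OF that])
    show "norm (loc_dQ A g c y e p) \<le> B * norm e * norm p" if "y \<in> ?U" for y e p
    proof -
      have "\<bar>\<Sum>l\<in>UNIV. frechet_derivative (\<lambda>y. matrix_inv (GM y) $ k $ l) (at y) e * p $ l\<bar> \<le> ?n * (b * norm e * norm p)" for k
      proof -
        have "\<bar>\<Sum>l\<in>UNIV. frechet_derivative (\<lambda>y. matrix_inv (GM y) $ k $ l) (at y) e * p $ l\<bar>
            \<le> (\<Sum>l\<in>(UNIV :: 'n set). b * norm e * norm p)"
          by (intro order_trans[OF sum_abs] sum_mono, unfold abs_mult, intro mult_mono)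
            (auto simp: bdD(3)[OF that] component_le_norm_cart be)
        then show ?thesis by simp
      qed
      then have "norm (loc_dQ A g c y e p) \<le> ?n * (?n * (b * norm e * norm p))"
        unfolding loc_dQ_def GM_def[symmetric] by (intro norm_vec_bound) simp
      also have "\<dots> = (?n\<^sup>2 * b) * (norm e * norm p)" by (simp add: power2_eq_square)
      also have "\<dots> \<le> B * (norm e * norm p)" using nB(2) by (intro mult_right_mono) auto
      finally show ?thesis by (simp only: mult.assoc)
    qed
    show "(rhs_local A \<psi> c has_derivative loc_dPsi A \<psi> c (y, z, w)) (at (y, z, w))" if "y \<in> ?U" for y z w
    proof -
      have i: "(y, z, w) \<in> interior (?S \<times> (UNIV :: real set) \<times> (UNIV :: (real^'n) set))"
        using U(1)[OF that] by (simp add: interior_Times)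
      have "Ck_on (Suc (Suc (Suc 0))) (?S \<times> UNIV \<times> UNIV) (rhs_local A \<psi> c)"
        using rhs(4) by (simp add: numeral_3_eq_3)
      then have "rhs_local A \<psi> c differentiable (at (y, z, w) within (?S \<times> UNIV \<times> UNIV))"
        by (rule Ck_on_Suc_differentiable) (use U(2)[OF that] in simp)
      then have "(rhs_local A \<psi> c has_derivative
          frechet_derivative (rhs_local A \<psi> c) (at (y, z, w) within (?S \<times> UNIV \<times> UNIV))) (at (y, z, w))"
        unfolding frechet_derivative_works at_within_interior[OF i] .
      then show ?thesis
        using chart_basics(6)[OF atlas c U(2)[OF that]] by (simp add: loc_dPsi_def rhs_deriv_def)
    qed
    show "\<bar>loc_dPsi A \<psi> c (y, z, w) (E i, 0, - loc_Gam A g c y (E i) w)\<bar>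
        + \<bar>loc_dPsi A \<psi> c (y, z, w) (0, 1, 0)\<bar> * sqrt (loc_G A g c y w w)
        + \<bar>loc_dPsi A \<psi> c (y, z, w) (0, 0, E l)\<bar> * (sqrt (loc_G A g c y w w))\<^sup>2
        \<le> C\<psi> * sqrt (loc_G A g c y w w) powr (2 + \<gamma>)"
      if y: "y \<in> ?U" and E: "orthonormal_wrt (loc_G A g c y) E" for y z w and E :: "'n \<Rightarrow> real^'n" and i l
    proof -
      have x: "chart_inv c y \<in> chart_dom c" by (rule dom[OF U(2)[OF y]])
      have "orthonormal_frame A g c (chart_inv c y) E"
        using E unfolding orthonormal_wrt_def orthonormal_frame_def loc_G_def metric_form[OF g c x] .
      then show ?thesis
        using \<psi> c x unfolding admissible_rhs_def
        by (auto simp: loc_dPsi_def loc_G_def metric_form[OF g c x] loc_Gam_def gnorm_def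
            rhs_deriv_x_def rhs_deriv_z_def rhs_deriv_p_def)
    qed
  qed (use \<Gamma> f rhs c0 in auto)
  moreover have "0 < \<epsilon>" using d d' by (simp add: \<epsilon>_def)
  ultimately show thesis using that by simp
qed


section \<open>Geodesic balls in charts\<close>

text \<open>As \<tau> is differentiable only within \<open>W\<close>, the chain rule is used within
  the image of the curve. Continuity of the derivative of \<tau> is known direction by direction,
  hence the expansion in a basis.\<close>

lemma Ck1_curve:
  fixes \<tau> :: "'a::euclidean_space \<Rightarrow> 'b::real_normed_vector" and \<gamma> :: "real \<Rightarrow> 'a"
  assumes \<tau>: "Ck_on (Suc 0) W \<tau>" and \<gamma>: "\<And>t. (\<gamma> has_vector_derivative \<gamma>' t) (at t)"
    and \<gamma>': "continuous_on UNIV \<gamma>'" and sub: "\<And>t. t \<in> T \<Longrightarrow> \<gamma> t \<in> W"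
  shows "Ck_on (Suc 0) T (\<tau> \<circ> \<gamma>)"
proof -
  from \<tau> obtain \<tau>' where \<tau>': "\<forall>y\<in>W. (\<tau> has_derivative \<tau>' y) (at y within W)" "\<forall>v. continuous_on W (\<lambda>y. \<tau>' y v)"
    by auto
  have \<gamma>c: "continuous_on T \<gamma>"
    by (intro continuous_at_imp_continuous_on ballI has_vector_derivative_continuous[OF \<gamma>])
  have "(\<tau> \<circ> \<gamma> has_derivative \<tau>' (\<gamma> t) \<circ> (\<lambda>s. s *\<^sub>R \<gamma>' t)) (at t within T)" if t: "t \<in> T" for t
  proof -
    have 1: "(\<gamma> has_derivative (\<lambda>s. s *\<^sub>R \<gamma>' t)) (at t within T)"
      using has_vector_derivative_at_within[OF \<gamma>, of t T] unfolding has_vector_derivative_def .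
    have 2: "(\<tau> has_derivative \<tau>' (\<gamma> t)) (at (\<gamma> t) within W)" using \<tau>'(1) sub[OF t] by simp
    have "\<gamma> ` T \<subseteq> W" using sub by auto
    with 2 have 3: "(\<tau> has_derivative \<tau>' (\<gamma> t)) (at (\<gamma> t) within \<gamma> ` T)" by (rule has_derivative_subset)
    show ?thesis by (rule diff_chain_within[OF 1 3])
  qed
  moreover have "continuous_on T (\<lambda>t. (\<tau>' (\<gamma> t) \<circ> (\<lambda>s. s *\<^sub>R \<gamma>' t)) s)" for s
  proof -
    have "continuous_on T (\<lambda>t. \<tau>' (\<gamma> t) b)" for b
      by (rule continuous_on_compose2[OF \<tau>'(2)[rule_format] \<gamma>c]) (use sub in auto)
    then have "continuous_on T (\<lambda>t. \<Sum>b\<in>Basis. ((s *\<^sub>R \<gamma>' t) \<bullet> b) *\<^sub>R \<tau>' (\<gamma> t) b)"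
      using continuous_on_subset[OF \<gamma>' subset_UNIV, of T] by (intro continuous_intros)
    moreover have "(\<Sum>b\<in>Basis. ((s *\<^sub>R \<gamma>' t) \<bullet> b) *\<^sub>R \<tau>' (\<gamma> t) b) = (\<tau>' (\<gamma> t) \<circ> (\<lambda>s. s *\<^sub>R \<gamma>' t)) s" if "t \<in> T" for t
    proof -
      have l: "linear (\<tau>' (\<gamma> t))" using has_derivative_linear[OF bspec[OF \<tau>'(1) sub[OF that]]] .
      have "(\<Sum>b\<in>Basis. ((s *\<^sub>R \<gamma>' t) \<bullet> b) *\<^sub>R \<tau>' (\<gamma> t) b) = \<tau>' (\<gamma> t) (\<Sum>b\<in>Basis. ((s *\<^sub>R \<gamma>' t) \<bullet> b) *\<^sub>R b)"
        unfolding linear_sum[OF l] linear_cmul[OF l] ..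
      then show ?thesis by (simp add: euclidean_representation del: inner_scaleR_left)
    qed
    ultimately show ?thesis by (rule continuous_on_eq)
  qed
  ultimately show ?thesis unfolding Ck_on.simps
    by (intro exI[of _ "\<lambda>t. \<tau>' (\<gamma> t) \<circ> (\<lambda>s. s *\<^sub>R \<gamma>' t)"]) simp
qed

text \<open>Meant for the speed of a curve: at 0 and 1 the two-sided derivative in
  \<open>velocity\<close> carries no information, so the endpoints are left out, and a function that
  is not integrable has integral 0 by convention, which satisfies the bound as well.\<close>

lemma integral_unit_le:
  fixes h :: "real \<Rightarrow> real"
  assumes "\<And>t. 0 < t \<Longrightarrow> t < 1 \<Longrightarrow> h t \<le> C" "0 \<le> C"
  shows "integral {0..1} h \<le> C"
proof (cases "h integrable_on {0<..<1}")
  case True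
  have "integral {0..1} h = integral {0<..<1} h" by (simp only: integral_open_interval_real)
  also have "\<dots> \<le> integral {0<..<1::real} (\<lambda>_. C)"
  proof (rule integral_le[OF True])
    show "(\<lambda>_. C) integrable_on {0<..<1::real}" unfolding integrable_on_open_interval_real by (rule integrable_const_ivl)
  qed (use assms(1) in simp)
  also have "\<dots> = integral {0..1::real} (\<lambda>_. C)" by (simp only: integral_open_interval_real)
  finally show ?thesis by simp
next
  case False
  then show ?thesis
    using assms(2) integral_open_interval_real[of 0 1 h] by (simp add: not_integrable_integral)
qed

text \<open>A point of the half-space coordinates near \<open>y0\<close> is joined to \<open>y0\<close> by a curve that bends into the
  open half space, so that its interior points are interior points of the manifold and no
  derivatives at the boundary are involved.\<close>

lemma chart_point_in_geodesic_ball: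
  fixes A :: "('m, 'n::finite) chart set"
  assumes atlas: "smooth_atlas X A" and g: "riemannian_metric A g" and c: "c \<in> A" and x0: "x0 \<in> chart_dom c"
    and half: "chart_img c = {y. 0 \<le> y $ k} \<inter> T" "open T" and e: "0 < e" "ball a e \<subseteq> T"
    and y0: "dist (chart_map c x0) a < e / 2" and B: "1 \<le> B"
    and GB: "\<And>y v. y \<in> interior (chart_img c) \<inter> ball a e \<Longrightarrow> v \<bullet> (metric_matrix A g c (chart_inv c y) *v v) \<le> B * (norm v)\<^sup>2"
    and r: "0 < r" "r < 1" and \<delta>: "0 < \<delta>" "\<delta> \<le> e / 8" "\<delta> \<le> 1 / (4 * B)"
    and z: "z \<in> cball (chart_map c x0) (\<delta> * r)" "0 \<le> z $ k"
  shows "chart_inv c z \<in> geodesic_ball X A g x0 r" "z \<in> chart_img c"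
proof -
  let ?S = "chart_img c"
  define y0 where "y0 = chart_map c x0"
  define s where "s = \<delta> * r"
  have s: "0 < s" using \<delta> r by (simp add: s_def)
  have "\<delta> * r \<le> \<delta> * 1" using \<delta> r by (intro mult_left_mono) auto
  then have se: "s \<le> e / 8" unfolding s_def using \<delta>(2) by linarith
  define \<gamma> where "\<gamma> t = y0 + t *\<^sub>R (z - y0) + (t * (1 - t) * s) *\<^sub>R axis k 1" for t
  define \<gamma>' where "\<gamma>' t = (z - y0) + ((1 - 2 * t) * s) *\<^sub>R axis k 1" for t
  have d\<gamma>: "(\<gamma> has_vector_derivative \<gamma>' t) (at t)" for t
    unfolding \<gamma>_def \<gamma>'_def has_vector_derivative_def
    by (auto intro!: derivative_eq_intros simp: algebra_simps)
  have c\<gamma>': "continuous_on UNIV \<gamma>'" unfolding \<gamma>'_def by (intro continuous_intros)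
  have zy: "norm (z - y0) \<le> s" using z(1) by (simp add: y0_def s_def dist_norm norm_minus_commute)
  have y0S: "y0 \<in> ?S" unfolding y0_def by (rule chart_basics(4)[OF atlas c x0])
  then have y0k: "0 \<le> y0 $ k" using half by auto
  have \<gamma>k: "\<gamma> t $ k = (1 - t) * y0 $ k + t * z $ k + t * (1 - t) * s" for t
    by (simp add: \<gamma>_def algebra_simps)
  have tt: "0 \<le> t * (1 - t)" "t * (1 - t) \<le> 1" if "0 \<le> t" "t \<le> 1" for t :: real
    using that mult_le_one[of t "1 - t"] by auto
  have \<gamma>near: "\<gamma> t \<in> ball a e" if t: "0 \<le> t" "t \<le> 1" for t
  proof -
    have "norm (\<gamma> t - y0) \<le> norm (t *\<^sub>R (z - y0)) + norm ((t * (1 - t) * s) *\<^sub>R (axis k 1 :: real^'n))"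
      unfolding \<gamma>_def by (metis add.assoc add_diff_cancel_left' norm_triangle_ineq)
    also have "\<dots> \<le> s + s"
    proof (rule add_mono)
      have "t * norm (z - y0) \<le> 1 * s" using t zy by (intro mult_mono) auto
      then show "norm (t *\<^sub>R (z - y0)) \<le> s" using t by simp
      have "t * (1 - t) * s \<le> 1 * s" using tt[OF t] s by (intro mult_right_mono) auto
      then show "norm ((t * (1 - t) * s) *\<^sub>R (axis k 1 :: real^'n)) \<le> s" using tt(1)[OF t] s t by simp
    qed
    finally have "dist (\<gamma> t) y0 \<le> e / 4" using se by (simp add: dist_norm)
    then have "dist (\<gamma> t) a < e" using dist_triangle[of "\<gamma> t" a y0] y0 e(1) by (simp add: y0_def)
    then show ?thesis by (simp add: dist_commute)
  qed
  have \<gamma>S: "\<gamma> t \<in> ?S" if t: "0 \<le> t" "t \<le> 1" for t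
  proof -
    have "0 \<le> \<gamma> t $ k" unfolding \<gamma>k using t y0k z(2) s tt(1)[OF t] by (intro add_nonneg_nonneg mult_nonneg_nonneg) auto
    then show ?thesis unfolding half(1) using \<gamma>near[OF t] e(2) by auto
  qed
  have \<gamma>int: "\<gamma> t \<in> interior ?S" if t: "0 < t" "t < 1" for t
  proof (rule interiorI)
    show "open ({y. 0 < y $ k} \<inter> T)" by (intro open_Int open_halfspace_component_gt_cart half(2))
    have "0 \<le> (1 - t) * y0 $ k + t * z $ k" using t y0k z(2) by (intro add_nonneg_nonneg mult_nonneg_nonneg) auto
    moreover have "0 < t * (1 - t) * s" using t s by simp
    ultimately have "0 < \<gamma> t $ k" unfolding \<gamma>k by linarith
    then show "\<gamma> t \<in> {y. 0 < y $ k} \<inter> T" using \<gamma>near[of t] e(2) t by auto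
    show "{y. 0 < y $ k} \<inter> T \<subseteq> ?S" unfolding half(1) by auto
  qed
  define \<sigma> where "\<sigma> = chart_inv c \<circ> \<gamma>"
  have \<gamma>01: "\<gamma> 0 = y0" "\<gamma> 1 = z" by (simp_all add: \<gamma>_def)
  show zS: "z \<in> ?S" using \<gamma>S[of 1] \<gamma>01 by simp
  have \<sigma>01: "\<sigma> 0 = x0" "\<sigma> 1 = chart_inv c z"
    using chart_basics(3)[OF atlas c x0] by (simp_all add: \<sigma>_def \<gamma>01 y0_def)
  have "continuous_on {0..1} \<gamma>" unfolding \<gamma>_def by (intro continuous_intros)
  then have "continuous_map (top_of_set {0..1}) (top_of_set ?S) \<gamma>"
    using \<gamma>S by (auto simp: continuous_map_subtopology_eu)
  then have cont: "continuous_map (top_of_set {0..1}) X \<sigma>"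
    unfolding \<sigma>_def using chart_basics(9)[OF atlas c] by (rule continuous_map_compose)
  have pieces: "Ck_on 1 {t \<in> {p..q}. \<sigma> t \<in> chart_dom d} (chart_map d \<circ> \<sigma>)"
    if "0 \<le> p" "q \<le> 1" and d: "d \<in> A" for p q d
  proof -
    have "smooth_on (chart_map c ` (chart_dom c \<inter> chart_dom d)) (chart_map d \<circ> chart_inv c)"
      using atlas c d by (simp add: smooth_atlas_def)
    then have "Ck_on (Suc 0) (chart_map c ` (chart_dom c \<inter> chart_dom d)) (chart_map d \<circ> chart_inv c)"
      unfolding smooth_on_def by (rule spec)
    then have "Ck_on (Suc 0) {t \<in> {p..q}. \<sigma> t \<in> chart_dom d} ((chart_map d \<circ> chart_inv c) \<circ> \<gamma>)"
    proof (rule Ck1_curve[OF _ d\<gamma> c\<gamma>'])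
      fix t assume "t \<in> {t \<in> {p..q}. \<sigma> t \<in> chart_dom d}"
      then have "0 \<le> t" "t \<le> 1" and td: "\<sigma> t \<in> chart_dom d" using that by auto
      then have tS: "\<gamma> t \<in> ?S" using \<gamma>S by simp
      then have "\<sigma> t \<in> chart_dom c \<inter> chart_dom d" using chart_basics(5)[OF atlas c tS] td by (simp add: \<sigma>_def)
      moreover have "\<gamma> t = chart_map c (\<sigma> t)" using chart_basics(6)[OF atlas c tS] by (simp add: \<sigma>_def)
      ultimately show "\<gamma> t \<in> chart_map c ` (chart_dom c \<inter> chart_dom d)" by (rule rev_image_eqI)
    qed
    then show ?thesis by (simp add: \<sigma>_def comp_assoc)
  qed
  have pw: "piecewise_C1_curve X A \<sigma>"
    unfolding piecewise_C1_curve_def using cont pieces by (intro conjI exI[of _ "{}"]) auto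
  have "gnorm g (\<sigma> t) (velocity A \<sigma> t) \<le> B * (2 * s)" if t: "0 < t" "t < 1" for t
  proof -
    have tS: "\<gamma> t \<in> ?S" using \<gamma>S t by simp
    have x: "\<sigma> t \<in> chart_dom c" using chart_basics(5)[OF atlas c tS] by (simp add: \<sigma>_def)
    have cx: "chart_map c (\<sigma> t) = \<gamma> t" using chart_basics(6)[OF atlas c tS] by (simp add: \<sigma>_def)
    have "vector_derivative (chart_map d \<circ> \<sigma>) (at t) = coord_change c d (\<sigma> t) (\<gamma>' t)"
      if d: "d \<in> A" "\<sigma> t \<in> chart_dom d" for d
    proof -
      have D: "((chart_map d \<circ> chart_inv c) has_derivative coord_change c d (\<sigma> t)) (at (\<gamma> t))"
        using transition_differentiable[OF atlas c d(1) x d(2)] \<gamma>int[OF t] by (simp add: cx)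
      have "((chart_map d \<circ> chart_inv c) \<circ> \<gamma> has_derivative coord_change c d (\<sigma> t) \<circ> (\<lambda>s. s *\<^sub>R \<gamma>' t)) (at t)"
        using d\<gamma> D unfolding has_vector_derivative_def by (rule diff_chain_at)
      then have "(chart_map d \<circ> \<sigma> has_vector_derivative coord_change c d (\<sigma> t) (\<gamma>' t)) (at t)"
        unfolding has_vector_derivative_def \<sigma>_def comp_assoc
        by (simp add: o_def linear_cmul[OF has_derivative_linear[OF D], unfolded \<sigma>_def o_def])
      then show ?thesis by (rule vector_derivative_at)
    qed
    then have vel: "velocity A \<sigma> t = tvec A c (\<sigma> t) (\<gamma>' t)" by (auto simp: velocity_def tvec_def)
    have n: "norm (\<gamma>' t) \<le> 2 * s"
    proof -
      have "norm (\<gamma>' t) \<le> norm (z - y0) + norm (((1 - 2 * t) * s) *\<^sub>R (axis k 1 :: real^'n))"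
        unfolding \<gamma>'_def by (rule norm_triangle_ineq)
      also have "norm (((1 - 2 * t) * s) *\<^sub>R (axis k 1 :: real^'n)) = \<bar>1 - 2 * t\<bar> * s" using s by (simp add: abs_mult)
      also have "\<dots> \<le> 1 * s" using t s by (intro mult_right_mono) auto
      finally show ?thesis using zy by simp
    qed
    have "g (\<sigma> t) (tvec A c (\<sigma> t) (\<gamma>' t)) (tvec A c (\<sigma> t) (\<gamma>' t)) \<le> B * (norm (\<gamma>' t))\<^sup>2"
      using GB[of "\<gamma> t" "\<gamma>' t"] \<gamma>int[OF t] \<gamma>near[of t] t metric_form[OF g c x] by (simp add: \<sigma>_def)
    \<comment> \<open>Passing from \<open>B\<close> to \<open>B\<^sup>2\<close>, possible since
      \<open>1 \<le> B\<close>, lets the square root be taken exactly.\<close>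
    also have "\<dots> \<le> B\<^sup>2 * (norm (\<gamma>' t))\<^sup>2" using B by (intro mult_right_mono self_le_power) auto
    finally have "gnorm g (\<sigma> t) (velocity A \<sigma> t) \<le> sqrt ((B * norm (\<gamma>' t))\<^sup>2)"
      unfolding gnorm_def vel power_mult_distrib by (rule real_sqrt_le_mono)
    also have "\<dots> = B * norm (\<gamma>' t)" using B by simp
    also have "\<dots> \<le> B * (2 * s)" using n B by (intro mult_left_mono) auto
    finally show ?thesis .
  qed
  then have len: "curve_length A g \<sigma> \<le> B * (2 * s)"
    unfolding curve_length_def using B s by (intro integral_unit_le) auto
  \<comment> \<open>The origin of \<open>1 / (4 * B)\<close>: the length is at most 2 B \<delta> r,
    hence at most r / 2.\<close>
  have "B * \<delta> \<le> 1 / 4" using \<delta>(3) B by (simp add: field_simps)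
  then have "B * \<delta> * (2 * r) \<le> 1 / 4 * (2 * r)" using r by (intro mult_right_mono) auto
  then have "B * (2 * s) < r" using r by (simp add: s_def mult_ac)
  then have lt: "curve_length A g \<sigma> < r" using len by simp
  have "riemannian_dist X A g x0 (chart_inv c z) \<le> ereal (curve_length A g \<sigma>)"
    unfolding riemannian_dist_def using pw \<sigma>01 by (intro INF_lower) simp
  also have "\<dots> < ereal r" using lt by simp
  finally have "riemannian_dist X A g x0 (chart_inv c z) < ereal r" .
  moreover have "chart_inv c z \<in> topspace X"
    using chart_basics(5)[OF atlas c zS] openin_subset[OF chart_basics(1)[OF atlas c]] by auto
  ultimately show "chart_inv c z \<in> geodesic_ball X A g x0 r" by (simp add: geodesic_ball_def)
qed

text \<open>The part of the coordinate ball in the half space lies in the geodesic ball and so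
  consists of interior points. A point with \<open>k\<close>-th coordinate 0 is not one of them,
  because the chart image lies on one side of it. Hence the coordinate ball misses the hyperplane
  and, being convex with centre in the half space, lies on the positive side.\<close>

lemma chart_ball_in_interior:
  fixes A :: "('m, 'n::finite) chart set"
  assumes atlas: "smooth_atlas X A" and g: "riemannian_metric A g" and c: "c \<in> A" and x0: "x0 \<in> chart_dom c"
    and half: "chart_img c = {y. 0 \<le> y $ k} \<inter> T" "open T" and e: "0 < e" "ball a e \<subseteq> T"
    and y0: "dist (chart_map c x0) a < e / 2" and B: "1 \<le> B"
    and GB: "\<And>y v. y \<in> interior (chart_img c) \<inter> ball a e \<Longrightarrow> v \<bullet> (metric_matrix A g c (chart_inv c y) *v v) \<le> B * (norm v)\<^sup>2"
    and r: "0 < r" "r < 1" and \<delta>: "0 < \<delta>" "\<delta> \<le> e / 8" "\<delta> \<le> 1 / (4 * B)"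
    and ball: "geodesic_ball X A g x0 r \<subseteq> manifold_interior X A"
  shows "cball (chart_map c x0) (\<delta> * r) \<subseteq> interior (chart_img c) \<inter> ball a e"
proof
  let ?S = "chart_img c"
  define y where "y = chart_map c x0"
  fix z assume z: "z \<in> cball (chart_map c x0) (\<delta> * r)"
  note reach = chart_point_in_geodesic_ball[OF atlas g c x0 half e y0 B GB r \<delta>]
  have reach_int: "w \<in> interior ?S" if w: "w \<in> cball (chart_map c x0) (\<delta> * r)" "0 \<le> w $ k" for w
  proof -
    have "chart_inv c w \<in> manifold_interior X A" using reach(1)[OF _ w] ball by auto
    then have "interior_point A (chart_inv c w)" by (rule manifold_interiorD)
    moreover have wS: "w \<in> ?S" by (rule reach(2)[OF _ w])
    ultimately show ?thesis
      using c chart_basics(5,6)[OF atlas c wS] unfolding interior_point_def by metis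
  qed
  have not0: "w $ k \<noteq> 0" if w: "w \<in> cball (chart_map c x0) (\<delta> * r)" for w
  proof
    assume w0: "w $ k = 0"
    then have "w \<in> interior ?S" using reach_int[OF w] by simp
    then obtain \<epsilon> where \<epsilon>: "0 < \<epsilon>" "ball w \<epsilon> \<subseteq> ?S" by (auto simp: mem_interior)
    have "w - (\<epsilon> / 2) *\<^sub>R axis k 1 \<in> ball w \<epsilon>" using \<epsilon>(1) by (simp add: dist_norm)
    then have "w - (\<epsilon> / 2) *\<^sub>R axis k 1 \<in> ?S" using \<epsilon>(2) by blast
    then have "0 \<le> (w - (\<epsilon> / 2) *\<^sub>R axis k 1) $ k" unfolding half(1) by blast
    then show False using w0 \<epsilon>(1) by simp
  qed
  have yk: "0 \<le> y $ k" using chart_basics(4)[OF atlas c x0] half(1) by (auto simp: y_def)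
  have zk: "0 \<le> z $ k"
  proof (rule ccontr)
    assume neg: "\<not> 0 \<le> z $ k"
    \<comment> \<open>The parameter at which the segment from the centre to \<open>z\<close> meets
      the hyperplane.\<close>
    define t where "t = y $ k / (y $ k - z $ k)"
    have t: "0 \<le> t" "t \<le> 1" using yk neg by (auto simp: t_def)
    have "y + t *\<^sub>R (z - y) \<in> cball (chart_map c x0) (\<delta> * r)"
    proof -
      have "t * norm (z - y) \<le> 1 * (\<delta> * r)"
        using t z by (intro mult_mono) (auto simp: y_def dist_norm norm_minus_commute)
      then show ?thesis using t by (simp add: y_def dist_norm)
    qed
    moreover have "(y + t *\<^sub>R (z - y)) $ k = 0" using yk neg by (simp add: t_def field_simps)
    ultimately show False using not0 by blast
  qed
  have "z \<in> ball a e"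
  proof -
    have "\<delta> * r \<le> \<delta> * 1" using \<delta> r by (intro mult_left_mono) auto
    then have "dist (chart_map c x0) z \<le> e / 8" using z \<delta>(2) by simp
    then show ?thesis using dist_triangle[of a z "chart_map c x0"] y0 e(1) by (simp add: dist_commute)
  qed
  then show "z \<in> interior ?S \<inter> ball a e" using reach_int[OF z zk] by simp
qed


section \<open>Globalization\<close>

text \<open>By invariance of domain.\<close>

lemma chart_interior_independent:
  fixes A :: "('m, 'n::finite) chart set"
  assumes atlas: "smooth_atlas X A" and c: "c \<in> A" and d: "d \<in> A" and x: "x \<in> chart_dom c" "x \<in> chart_dom d"
    and int: "chart_map c x \<in> interior (chart_img c)"
  shows "chart_map d x \<in> interior (chart_img d)"
proof -
  let ?W = "chart_map c ` (chart_dom c \<inter> chart_dom d)" and ?f = "chart_map d \<circ> chart_inv c"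
  have "smooth_on ?W ?f" using atlas c d by (simp add: smooth_atlas_def)
  then have "Ck_on 0 ?W ?f" unfolding smooth_on_def by (rule spec)
  then have cont: "continuous_on (interior ?W) ?f"
    using interior_subset by (auto intro: continuous_on_subset)
  have f: "?f (chart_map c x') = chart_map d x'" if "x' \<in> chart_dom c" for x'
    using chart_basics(3)[OF atlas c that] by simp
  have "inj_on ?f ?W"
  proof (rule inj_onI)
    fix y z assume "y \<in> ?W" "z \<in> ?W" and eq: "?f y = ?f z"
    then obtain y' z' where yz: "y' \<in> chart_dom c" "y' \<in> chart_dom d" "y = chart_map c y'"
      "z' \<in> chart_dom c" "z' \<in> chart_dom d" "z = chart_map c z'" by auto
    then have "chart_map d y' = chart_map d z'" using eq f by simp
    then have "y' = z'" by (rule inj_onD[OF chart_basics(2)[OF atlas d] _ yz(2,5)])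
    then show "y = z" using yz by simp
  qed
  then have "inj_on ?f (interior ?W)" using interior_subset by (rule inj_on_subset)
  with cont have op: "open (?f ` interior ?W)" by (intro invariance_of_domain) auto
  show ?thesis
  proof (rule interiorI[OF op])
    show "chart_map d x \<in> ?f ` interior ?W"
      using f[OF x(1)] transition_interior[OF assms] by (intro image_eqI[of _ _ "chart_map c x"]) auto
    show "?f ` interior ?W \<subseteq> chart_img d"
    proof
      fix w assume "w \<in> ?f ` interior ?W"
      then obtain y where y: "y \<in> ?W" "w = ?f y" using interior_subset by blast
      then obtain x' where "x' \<in> chart_dom c" "x' \<in> chart_dom d" "y = chart_map c x'" by auto
      then show "w \<in> chart_img d" using f chart_basics(4)[OF atlas d] y(2) by simp
    qed
  qed
qed

text \<open>A finite subcover together with monotonicity in the constant. It is applied to the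
  values of a solution and to the gradient estimate, hence the arbitrary \<open>P\<close>.\<close>

lemma compact_uniform_bound:
  fixes P :: "'a \<Rightarrow> real \<Rightarrow> bool"
  assumes X: "compact_space X" and mono: "\<And>x C C'. P x C \<Longrightarrow> C \<le> C' \<Longrightarrow> P x C'"
    and loc: "\<And>x. x \<in> topspace X \<Longrightarrow> \<exists>N C. openin X N \<and> x \<in> N \<and> (\<forall>x'\<in>N. P x' C)"
  obtains C where "0 < C" "\<And>x. x \<in> topspace X \<Longrightarrow> P x C"
proof -
  have "\<forall>x\<in>topspace X. \<exists>N. \<exists>C. openin X N \<and> x \<in> N \<and> (\<forall>x'\<in>N. P x' C)" using loc by simp
  then obtain N where "\<forall>x\<in>topspace X. \<exists>C. openin X (N x) \<and> x \<in> N x \<and> (\<forall>x'\<in>N x. P x' C)"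
    by (rule bchoice[THEN exE])
  then obtain C where NC: "\<forall>x\<in>topspace X. openin X (N x) \<and> x \<in> N x \<and> (\<forall>x'\<in>N x. P x' (C x))"
    by (rule bchoice[THEN exE])
  have cov: "(\<forall>V\<in>N ` topspace X. openin X V) \<and> topspace X \<subseteq> \<Union> (N ` topspace X)" using NC by auto
  obtain F where F: "finite F" "F \<subseteq> N ` topspace X" "topspace X \<subseteq> \<Union> F"
    using X[unfolded compact_space_alt, rule_format, of "N ` topspace X"] cov by auto
  obtain T where T: "T \<subseteq> topspace X" "finite T" "F = N ` T"
    using finite_subset_image[OF F(1,2)] by auto
  define D where "D = 1 + (\<Sum>x\<in>T. \<bar>C x\<bar>)"
  have "P x D" if x: "x \<in> topspace X" for x
  proof -
    obtain y where y: "y \<in> T" "x \<in> N y" using F(3) x T(3) by auto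
    have "\<bar>C y\<bar> \<le> (\<Sum>x\<in>T. \<bar>C x\<bar>)" using T(2) y(1) by (intro member_le_sum) auto
    then have "C y \<le> D" by (simp add: D_def)
    moreover have "P x (C y)" using NC y T(1) by auto
    ultimately show ?thesis by (rule mono[rotated])
  qed
  moreover have "0 < D" by (simp add: D_def add_pos_nonneg sum_nonneg)
  ultimately show thesis using that by simp
qed

lemma atlas_cover:
  assumes "smooth_atlas X A" "x \<in> topspace X"
  obtains c where "c \<in> A" "x \<in> chart_dom c"
proof -
  have "x \<in> (\<Union>c\<in>A. chart_dom c)" using assms unfolding smooth_atlas_def by simp
  then show thesis by (rule UN_E) (rule that)
qed

lemma chart_neighbourhood:
  assumes atlas: "smooth_atlas X A" and c: "c \<in> A"
  shows "openin X {x \<in> chart_dom c. chart_map c x \<in> ball a e}"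
proof -
  have ts: "topspace (subtopology X (chart_dom c)) = chart_dom c"
    using openin_subset[OF chart_basics(1)[OF atlas c]] by (auto simp: topspace_subtopology)
  have "openin (top_of_set (chart_img c)) (chart_img c \<inter> ball a e)" by (rule openin_open_Int) simp
  then have "openin (subtopology X (chart_dom c))
      {x \<in> topspace (subtopology X (chart_dom c)). chart_map c x \<in> chart_img c \<inter> ball a e}"
    by (rule openin_continuous_map_preimage[OF chart_basics(8)[OF atlas c]])
  also have "{x \<in> topspace (subtopology X (chart_dom c)). chart_map c x \<in> chart_img c \<inter> ball a e}
      = {x \<in> chart_dom c. chart_map c x \<in> ball a e}"
    unfolding ts using chart_basics(4)[OF atlas c] by auto
  finally show ?thesis using openin_open_subtopology[OF chart_basics(1)[OF atlas c]] by simp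
qed

text \<open>The bound on u in the theorem is a real supremum, which controls the values only if they
  are bounded above; continuity on a compact space supplies this.\<close>

lemma C3_fun_bounded:
  assumes X: "compact_space X" and atlas: "smooth_atlas X A" and u: "C3_fun A u"
  shows "bdd_above ((\<lambda>x. \<bar>u x\<bar>) ` topspace X)"
proof -
  obtain C where "\<And>x. x \<in> topspace X \<Longrightarrow> \<bar>u x\<bar> \<le> C"
  proof (rule compact_uniform_bound[OF X, where P = "\<lambda>x C. \<bar>u x\<bar> \<le> C"])
    fix x assume "x \<in> topspace X"
    then obtain c where c: "c \<in> A" "x \<in> chart_dom c" by (rule atlas_cover[OF atlas])
    let ?a = "chart_map c x"
    have a: "?a \<in> chart_img c" by (rule chart_basics(4)[OF atlas c])
    have "Ck_on (Suc (Suc (Suc 0))) (chart_img c) (u \<circ> chart_inv c)"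
      using u c(1) by (simp add: C3_fun_def numeral_3_eq_3)
    then have "Ck_on 0 (chart_img c) (u \<circ> chart_inv c)" by (rule Ck_on_Suc_imp[OF Ck_on_Suc_imp[OF Ck_on_Suc_imp]])
    then have "continuous_on (chart_img c) (u \<circ> chart_inv c)" by simp
    from bspec[OF this[unfolded continuous_on_iff] a]
    have "\<forall>e>0. \<exists>d>0. \<forall>y\<in>chart_img c. dist y ?a < d \<longrightarrow> dist ((u \<circ> chart_inv c) y) ((u \<circ> chart_inv c) ?a) < e" .
    then obtain d where d: "0 < d" "\<forall>y\<in>chart_img c. dist y ?a < d \<longrightarrow> dist ((u \<circ> chart_inv c) y) ((u \<circ> chart_inv c) ?a) < 1"
      using zero_less_one by blast
    have "\<bar>u x'\<bar> \<le> \<bar>u x\<bar> + 1" if x': "x' \<in> {x \<in> chart_dom c. chart_map c x \<in> ball ?a d}" for x'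
    proof -
      have "x' \<in> chart_dom c" "dist (chart_map c x') ?a < d" using x' by (auto simp: dist_commute)
      then have "dist ((u \<circ> chart_inv c) (chart_map c x')) ((u \<circ> chart_inv c) ?a) < 1"
        using d(2) chart_basics(4)[OF atlas c(1)] by blast
      then show ?thesis
        using chart_basics(3)[OF atlas c(1)] c(2) \<open>x' \<in> chart_dom c\<close> by (simp add: dist_real_def)
    qed
    then show "\<exists>N C. openin X N \<and> x \<in> N \<and> (\<forall>x'\<in>N. \<bar>u x'\<bar> \<le> C)"
      using chart_neighbourhood[OF atlas c(1)] c(2) d(1)
      by (intro exI[of _ "{x \<in> chart_dom c. chart_map c x \<in> ball ?a d}"] exI[of _ "\<bar>u x\<bar> + 1"]) auto
  qed (auto intro: that)
  then show ?thesis by (intro bdd_aboveI2)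
qed

text \<open>Connects the Hessian and gradient, defined by iterated \<open>partial_deriv\<close>
  within the chart image, with the jet of the coordinate expression of \<open>u\<close>; at interior
  points both are ordinary derivatives.\<close>

lemma chart_hessian_eq:
  fixes A :: "('m, 'n::finite) chart set"
  assumes jet: "C3_jet U (u \<circ> chart_inv c) u1 u2 u3" and U: "open U" "U \<subseteq> interior (chart_img c)" and y: "y \<in> U"
    and cx: "chart_map c (chart_inv c y) = y"
  shows "v \<bullet> (hessian A g u c (chart_inv c y) *v w) = u2 y v w - u1 y (loc_Gam A g c y v w)"
    and "c \<in> A \<Longrightarrow> chart_inv c y \<in> chart_dom c \<Longrightarrow> grad A g u (chart_inv c y) c = loc_Q A g c y (gradv (u1 y))"
proof -
  let ?uc = "u \<circ> chart_inv c" and ?S = "chart_img c"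
  have pd: "partial_deriv ?S j ?uc y = u1 y (axis j 1)" if "y \<in> U" for y j
  proof -
    have yi: "y \<in> interior ?S" using that U(2) by blast
    have "u1 y = frechet_derivative ?uc (at y)" by (rule frechet_derivative_at[OF C3_jetD(1)[OF jet that]])
    then show ?thesis unfolding partial_deriv_def at_within_interior[OF yi] by (simp only:)
  qed
  have pd2: "partial_deriv ?S i (partial_deriv ?S j ?uc) y = u2 y (axis j 1) (axis i 1)" for i j
  proof -
    have "((\<lambda>y. partial_deriv ?S j ?uc y) has_derivative u2 y (axis j 1)) (at y)"
      by (rule has_derivative_transform_within_open[OF C3_jetD(2)[OF jet y] U(1) y]) (simp add: pd)
    then have eq: "u2 y (axis j 1) = frechet_derivative (\<lambda>y. partial_deriv ?S j ?uc y) (at y)"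
      by (rule frechet_derivative_at)
    have yi: "y \<in> interior ?S" using y U(2) by blast
    show ?thesis unfolding eq partial_deriv_def[of ?S i] at_within_interior[OF yi] ..
  qed
  have grd: "(\<chi> j. partial_deriv ?S j ?uc y) = gradv (u1 y)"
  proof -
    have "gradv (u1 y) $ j = u1 y (axis j 1)" for j
      using C3_jetD(9)[OF jet y, of "axis j 1"] by (simp add: inner_axis)
    then show ?thesis by (simp add: vec_eq_iff pd[OF y])
  qed
  show "grad A g u (chart_inv c y) c = loc_Q A g c y (gradv (u1 y))" if "c \<in> A" "chart_inv c y \<in> chart_dom c"
    using that by (simp add: grad_def loc_Q_def cx grd)
  define Ch where "Ch k i j = christoffel A g c (chart_inv c y) k i j" for k i j
  define q where "q k = u1 y (axis k 1)" for k
  have u2e: "u2 y v w = (\<Sum>i\<in>UNIV. \<Sum>j\<in>UNIV. u2 y (axis j 1) (axis i 1) * v $ i * w $ j)"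
  proof -
    note bl = C3_jetD(4)[OF jet y]
    have "u2 y v w = u2 y w v" by (rule C3_jetD(5)[OF jet y])
    also have "\<dots> = u2 y (\<Sum>j\<in>UNIV. w $ j *\<^sub>R axis j 1) (\<Sum>i\<in>UNIV. v $ i *\<^sub>R axis i 1)"
      using basis_expansion[of v] basis_expansion[of w] by (simp add: scalar_mult_eq_scaleR)
    also have "\<dots> = (\<Sum>i\<in>UNIV. \<Sum>j\<in>UNIV. v $ i * (w $ j * u2 y (axis j 1) (axis i 1)))"
      by (simp only: bilinear_expand[OF bl] sum_distrib_left)
    also have "\<dots> = (\<Sum>i\<in>UNIV. \<Sum>j\<in>UNIV. u2 y (axis j 1) (axis i 1) * v $ i * w $ j)"
      by (intro sum.cong refl) (simp only: mult_ac)
    finally show ?thesis .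
  qed
  have u1e: "u1 y (loc_Gam A g c y v w) = (\<Sum>i\<in>UNIV. \<Sum>j\<in>UNIV. (\<Sum>k\<in>UNIV. Ch k i j * q k) * v $ i * w $ j)"
  proof -
    have l: "linear (u1 y)" by (rule C3_jetD(8)[OF jet y])
    let ?z = "loc_Gam A g c y v w"
    have "u1 y ?z = u1 y (\<Sum>k\<in>UNIV. ?z $ k *\<^sub>R axis k 1)"
      using basis_expansion[of ?z] by (simp add: scalar_mult_eq_scaleR)
    also have "\<dots> = (\<Sum>k\<in>UNIV. ?z $ k * q k)"
      unfolding linear_sum[OF l] linear_cmul[OF l] q_def by simp
    also have "\<dots> = (\<Sum>k\<in>UNIV. \<Sum>i\<in>UNIV. \<Sum>j\<in>UNIV. Ch k i j * q k * v $ i * w $ j)"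
      unfolding loc_Gam_def christoffel_map_def vec_lambda_beta sum_distrib_right Ch_def
      by (intro sum.cong refl) (simp only: mult_ac)
    also have "\<dots> = (\<Sum>i\<in>UNIV. \<Sum>k\<in>UNIV. \<Sum>j\<in>UNIV. Ch k i j * q k * v $ i * w $ j)" by (rule sum.swap)
    also have "\<dots> = (\<Sum>i\<in>UNIV. \<Sum>j\<in>UNIV. \<Sum>k\<in>UNIV. Ch k i j * q k * v $ i * w $ j)"
      by (intro sum.cong refl sum.swap)
    also have "\<dots> = (\<Sum>i\<in>UNIV. \<Sum>j\<in>UNIV. (\<Sum>k\<in>UNIV. Ch k i j * q k) * v $ i * w $ j)"
      by (simp only: sum_distrib_right)
    finally show ?thesis .
  qed
  have "v \<bullet> (hessian A g u c (chart_inv c y) *v w)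
      = (\<Sum>i\<in>UNIV. \<Sum>j\<in>UNIV. (u2 y (axis j 1) (axis i 1) - (\<Sum>k\<in>UNIV. Ch k i j * q k)) * v $ i * w $ j)"
    unfolding matrix_form_sum hessian_def vec_lambda_beta cx pd2 pd[OF y] Ch_def q_def ..
  then show "v \<bullet> (hessian A g u c (chart_inv c y) *v w) = u2 y v w - u1 y (loc_Gam A g c y v w)"
    unfolding u2e u1e by (simp only: left_diff_distrib sum_subtractf)
qed

text \<open>The centre \<open>x\<close> may be a boundary point, and \<open>x0\<close> may be as
  close to the boundary as the ball permits. Only the radius \<delta> r enters, with \<delta> fixed
  by the chart, so one constant serves the neighbourhood. Keeping \<open>x0\<close> within
  \<open>e / 2\<close> of \<open>a\<close> leaves room for the coordinate balls inside the region of
  the coefficient bounds.\<close>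

lemma pointwise_gradient_estimate:
  fixes X :: "'m topology" and A :: "('m, 'n::finite) chart set"
  assumes atlas: "smooth_atlas X A" and g: "riemannian_metric A g" and \<Gamma>: "admissible_cone \<Gamma>"
    and f: "admissible_operator \<Gamma> f \<nu>0" and \<psi>: "admissible_rhs X A g \<psi> \<gamma> C\<psi>" and K: "0 \<le> K"
    and x: "x \<in> topspace X"
  shows "\<exists>N C. openin X N \<and> x \<in> N \<and> (\<forall>x0\<in>N. \<forall>u r. C3_fun A u \<longrightarrow> admissible_solution A g \<Gamma> f \<psi> u \<longrightarrow>
    (\<forall>x\<in>topspace X. \<bar>u x\<bar> \<le> K) \<longrightarrow> 0 < r \<longrightarrow> r < 1 \<longrightarrow> geodesic_ball X A g x0 r \<subseteq> manifold_interior X A \<longrightarrow>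
    gnorm g x0 (grad A g u x0) \<le> C / r)"
proof -
  obtain c where cA: "c \<in> A" "x \<in> chart_dom c" using x by (rule atlas_cover[OF atlas])
  let ?S = "chart_img c"
  define a where "a = chart_map c x"
  have a: "a \<in> ?S" unfolding a_def by (rule chart_basics(4)[OF atlas cA])
  obtain \<epsilon> c0 B where \<epsilon>: "0 < \<epsilon>" and le: "local_equation (interior ?S \<inter> ball a \<epsilon>) (loc_G A g c) (loc_dG A g c)
    (loc_Gam A g c) (loc_dGam A g c) (loc_Q A g c) (loc_dQ A g c) (rhs_local A \<psi> c) (loc_dPsi A \<psi> c) \<Gamma> f c0 B \<nu>0 \<gamma> C\<psi>"
    by (rule chart_local_equation[OF atlas g \<Gamma> f \<psi> cA(1) a]) (rule that)
  define U where "U = interior ?S \<inter> ball a \<epsilon>"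
  interpret local_equation U "loc_G A g c" "loc_dG A g c" "loc_Gam A g c" "loc_dGam A g c" "loc_Q A g c"
    "loc_dQ A g c" "rhs_local A \<psi> c" "loc_dPsi A \<psi> c" \<Gamma> f c0 B \<nu>0 \<gamma> C\<psi>
    unfolding U_def by (rule le)
  obtain C1 where C1: "0 < C1" and "\<forall>u u1 u2 u3 y R. C3_jet U u u1 u2 u3 \<longrightarrow> solves u u1 u2 \<longrightarrow>
      (\<forall>x\<in>U. \<bar>u x\<bar> \<le> K) \<longrightarrow> 0 < R \<longrightarrow> R \<le> 1 \<longrightarrow> cball y R \<subseteq> U \<longrightarrow> norm (gradv (u1 y)) \<le> C1 / R"
    using local_gradient_estimate[OF K] by (elim exE conjE) (rule that)
  note est = this(2)[rule_format]
  have "is_chart X c" using atlas cA(1) by (simp add: smooth_atlas_def)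
  then obtain k where "openin (top_of_set {y. 0 \<le> y $ k}) ?S" by (auto simp: is_chart_def)
  then obtain T where T: "?S = {y. 0 \<le> y $ k} \<inter> T" "open T" by (auto simp: openin_open)
  have "a \<in> T" using a T(1) by simp
  then obtain e0 where e0: "0 < e0" "ball a e0 \<subseteq> T" using T(2) open_contains_ball by blast
  define e where "e = min e0 \<epsilon>"
  have e: "0 < e" "ball a e \<subseteq> T" "e \<le> \<epsilon>" using e0 \<epsilon> by (auto simp: e_def)
  define \<delta> where "\<delta> = min (e / 8) (1 / (4 * B))"
  have \<delta>: "0 < \<delta>" "\<delta> \<le> e / 8" "\<delta> \<le> 1 / (4 * B)" using e(1) B by (auto simp: \<delta>_def)
  have "1 / (4 * B) \<le> 1" using B by simp
  then have \<delta>1: "\<delta> \<le> 1" using \<delta>(3) by simp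
  define N where "N = {x \<in> chart_dom c. chart_map c x \<in> ball a (e / 2)}"
  \<comment> \<open>The local estimate gives \<open>C1 / (\<delta> * r)\<close> for the Euclidean
    length of the coordinate gradient; the factor 1 / sqrt c0 converts it into the
    \<open>g\<close>-length of the gradient.\<close>
  define C where "C = C1 / \<delta> / sqrt c0"
  have "gnorm g x0 (grad A g u x0) \<le> C / r"
    if x0: "x0 \<in> N" and u: "C3_fun A u" and sol: "admissible_solution A g \<Gamma> f \<psi> u" and uK: "\<forall>x\<in>topspace X. \<bar>u x\<bar> \<le> K"
      and r: "0 < r" "r < 1" and ball: "geodesic_ball X A g x0 r \<subseteq> manifold_interior X A" for x0 u r
  proof -
    let ?uc = "u \<circ> chart_inv c"
    define y0 where "y0 = chart_map c x0"
    have x0c: "x0 \<in> chart_dom c" and y0a: "dist (chart_map c x0) a < e / 2"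
      using x0 by (auto simp: N_def dist_commute)
    have GB': "v \<bullet> (metric_matrix A g c (chart_inv c y) *v v) \<le> B * (norm v)\<^sup>2"
      if "y \<in> interior ?S \<inter> ball a e" for y v
    proof -
      have "y \<in> U" using that e(3) by (auto simp: U_def)
      from GB[OF this, of v v] show ?thesis by (simp add: loc_G_def power2_eq_square)
    qed
    have cb: "cball y0 (\<delta> * r) \<subseteq> interior ?S \<inter> ball a e" unfolding y0_def
      by (rule chart_ball_in_interior[OF atlas g cA(1) x0c T e(1,2) y0a B GB' r \<delta> ball])
    then have cbU: "cball y0 (\<delta> * r) \<subseteq> U" using e(3) by (auto simp: U_def)
    have Rpos: "0 < \<delta> * r" using \<delta> r by simp
    then have y0U: "y0 \<in> U" using cbU by auto
    have US: "y \<in> ?S" "chart_inv c y \<in> chart_dom c" "chart_map c (chart_inv c y) = y" if "y \<in> U" for y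
    proof -
      show "y \<in> ?S" using that interior_subset by (auto simp: U_def)
      then show "chart_inv c y \<in> chart_dom c" "chart_map c (chart_inv c y) = y"
        using chart_basics(5,6)[OF atlas cA(1)] by auto
    qed
    have "Ck_on 3 U ?uc"
      by (rule Ck_on_subset[of 3 ?S]) (use u cA(1) US(1) in \<open>auto simp: C3_fun_def\<close>)
    then obtain u1 u2 u3 where jet: "C3_jet U ?uc u1 u2 u3" by (rule C3_jet_exists[OF U])
    note hq = chart_hessian_eq[OF jet U]
    have Ui: "U \<subseteq> interior ?S" by (simp add: U_def)
    \<comment> \<open>\<psi> is evaluated at the gradient as a tangent vector, that is, at its
      components in all charts. To identify it with the vector computed in \<open>c\<close>, the
      point must be interior in every chart around it.\<close>
    have ip: "interior_point A (chart_inv c y)" if "y \<in> U" for y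
      unfolding interior_point_def
    proof (intro ballI impI)
      fix d assume d: "d \<in> A" "chart_inv c y \<in> chart_dom d"
      have "chart_map c (chart_inv c y) \<in> interior ?S" using US(3)[OF that] Ui that by auto
      then show "chart_map d (chart_inv c y) \<in> interior (chart_img d)"
        by (rule chart_interior_independent[OF atlas cA(1) d(1) US(2)[OF that] d(2)])
    qed
    have gradeq: "tvec A c (chart_inv c y) (loc_Q A g c y (gradv (u1 y))) = grad A g u (chart_inv c y)" if "y \<in> U" for y
      using grad_eq_tvec[OF atlas g u cA(1) US(2)[OF that] ip[OF that]]
        hq(2)[OF Ui that US(3)[OF that] cA(1) US(2)[OF that]] by simp
    have "solves ?uc u1 u2"
      unfolding solves_def
    proof
      fix y assume y: "y \<in> U"
      let ?x = "chart_inv c y"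
      have xd: "?x \<in> chart_dom c" by (rule US(2)[OF y])
      obtain lam where lam: "eigenvalues_wrt (metric_matrix A g c ?x) (hessian A g u c ?x) lam" "lam \<in> \<Gamma>"
        "f lam = \<psi> ?x (u ?x) (grad A g u ?x)"
        using sol cA(1) xd unfolding admissible_solution_def by blast
      have hessform: "v \<bullet> (hessian A g u c ?x *v w) = hess u1 u2 y v w" for v w
        unfolding hess_def by (rule hq(1)[OF Ui y US(3)[OF y]])
      have hs: "hess u1 u2 y v w = hess u1 u2 y w v" for v w
        using C3_jetD(5)[OF jet y] Gams[OF y] by (simp add: hess_def)
      have "hessian A g u c ?x $ i $ j = hess u1 u2 y (axis i 1) (axis j 1)" for i j
        unfolding hessform[symmetric] by (simp add: matrix_vector_mult_basis inner_axis' column_def)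
      then have Hs: "transpose (hessian A g u c ?x) = hessian A g u c ?x"
        using hs by (simp add: transpose_def vec_eq_iff)
      obtain E where E: "orthonormal_wrt (\<lambda>v w. v \<bullet> (metric_matrix A g c ?x *v w)) E"
        "\<And>i. hessian A g u c ?x *v E i = lam $ i *\<^sub>R (metric_matrix A g c ?x *v E i)"
        by (rule eigenframe_exists[OF metric_matrix_spd(1)[OF g cA(1) xd] metric_matrix_spd(2)[OF g cA(1) xd] Hs lam(1)])
          (assumption, rule that)
      have "orthonormal_wrt (loc_G A g c y) E" using E(1) by (simp add: loc_G_def[abs_def])
      moreover have "hess u1 u2 y (E i) v = lam $ i * loc_G A g c y (E i) v" for i v
      proof -
        have "hess u1 u2 y (E i) v = v \<bullet> (hessian A g u c ?x *v E i)" unfolding hessform by (rule hs)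
        also have "\<dots> = lam $ i * loc_G A g c y v (E i)" by (simp add: E(2) loc_G_def)
        also have "loc_G A g c y v (E i) = loc_G A g c y (E i) v" by (rule spd_formD(2)[OF G[OF y]])
        finally show ?thesis .
      qed
      moreover have "f lam = rhs_local A \<psi> c (y, ?uc y, loc_Q A g c y (gradv (u1 y)))"
        by (simp add: rhs_local_def gradeq[OF y] lam(3))
      ultimately show "\<exists>E lam. orthonormal_wrt (loc_G A g c y) E \<and>
          (\<forall>i v. hess u1 u2 y (E i) v = lam $ i * loc_G A g c y (E i) v) \<and> lam \<in> \<Gamma> \<and>
          f lam = rhs_local A \<psi> c (y, ?uc y, loc_Q A g c y (gradv (u1 y)))"
        using lam(2) by blast
    qed
    moreover have "\<bar>?uc y\<bar> \<le> K" if "y \<in> U" for y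
    proof -
      have "chart_inv c y \<in> topspace X"
        using US(2)[OF that] openin_subset[OF chart_basics(1)[OF atlas cA(1)]] by auto
      then show ?thesis using uK by simp
    qed
    moreover have "\<delta> * r \<le> 1" using \<delta> \<delta>1 r by (intro mult_le_one) auto
    ultimately have est0: "norm (gradv (u1 y0)) \<le> C1 / (\<delta> * r)"
      by (intro est[OF jet _ _ Rpos _ cbU]) auto
    have x0i: "chart_inv c y0 = x0" unfolding y0_def by (rule chart_basics(3)[OF atlas cA(1) x0c])
    let ?p = "gradv (u1 y0)"
    have "g x0 (grad A g u x0) (grad A g u x0) = loc_G A g c y0 (loc_Q A g c y0 ?p) (loc_Q A g c y0 ?p)"
      using gradeq[OF y0U] metric_form[OF g cA(1) x0c] by (simp add: loc_G_def x0i)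
    also have "\<dots> = ?p \<bullet> loc_Q A g c y0 ?p" by (rule GQ[OF y0U])
    also have "\<dots> \<le> norm ?p * norm (loc_Q A g c y0 ?p)" by (rule norm_cauchy_schwarz)
    also have "\<dots> \<le> norm ?p * (norm ?p / c0)" using norm_Q[OF y0U] by (intro mult_left_mono) auto
    also have "\<dots> = (norm ?p)\<^sup>2 / c0" by (simp add: power2_eq_square)
    finally have "gnorm g x0 (grad A g u x0) \<le> sqrt ((norm ?p)\<^sup>2 / c0)"
      unfolding gnorm_def by (rule real_sqrt_le_mono)
    also have "\<dots> = norm ?p / sqrt c0" by (simp add: real_sqrt_divide)
    also have "\<dots> \<le> C1 / (\<delta> * r) / sqrt c0" using est0 local_equation.c[OF local_equation_axioms] by (intro divide_right_mono) auto
    also have "\<dots> = C / r" by (simp add: C_def)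
    finally show ?thesis .
  qed
  moreover have "openin X N" unfolding N_def by (rule chart_neighbourhood[OF atlas cA(1)])
  moreover have "x \<in> N" using cA(2) e(1) by (simp add: N_def a_def)
  ultimately show ?thesis by blast
qed

theorem theorem1p1:
  fixes X :: "'m topology"
    and A :: "('m, 'n::finite) chart set"
    and g :: "('m, 'n) metric"
    and \<Gamma> :: "(real^'n) set"
    and f :: "real^'n \<Rightarrow> real"
    and \<psi> :: "('m, 'n) rhs"
    and \<nu>0 \<gamma> C\<psi> K :: real
  assumes dim: "2 \<le> CARD('n)"
    and M: "compact_riemannian_manifold_with_boundary X A g"
    and \<Gamma>: "admissible_cone \<Gamma>"
    and f: "admissible_operator \<Gamma> f \<nu>0"
    and \<psi>: "admissible_rhs X A g \<psi> \<gamma> C\<psi>"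
    and K: "0 \<le> K"
  shows "\<exists>C>0. \<forall>u. C3_fun A u \<and> admissible_solution A g \<Gamma> f \<psi> u \<and>
             (SUP x\<in>topspace X. \<bar>u x\<bar>) \<le> K \<longrightarrow>
           (\<forall>x0\<in>topspace X. \<forall>r. 0 < r \<and> r < 1 \<and>
              geodesic_ball X A g x0 r \<subseteq> manifold_interior X A \<longrightarrow>
              gnorm g x0 (grad A g u x0) \<le> C / r)"
proof -
  have X: "compact_space X" and atlas: "smooth_atlas X A" and g: "riemannian_metric A g"
    using M by (auto simp: compact_riemannian_manifold_with_boundary_def)
  define P where "P x0 C \<longleftrightarrow> (\<forall>u r. C3_fun A u \<longrightarrow> admissible_solution A g \<Gamma> f \<psi> u \<longrightarrow>
    (\<forall>x\<in>topspace X. \<bar>u x\<bar> \<le> K) \<longrightarrow> 0 < r \<longrightarrow> r < 1 \<longrightarrow> geodesic_ball X A g x0 r \<subseteq> manifold_interior X A \<longrightarrow>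
    gnorm g x0 (grad A g u x0) \<le> C / r)" for x0 and C :: real
  obtain C where C: "0 < C" "\<And>x. x \<in> topspace X \<Longrightarrow> P x C"
  proof (rule compact_uniform_bound[OF X, of P])
    show "P x C'" if "P x C" "C \<le> C'" for x C C'
      unfolding P_def
    proof (intro allI impI)
      fix u and r :: real
      assume *: "C3_fun A u" "admissible_solution A g \<Gamma> f \<psi> u" "\<forall>x\<in>topspace X. \<bar>u x\<bar> \<le> K"
        "0 < r" "r < 1" "geodesic_ball X A g x r \<subseteq> manifold_interior X A"
      have "gnorm g x (grad A g u x) \<le> C / r" using that(1) * unfolding P_def by blast
      also have "\<dots> \<le> C' / r" using that(2) *(4) by (simp add: divide_right_mono)
      finally show "gnorm g x (grad A g u x) \<le> C' / r" .
    qed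
    show "\<exists>N C. openin X N \<and> x \<in> N \<and> (\<forall>x'\<in>N. P x' C)" if "x \<in> topspace X" for x
      unfolding P_def by (rule pointwise_gradient_estimate[OF atlas g \<Gamma> f \<psi> K that])
  qed (rule that)
  have "gnorm g x0 (grad A g u x0) \<le> C / r"
    if u: "C3_fun A u" "admissible_solution A g \<Gamma> f \<psi> u" "(SUP x\<in>topspace X. \<bar>u x\<bar>) \<le> K"
      and x0: "x0 \<in> topspace X" and r: "0 < r" "r < 1" "geodesic_ball X A g x0 r \<subseteq> manifold_interior X A" for u x0 r
  proof -
    have "\<bar>u x\<bar> \<le> K" if "x \<in> topspace X" for x
      using cSUP_upper[OF that C3_fun_bounded[OF X atlas u(1)]] u(3) by simp
    then show ?thesis using C(2)[OF x0] u r unfolding P_def by blast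
  qed
  then show ?thesis using C(1) by blast
qed

end
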